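(* Let $(\mathbf{x}_i,\mathbf{y}_i)$, $i=1,\dots,n$, with $\mathbf{x}_i\in\mathbb{R}^d$, $\mathbf{y}_i\in\mathbb{R}$ (the $\mathbf{x}_i$ may be fixed or random), satisfy: conditioned on $\{\mathbf{x}_i\}_{i=1,\dots,n}$, the $\mathbf{y}_i$ are independent (not necessarily identically distributed) and there is a constant $\sigma\ge 0$ with $\mathbf{E}\big[e^{t(\mathbf{y}_i-\mathbf{E}\mathbf{y}_i)}\,\big|\,\{\mathbf{x}_i\}\big]\le e^{\sigma^2t^2/2}$ for all $i$ and all $t\in\mathbb{R}$. Let $\hat A=\frac1n\sum_{i=1}^n\mathbf{x}_i\mathbf{x}_i^T$, let $\lambda\ge0$ be the regularization parameter, and let $\hat\beta$ be the solution of $$\hat\beta=\arg\min_{\beta\in\mathbb{R}^d}\Big[\frac1n\sum_{i=1}^n(\beta^T\mathbf{x}_i-\mathbf{y}_i)^2+\lambda\|\beta\|_1\Big].$$ Consider any fixed target vector $\bar\beta\in\mathbb{R}^d$ and a positive constant $a>0$. Given $\delta\in(0,1)$, with probability larger than $1-\delta$ the following two claims hold for $q=1,p$ and for all integers $k,\ell$ such that $k\le\ell\le(d-k)/2$, all $t\in(0,1)$ and all $p\in[1,\infty]$: (1) If $t\le 1-\pi^{(p)}_{\hat A,k+\ell,\ell}k^{1-1/p}/\ell$, $\lambda\ge\frac{4(2-t)}{t}\Big(\sigma a\sqrt{\frac2n\ln(2d/\delta)}+\big\|\frac1n\sum_{i=1}^n(\bar\beta^T\mathbf{x}_i-\mathbf{E}\mathbf{y}_i)\mathbf{x}_i\big\|_\infty\Big)$,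 and $(\sup_j\hat A_{j,j})^{1/2}\le a$, then $$\|\hat\beta-\bar\beta\|_q\le\frac{8k^{1/q-1/p}}{t\,\omega^{(p)}_{\hat A,k+\ell}}\big[\rho^{(p)}_{\hat A,k+\ell}r_k^{(p)}(\bar\beta)+k^{1/p}\lambda\big]+\frac{32k^{1/q-1/p}}{t}\pi^{(p)}_{\hat A,k+\ell,\ell}\,r_k^{(1)}(\bar\beta)\ell^{-1}+4k^{1/q-1/p}r_k^{(p)}(\bar\beta)+4r_k^{(1)}(\bar\beta)\ell^{1/q-1}.$$ (2) If $t\le 1-\gamma^{(p)}_{\hat A,k+\ell,\ell}k^{1-1/p}/\ell$, $\lambda\ge\frac{4(2-t)}{t}\Big(\sigma a\sqrt{\frac2n\ln(2d/\delta)}+\big\|\frac1n\sum_{i=1}^n(\bar\beta^T\mathbf{x}_i-\mathbf{E}\mathbf{y}_i)\mathbf{x}_i\big\|_\infty\Big)$, and $(\sup_j\hat A_{j,j})^{1/2}\le a$, then $$\|\hat\beta-\bar\beta\|_q\le\frac{8k^{1/q-1/p}}{t}\big[4\gamma^{(p)}_{\hat A,k+\ell,\ell}\ell^{-1}r_k^{(1)}(\bar\beta)+\lambda(k+\ell)^{1/p}/\mu^{(p)}_{\hat A,k+\ell}\big]+4r_k^{(1)}(\bar\beta)\ell^{1/q-1}.$$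
   Context: $\mathbf{E}\mathbf{y}_i$ denotes the (conditional, given $\{\mathbf{x}_i\}$) expectation. $\|\cdot\|_p$ is the usual $\ell_p$ norm on vectors; $1/\infty=0$. "With probability $1-\delta$: if $X$ then $Y$" can be read as: with that probability either $X$ is false or $Y$ is true. For $\beta\in\mathbb{R}^d$ with $|\beta_{(1)}|\ge\cdots\ge|\beta_{(d)}|$ in descending order, $r_k^{(p)}(\beta)=\big(\sum_{j=k+1}^d|\beta_{(j)}|^p\big)^{1/p}$ (the $p$-norm of the $d-k$ smallest components in absolute value). For a positive semi-definite $A\in\mathbb{R}^{d\times d}$ and $k,\ell\ge1$ with $k+\ell\le d$, let $I,J$ range over disjoint subsets of $\{1,\dots,d\}$ with $k$ and $\ell$ elements, $A_{I,J}$ be the restriction of $A$ to row indices $I$ and column indices $J$, and $\mathbf{v}\in\mathbb{R}^k$, $\mathbf{u}\in\mathbb{R}^\ell$ range over (nonzero) vectors. Define, for $p\in[1,\infty]$, $$\rho^{(p)}_{A,k}=\sup_{\mathbf{v},I}\frac{\|A_{I,I}\mathbf{v}\|_p}{\|\mathbf{v}\|_p},\quad \mu^{(p)}_{A,k}=\inf_{\mathbf{v},I}\frac{\|A_{I,I}\mathbf{v}\|_p}{\|\mathbf{v}\|_p},\quad \gamma^{(p)}_{A,k,\ell}=\sup_{\mathbf{u},I,J}\frac{\|A_{I,I}^{-1}A_{I,J}\mathbf{u}\|_p}{\|\mathbf{u}\|_\infty}.$$ With $\mathbf{v}^{p-1}=[|\mathbf{v}_1|^{p-1}\mathrm{sgn}(\mathbf{v}_1),\dots,|\mathbf{v}_k|^{p-1}\mathrm{sgn}(\mathbf{v}_k)]$,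 $$\omega^{(p)}_{A,k}=\inf_{\mathbf{v},I}\frac{\max(0,\mathbf{v}^TA_{I,I}\mathbf{v}^{p-1})}{\|\mathbf{v}\|_p^p},\qquad \pi^{(p)}_{A,k,\ell}=\sup_{\mathbf{v},\mathbf{u},I,J}\frac{(\mathbf{v}^{p-1})^TA_{I,J}\mathbf{u}\,\|\mathbf{v}\|_p}{\max(0,\mathbf{v}^TA_{I,I}\mathbf{v}^{p-1})\,\|\mathbf{u}\|_\infty}.$$ Reading conventions: a ratio with zero denominator is $+\infty$; $\gamma^{(p)}_{A,k,\ell}=+\infty$ if some $A_{I,I}$ with $|I|=k$ is singular; for $p=\infty$ the vector $\mathbf{v}^{p-1}/\|\mathbf{v}\|_p^{p-1}$ is understood as its limit as $p\to\infty$, i.e. the vector with entries $\mathrm{sgn}(\mathbf{v}_i)/m$ where $|\mathbf{v}_i|=\|\mathbf{v}\|_\infty$ ($m$ being the number of such $i$) and $0$ elsewhere.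
   Formalization: For λ=0, "the solution" is taken to mean that the minimiser is almost surely unique (for λ>0 any minimiser is allowed); without this the claim fails, e.g. σ=0, y=0, target 0, Â=I−(1/5)11ᵀ, d=5, k=ℓ=1, p=∞, t=1/2, where the bound is 0 but every c·1 is a minimiser. *)

theory Defs
  imports "HOL-Probability.Probability"
begin

section \<open>Vectors\<close>

text \<open>Exponents \<open>p\<close> range over the extended reals in \<open>[1,\<infinity>]\<close>. \<open>inv_exp p\<close> is \<open>1/p\<close>, with \<open>1/\<infinity> = 0\<close>.\<close>

definition inv_exp :: "ereal \<Rightarrow> real" where
  "inv_exp p = real_of_ereal (1 / p)"

definition pnorm :: "ereal \<Rightarrow> real ^ 'd \<Rightarrow> real" where
  "pnorm p v = (if p = \<infinity> then infnorm v
     else (\<Sum>i\<in>UNIV. \<bar>v $ i\<bar> powr real_of_ereal p) powr inv_exp p)"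

definition abs_desc :: "real ^ 'd \<Rightarrow> real list" where
  "abs_desc \<beta> = rev (sorted_list_of_multiset (image_mset (\<lambda>j. \<bar>\<beta> $ j\<bar>) (mset_set UNIV)))"

text \<open>Lists are indexed from 0, so \<open>abs_desc \<beta> ! j\<close> for \<open>k \<le> j < d\<close> are
  the magnitudes of the ordered components number \<open>k + 1, \<dots>, d\<close>.\<close>

definition tail_norm :: "ereal \<Rightarrow> nat \<Rightarrow> real ^ 'd \<Rightarrow> real" where
  "tail_norm p k \<beta> = (if p = \<infinity> then Max (insert 0 ((\<lambda>j. abs_desc \<beta> ! j) ` {k..<CARD('d)}))
     else (\<Sum>j = k..<CARD('d). (abs_desc \<beta> ! j) powr real_of_ereal p) powr inv_exp p)"

text \<open>The vector written \<open>v\<^sup>p\<^sup>-\<^sup>1\<close>. For \<open>p = \<infinity>\<close> it stands for the limit of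
  \<open>v\<^sup>p\<^sup>-\<^sup>1\<close> divided by the power \<open>p - 1\<close> of the \<open>p\<close>-norm of \<open>v\<close> (for \<open>v \<noteq> 0\<close>).\<close>

definition sgn_pow :: "ereal \<Rightarrow> real ^ 'd \<Rightarrow> real ^ 'd" where
  "sgn_pow p v = (if p = \<infinity>
     then (\<chi> i. if \<bar>v $ i\<bar> = infnorm v
                then sgn (v $ i) / real (card {j. \<bar>v $ j\<bar> = infnorm v}) else 0)
     else (\<chi> i. \<bar>v $ i\<bar> powr (real_of_ereal p - 1) * sgn (v $ i)))"

section \<open>Submatrices and the sparse eigenvalue-type quantities\<close>

text \<open>For an index set \<open>I\<close>, the space of vectors indexed by \<open>I\<close> is represented by the vectors
  of the full space that vanish outside \<open>I\<close>; likewise \<open>A\<^sub>I\<^sub>,\<^sub>J\<close> is padded with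
  zeros. Padding changes neither products nor \<open>p\<close>-norms. The inverse of \<open>A\<^sub>I\<^sub>,\<^sub>I\<close> is
  the inverse with respect to the identity matrix on \<open>I\<close>.\<close>

definition nonzero_on :: "'d set \<Rightarrow> (real ^ 'd) set" where
  "nonzero_on I = {v. v \<noteq> 0 \<and> (\<forall>i. i \<notin> I \<longrightarrow> v $ i = 0)}"

definition submat :: "'d set \<Rightarrow> 'd set \<Rightarrow> real ^ 'd ^ 'd \<Rightarrow> real ^ 'd ^ 'd" where
  "submat I J A = (\<chi> i j. if i \<in> I \<and> j \<in> J then A $ i $ j else 0)"

definition is_submat_inv :: "'d set \<Rightarrow> real ^ 'd ^ 'd \<Rightarrow> real ^ 'd ^ 'd \<Rightarrow> bool" where
  "is_submat_inv I A B \<longleftrightarrow> submat I I B = B \<and>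
     submat I I A ** B = submat I I (mat 1) \<and> B ** submat I I A = submat I I (mat 1)"

definition submat_inv :: "'d set \<Rightarrow> real ^ 'd ^ 'd \<Rightarrow> real ^ 'd ^ 'd" where
  "submat_inv I A = (THE B. is_submat_inv I A B)"

text \<open>A quotient whose value is \<open>+\<infinity>\<close> whenever the denominator is zero; the library
  quotient of extended reals would give \<open>0 / 0 = 0\<close>.\<close>

definition eratio :: "ereal \<Rightarrow> ereal \<Rightarrow> ereal" where
  "eratio a b = (if b = 0 then \<infinity> else a / b)"

definition rho :: "ereal \<Rightarrow> real ^ 'd ^ 'd \<Rightarrow> nat \<Rightarrow> ereal" where
  "rho p A k = (SUP I\<in>{I. card I = k}. SUP v\<in>nonzero_on I.
     eratio (pnorm p (submat I I A *v v)) (pnorm p v))"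

definition mu :: "ereal \<Rightarrow> real ^ 'd ^ 'd \<Rightarrow> nat \<Rightarrow> ereal" where
  "mu p A k = (INF I\<in>{I. card I = k}. INF v\<in>nonzero_on I.
     eratio (pnorm p (submat I I A *v v)) (pnorm p v))"

definition gam :: "ereal \<Rightarrow> real ^ 'd ^ 'd \<Rightarrow> nat \<Rightarrow> nat \<Rightarrow> ereal" where
  "gam p A k l = (if \<exists>I. card I = k \<and> \<not> (\<exists>B. is_submat_inv I A B) then \<infinity>
     else (SUP I\<in>{I. card I = k}. SUP J\<in>{J. card J = l \<and> I \<inter> J = {}}. SUP u\<in>nonzero_on J.
       eratio (pnorm p ((submat_inv I A ** submat I J A) *v u)) (pnorm \<infinity> u)))"

text \<open>For \<open>p = \<infinity>\<close> the vector \<open>sgn_pow p v\<close> is already normalised, so one power of the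
  norm remains in the denominator; \<open>ppi\<close> is unaffected by the normalisation.\<close>

definition omega :: "ereal \<Rightarrow> real ^ 'd ^ 'd \<Rightarrow> nat \<Rightarrow> ereal" where
  "omega p A k = (INF I\<in>{I. card I = k}. INF v\<in>nonzero_on I.
     eratio (max 0 (v \<bullet> (submat I I A *v sgn_pow p v)))
       (if p = \<infinity> then pnorm p v else pnorm p v powr real_of_ereal p))"

definition ppi :: "ereal \<Rightarrow> real ^ 'd ^ 'd \<Rightarrow> nat \<Rightarrow> nat \<Rightarrow> ereal" where
  "ppi p A k l = (SUP I\<in>{I. card I = k}. SUP J\<in>{J. card J = l \<and> I \<inter> J = {}}.
     SUP v\<in>nonzero_on I. SUP u\<in>nonzero_on J.
       eratio ((sgn_pow p v \<bullet> (submat I J A *v u)) * pnorm p v)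
         (max 0 (v \<bullet> (submat I I A *v sgn_pow p v)) * pnorm \<infinity> u))"

section \<open>The regression model\<close>

definition emp_mat :: "nat \<Rightarrow> (nat \<Rightarrow> real ^ 'd) \<Rightarrow> real ^ 'd ^ 'd" where
  "emp_mat n x = (1 / real n) *\<^sub>R (\<Sum>i = 1..n. (\<chi> j k. x i $ j * x i $ k))"

definition lasso_obj ::
  "nat \<Rightarrow> (nat \<Rightarrow> real ^ 'd) \<Rightarrow> (nat \<Rightarrow> real) \<Rightarrow> real \<Rightarrow> real ^ 'd \<Rightarrow> real" where
  "lasso_obj n x y lam \<beta> =
     (1 / real n) * (\<Sum>i = 1..n. (\<beta> \<bullet> x i - y i)\<^sup>2) + lam * pnorm 1 \<beta>"

text \<open>For \<open>lam > 0\<close> any minimiser is admitted. For \<open>lam = 0\<close> (ordinary least squares) the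
  phrase ``the solution'' is taken literally: the minimiser has to be unique. Otherwise, in the
  noiseless case \<open>y = 0\<close>, every kernel vector of the design is a minimiser, while the
  bounds of the theorem can be \<open>0\<close> for the target \<open>0\<close>. Example: an empirical second-moment
  matrix equal to the identity minus the all-\<open>1/5\<close> matrix, with
  \<open>d = 5\<close>, \<open>k = l = 1\<close>, \<open>p = \<infinity>\<close>, \<open>t = 1/2\<close>.\<close>

definition lasso_solution ::
  "nat \<Rightarrow> (nat \<Rightarrow> real ^ 'd) \<Rightarrow> (nat \<Rightarrow> real) \<Rightarrow> real \<Rightarrow> real ^ 'd \<Rightarrow> bool" where
  "lasso_solution n x y lam \<beta> \<longleftrightarrow> is_arg_min (lasso_obj n x y lam) (\<lambda>_. True) \<beta> \<and>
     (lam = 0 \<longrightarrow> (\<forall>\<beta>'. is_arg_min (lasso_obj n x y lam) (\<lambda>_. True) \<beta>' \<longrightarrow> \<beta>' = \<beta>))"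

text \<open>The \<open>\<sigma>\<close>-algebra generated by \<open>x\<^sub>1, \<dots>, x\<^sub>n\<close>.\<close>

definition design_alg :: "'w measure \<Rightarrow> nat \<Rightarrow> (nat \<Rightarrow> 'w \<Rightarrow> real ^ 'd) \<Rightarrow> 'w measure" where
  "design_alg M n x =
     vimage_algebra (space M) (\<lambda>w. \<lambda>i\<in>{1..n}. x i w) (Pi\<^sub>M {1..n} (\<lambda>_. borel))"

definition cond_mean ::
  "'w measure \<Rightarrow> nat \<Rightarrow> (nat \<Rightarrow> 'w \<Rightarrow> real ^ 'd) \<Rightarrow> (nat \<Rightarrow> 'w \<Rightarrow> real) \<Rightarrow> nat \<Rightarrow> 'w \<Rightarrow> real" where
  "cond_mean M n x y i = real_cond_exp M (design_alg M n x) (y i)"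

definition cond_indep_vars ::
  "'w measure \<Rightarrow> 'w measure \<Rightarrow> ('i \<Rightarrow> 'w \<Rightarrow> real) \<Rightarrow> 'i set \<Rightarrow> bool" where
  "cond_indep_vars M F Y I \<longleftrightarrow> (\<forall>i\<in>I. Y i \<in> borel_measurable M) \<and>
     (\<forall>J B. J \<subseteq> I \<and> finite J \<and> (\<forall>j\<in>J. B j \<in> sets borel) \<longrightarrow>
       (AE w in M. real_cond_exp M F (indicator {w \<in> space M. \<forall>j\<in>J. Y j w \<in> B j}) w =
          (\<Prod>j\<in>J. real_cond_exp M F (indicator {w \<in> space M. Y j w \<in> B j}) w)))"

text \<open>Since \<open>Y\<close> need not be integrable unconditionally, existence of the conditional mean is
  expressed by conditional integrability. The nonnegative conditional expectation is used for the
  moment generating function because it takes the value \<open>\<infinity>\<close> where that function is infinite.\<close>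

definition cond_subgaussian ::
  "'w measure \<Rightarrow> 'w measure \<Rightarrow> ('w \<Rightarrow> real) \<Rightarrow> real \<Rightarrow> bool" where
  "cond_subgaussian M F Y \<sigma> \<longleftrightarrow>
     (AE w in M. nn_cond_exp M F (\<lambda>w. ennreal \<bar>Y w\<bar>) w < \<infinity>) \<and>
     (\<forall>t. AE w in M. nn_cond_exp M F (\<lambda>w. ennreal (exp (t * (Y w - real_cond_exp M F Y w)))) w
        \<le> ennreal (exp (\<sigma>\<^sup>2 * t\<^sup>2 / 2)))"

end

theory Submission
  imports Defs
begin

text \<open>
  Write \<open>A\<close> for the empirical second-moment matrix, \<open>\<Delta> = bhat - bbar\<close>, and \<open>e\<close> for the average of
  \<open>(bbar \<bullet> x\<^sub>i - y\<^sub>i) x\<^sub>i\<close>. The quadratic loss makes the optimality condition of \<open>bhat\<close> linear in \<open>\<Delta>\<close>: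
  \<open>2 (A \<Delta> + e)\<close> is minus \<open>lam\<close> times a subgradient of the 1-norm at \<open>bhat\<close> (\<open>lasso_kkt\<close>). Once
  \<open>lam\<close> dominates the entries of \<open>e\<close>, everything else is deterministic.

  Let \<open>F\<close> carry the \<open>k\<close> largest entries of \<open>bbar\<close>. Pairing the optimality condition with \<open>\<Delta>\<close> gives the
  cone condition (\<open>cone_condition\<close>): up to \<open>4 r\<^sub>k\<^sup>(\<^sup>1\<^sup>)\<close>, the 1-norm of \<open>\<Delta>\<close> off \<open>F\<close> is at most
  \<open>(4 - t) / (4 - 3 t)\<close> times its 1-norm on \<open>F\<close>. This factor is at most \<open>3\<close>, and multiplied by
  \<open>1 - t\<close> it is at most \<open>1 - t / 2\<close>; the second property is what allows the threshold on \<open>t\<close> to close the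
  argument.

  Let \<open>J\<^sub>0\<close> be the \<open>l\<close> largest entries of \<open>\<Delta>\<close> off \<open>F\<close> and \<open>I = F \<union> J\<^sub>0\<close>. The entries
  off \<open>I\<close>, cut into blocks of size \<open>l\<close> in decreasing order, have block maxima that sum to at most \<open>1 / l\<close>
  times the 1-norm of \<open>\<Delta>\<close> off \<open>F\<close> (\<open>block_decomposition_bound\<close>). The action of each block on \<open>I\<close> is
  controlled by \<open>gam\<close> or \<open>ppi\<close>, so by the cone condition all blocks together cost at most the fraction
  \<open>1 - t / 2\<close> of the norm to be bounded, and that fraction is absorbed (\<open>gamma_bound\<close>, \<open>pi_bound\<close>). For
  \<open>gam\<close> one inverts \<open>A\<close> on \<open>I\<close>. For \<open>ppi\<close> one tests \<open>A \<Delta>\<close> with the dual vector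
  \<open>v\<^sup>p\<^sup>-\<^sup>1\<close> of the vector \<open>v\<close> that is \<open>\<Delta>\<close> on \<open>F\<close> and \<open>bhat\<close> on \<open>J\<^sub>0\<close>: the
  signs of \<open>bhat\<close> and of the gradient are opposite, so \<open>J\<^sub>0\<close> contributes nothing positive and only
  \<open>k\<close> coordinates pay the price \<open>lam\<close>. If \<open>lam = 0\<close>, then \<open>e = 0\<close>, the target is itself a minimiser, and
  \<open>\<Delta> = 0\<close> by uniqueness.

  The random part of \<open>e\<close> is a weighted sum of centred noises whose weights are functions of the design.
  Conditional independence lets one replace the factors of a product of functions of design and response, one
  factor at a time, by their conditional expectations (\<open>product_swap\<close>). With exponential factors this gives
  the Chernoff bound on the event that the diagonal of \<open>A\<close> is small (\<open>weighted_noise_tail\<close>). The bound is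
  strict because the indicator of an upper tail is everywhere strictly below the exponential that dominates
  it; hence the good event has probability strictly larger than \<open>1 - \<delta>\<close>.
\<close>

section \<open>The p-norms and their dual vectors\<close>

definition restr :: "'d set \<Rightarrow> real ^ 'd \<Rightarrow> real ^ 'd" where
  "restr F v = (\<chi> i. if i \<in> F then v $ i else 0)"

text \<open>The factor by which \<open>sgn_pow p v\<close> misses unit norm in the dual space: Hoelder's inequality for the
  dual vector reads \<open>sgn_pow p v \<bullet> z \<le> dual_scale p v * pnorm p z\<close>, with equality at \<open>z = v\<close>. It is
  \<open>1\<close> at infinity, where \<open>sgn_pow\<close> is already normalised.\<close>

definition dual_scale :: "ereal \<Rightarrow> real ^ 'd \<Rightarrow> real" where
  "dual_scale p v = (if p = \<infinity> then 1 else pnorm p v powr (real_of_ereal p - 1))"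

lemma restr_nth [simp]: "restr F v $ i = (if i \<in> F then v $ i else 0)"
  by (simp add: restr_def)

lemma exponent_cases:
  assumes "1 \<le> (p::ereal)"
  obtains (infinite) "p = \<infinity>" | (finite) r where "p = ereal r" "1 \<le> r" "inv_exp p = 1 / r"
  using assms by (cases p) (auto simp: inv_exp_def one_ereal_def)

lemma inv_exp_infinity [simp]: "inv_exp \<infinity> = 0"
  by (simp add: inv_exp_def)

lemma inv_exp_1 [simp]: "inv_exp 1 = 1"
  by (simp add: inv_exp_def one_ereal_def)

lemma inv_exp_le_1: "1 \<le> p \<Longrightarrow> inv_exp p \<le> 1"
  by (erule exponent_cases) auto

lemma pnorm_infinity: "pnorm \<infinity> v = infnorm v"
  by (simp add: pnorm_def)

lemma pnorm_ereal:
  "1 \<le> r \<Longrightarrow> pnorm (ereal r) v = (\<Sum>i\<in>UNIV. \<bar>v $ i\<bar> powr r) powr (1 / r)"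
  by (simp add: pnorm_def inv_exp_def one_ereal_def)

lemma pnorm_1: "pnorm 1 v = (\<Sum>i\<in>UNIV. \<bar>v $ i\<bar>)"
  by (simp add: one_ereal_def pnorm_ereal sum_nonneg)

lemma infnorm_le_iff:
  fixes v :: "real ^ 'd"
  shows "infnorm v \<le> c \<longleftrightarrow> (\<forall>i. \<bar>v $ i\<bar> \<le> c)"
proof
  assume "infnorm v \<le> c"
  then show "\<forall>i. \<bar>v $ i\<bar> \<le> c" using component_le_infnorm_cart[of v] order_trans by blast
next
  assume "\<forall>i. \<bar>v $ i\<bar> \<le> c"
  then show "infnorm v \<le> c"
    unfolding infnorm_cart by (intro cSup_least) auto
qed

lemma infnorm_attained: "\<exists>i. infnorm (v :: real ^ 'd) = \<bar>v $ i\<bar>"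
proof -
  have "{\<bar>v $ i\<bar> |i. i \<in> UNIV} = range (\<lambda>i. \<bar>v $ i\<bar>)" by auto
  then have "infnorm v = Max (range (\<lambda>i. \<bar>v $ i\<bar>))"
    unfolding infnorm_cart by (simp add: cSup_eq_Max)
  moreover have "Max (range (\<lambda>i. \<bar>v $ i\<bar>)) \<in> range (\<lambda>i. \<bar>v $ i\<bar>)"
    by (rule Max_in) auto
  ultimately show ?thesis by force
qed

lemma pnorm_nonneg: "0 \<le> pnorm p v"
  by (simp add: pnorm_def infnorm_pos_le)

lemma pnorm_0 [simp]: "pnorm p (0 :: real ^ 'd) = 0"
  by (simp add: pnorm_def infnorm_0)

lemma pnorm_power_sum:
  "1 \<le> r \<Longrightarrow> pnorm (ereal r) v powr r = (\<Sum>i\<in>UNIV. \<bar>v $ i\<bar> powr r)"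
  by (simp add: pnorm_ereal powr_powr sum_nonneg)

lemma pnorm_pos:
  assumes "1 \<le> p" "v \<noteq> 0"
  shows "0 < pnorm p v"
  using assms(1)
proof (cases rule: exponent_cases)
  case infinite
  then show ?thesis using assms by (simp add: pnorm_infinity infnorm_pos_lt)
next
  case (finite r)
  obtain i where "v $ i \<noteq> 0" using assms(2) by (auto simp: vec_eq_iff)
  then have "0 < (\<Sum>i\<in>UNIV. \<bar>v $ i\<bar> powr r)"
    by (intro sum_pos2[where i = i]) auto
  then show ?thesis using finite by (simp add: pnorm_ereal)
qed

lemma pnorm_mono:
  assumes "1 \<le> p" "\<And>i. \<bar>u $ i\<bar> \<le> \<bar>v $ i\<bar>"
  shows "pnorm p u \<le> pnorm p v"
  using assms(1)
proof (cases rule: exponent_cases)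
  case infinite
  have "\<bar>u $ i\<bar> \<le> infnorm v" for i using assms(2) component_le_infnorm_cart order_trans by blast
  then show ?thesis using infinite by (simp add: pnorm_infinity infnorm_le_iff)
next
  case (finite r)
  then show ?thesis using assms(2)
    by (auto simp: pnorm_ereal intro!: powr_mono2 sum_mono sum_nonneg)
qed

lemma dual_scale_pos: "1 \<le> p \<Longrightarrow> v \<noteq> 0 \<Longrightarrow> 0 < dual_scale p v"
  using pnorm_pos[of p v] by (auto simp: dual_scale_def)

lemma omega_denominator:
  assumes "1 \<le> p" "v \<noteq> 0"
  shows "(if p = \<infinity> then pnorm p v else pnorm p v powr real_of_ereal p) = dual_scale p v * pnorm p v"
  using assms(1)
proof (cases rule: exponent_cases)
  case (finite r)
  have "0 < pnorm p v" using assms by (rule pnorm_pos)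
  then show ?thesis using finite by (simp add: dual_scale_def powr_diff)
qed (simp add: dual_scale_def)

lemma sgn_pow_sgn: "sgn_pow p v $ i = \<bar>sgn_pow p v $ i\<bar> * sgn (v $ i)"
  by (auto simp: sgn_pow_def abs_mult sgn_if)

lemma sgn_pow_eq_0: "v $ i = 0 \<Longrightarrow> sgn_pow p v $ i = 0"
  by (simp add: sgn_pow_def)

lemma dual_pairing_self:
  fixes v :: "real ^ 'd"
  assumes "1 \<le> p" "v \<noteq> 0"
  shows "sgn_pow p v \<bullet> v = dual_scale p v * pnorm p v"
  using assms(1)
proof (cases rule: exponent_cases)
  case infinite
  define S where "S = {j. \<bar>v $ j\<bar> = infnorm v}"
  have "S \<noteq> {}" using infnorm_attained[of v] by (auto simp: S_def)
  then have "card S \<noteq> 0" by simp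
  have "sgn_pow p v $ i * v $ i = (if i \<in> S then infnorm v / card S else 0)" for i
    using infinite by (auto simp: sgn_pow_def S_def sgn_if)
  then have "sgn_pow p v \<bullet> v = (\<Sum>i\<in>UNIV. if i \<in> S then infnorm v / card S else 0)"
    by (simp add: inner_vec_def)
  also have "\<dots> = infnorm v" using \<open>card S \<noteq> 0\<close> by (simp add: sum.If_cases)
  finally show ?thesis using infinite by (simp add: dual_scale_def pnorm_infinity)
next
  case (finite r)
  have "sgn_pow p v $ i * v $ i = \<bar>v $ i\<bar> powr r" for i
  proof (cases "v $ i = 0")
    case False
    have "sgn_pow p v $ i * v $ i = \<bar>v $ i\<bar> powr (r - 1) * \<bar>v $ i\<bar>"
      using finite by (simp add: sgn_pow_def abs_sgn mult_ac)
    also have "\<dots> = \<bar>v $ i\<bar> powr r" using False by (simp add: powr_diff)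
    finally show ?thesis .
  qed simp
  then have "sgn_pow p v \<bullet> v = (\<Sum>i\<in>UNIV. \<bar>v $ i\<bar> powr r)"
    by (simp add: inner_vec_def)
  also have "\<dots> = pnorm p v powr r" using finite by (simp add: pnorm_power_sum)
  also have "\<dots> = dual_scale p v * pnorm p v" using omega_denominator[OF assms] finite by simp
  finally show ?thesis .
qed

text \<open>At infinity the dual vector is an average of signed coordinates. For finite \<open>p\<close> this is Hoelder's
  inequality: after dividing \<open>v\<close> and \<open>z\<close> by their norms, the weighted arithmetic-geometric mean inequality
  in each coordinate adds up to the weights \<open>1 - 1/p\<close> and \<open>1/p\<close>, that is, to \<open>1\<close>.\<close>

lemma dual_pairing_le:
  fixes v z :: "real ^ 'd"
  assumes "1 \<le> p" "v \<noteq> 0"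
  shows "sgn_pow p v \<bullet> z \<le> dual_scale p v * pnorm p z"
  using assms(1)
proof (cases rule: exponent_cases)
  case infinite
  define S where "S = {j. \<bar>v $ j\<bar> = infnorm v}"
  have "S \<noteq> {}" using infnorm_attained[of v] by (auto simp: S_def)
  then have "card S \<noteq> 0" by simp
  have "sgn_pow p v $ i * z $ i \<le> (if i \<in> S then infnorm z / card S else 0)" for i
  proof (cases "i \<in> S")
    case True
    have "sgn (v $ i) * z $ i \<le> \<bar>z $ i\<bar>" by (auto simp: sgn_if)
    also have "\<dots> \<le> infnorm z" by (rule component_le_infnorm_cart)
    finally show ?thesis using True infinite by (simp add: sgn_pow_def S_def divide_right_mono)
  qed (use infinite in \<open>simp add: sgn_pow_def S_def\<close>)
  then have "sgn_pow p v \<bullet> z \<le> (\<Sum>i\<in>UNIV. if i \<in> S then infnorm z / card S else 0)"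
    unfolding inner_vec_def by (intro sum_mono) simp
  also have "\<dots> = infnorm z" using \<open>card S \<noteq> 0\<close> by (simp add: sum.If_cases)
  finally show ?thesis using infinite by (simp add: dual_scale_def pnorm_infinity)
next
  case (finite r)
  show ?thesis
  proof (cases "z = 0")
    case False
    define V Z where "V = pnorm p v" and "Z = pnorm p z"
    have pos: "0 < V" "0 < Z" using assms False by (auto simp: V_def Z_def pnorm_pos)
    have sV: "(\<Sum>i\<in>UNIV. \<bar>v $ i\<bar> powr r) = V powr r" and sZ: "(\<Sum>i\<in>UNIV. \<bar>z $ i\<bar> powr r) = Z powr r"
      using finite by (simp_all add: V_def Z_def pnorm_power_sum)
    have "sgn_pow p v $ i * z $ i \<le> V powr (r - 1) * Z *
        ((1 - 1/r) * (\<bar>v $ i\<bar> powr r / V powr r) + 1/r * (\<bar>z $ i\<bar> powr r / Z powr r))" (is "_ \<le> ?R") for i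
    proof (cases "v $ i = 0 \<or> z $ i = 0")
      case True
      have "0 \<le> ?R" using pos finite by (intro mult_nonneg_nonneg add_nonneg_nonneg) auto
      then show ?thesis using True sgn_pow_eq_0[of v i p] by auto
    next
      case False
      define a b where "a = (\<bar>v $ i\<bar> / V) powr r" and "b = (\<bar>z $ i\<bar> / Z) powr r"
      have "a > 0" "b > 0" using False pos by (auto simp: a_def b_def)
      then have "a powr (1 - 1/r) * b powr (1/r) \<le> (1 - 1/r) * a + 1/r * b"
        using finite by (intro Youngs_inequality_0) auto
      moreover have "a powr (1 - 1/r) = \<bar>v $ i\<bar> powr (r - 1) / V powr (r - 1)"
        using finite pos by (simp add: a_def powr_powr powr_divide right_diff_distrib)
      moreover have "b powr (1/r) = \<bar>z $ i\<bar> / Z"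
        using finite pos by (simp add: b_def powr_powr)
      ultimately have "V powr (r - 1) * Z * (\<bar>v $ i\<bar> powr (r - 1) / V powr (r - 1) * (\<bar>z $ i\<bar> / Z)) \<le> V powr (r - 1) * Z * ((1 - 1/r) * a + 1/r * b)"
        using pos by (intro mult_left_mono) auto
      then have "\<bar>v $ i\<bar> powr (r - 1) * \<bar>z $ i\<bar> \<le> V powr (r - 1) * Z * ((1 - 1/r) * a + 1/r * b)"
        using pos by simp
      moreover have "sgn_pow p v $ i * z $ i \<le> \<bar>v $ i\<bar> powr (r - 1) * \<bar>z $ i\<bar>"
      proof -
        have "sgn_pow p v $ i * z $ i = \<bar>v $ i\<bar> powr (r - 1) * (sgn (v $ i) * z $ i)"
          using finite by (simp add: sgn_pow_def)
        also have "\<dots> \<le> \<bar>v $ i\<bar> powr (r - 1) * \<bar>z $ i\<bar>"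
          by (intro mult_left_mono) (auto simp: sgn_if)
        finally show ?thesis .
      qed
      ultimately show ?thesis using pos by (simp add: a_def b_def powr_divide)
    qed
    then have "sgn_pow p v \<bullet> z \<le> (\<Sum>i\<in>UNIV. V powr (r - 1) * Z *
        ((1 - 1/r) * (\<bar>v $ i\<bar> powr r / V powr r) + 1/r * (\<bar>z $ i\<bar> powr r / Z powr r)))"
      unfolding inner_vec_def by (intro sum_mono) simp
    also have "\<dots> = V powr (r - 1) * Z * ((1 - 1/r) * ((\<Sum>i\<in>UNIV. \<bar>v $ i\<bar> powr r) / V powr r)
        + 1/r * ((\<Sum>i\<in>UNIV. \<bar>z $ i\<bar> powr r) / Z powr r))"
      by (simp only: sum_distrib_left[symmetric] sum.distrib sum_divide_distrib[symmetric])
    also have "\<dots> = V powr (r - 1) * Z" using pos by (simp add: sV sZ)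
    finally show ?thesis using finite by (simp add: dual_scale_def V_def Z_def)
  qed simp
qed

text \<open>The dual vector of \<open>u + v\<close> attains the norm of \<open>u + v\<close> and is bounded by Hoelder's inequality on
  each summand.\<close>

lemma pnorm_triangle:
  assumes "1 \<le> p"
  shows "pnorm p (u + v) \<le> pnorm p u + pnorm p v"
proof (cases "u + v = 0")
  case False
  define w where "w = u + v"
  have "dual_scale p w * pnorm p w = sgn_pow p w \<bullet> u + sgn_pow p w \<bullet> v"
    using dual_pairing_self[OF assms, of w] False by (simp add: w_def inner_add_right)
  also have "\<dots> \<le> dual_scale p w * (pnorm p u + pnorm p v)"
    using dual_pairing_le[OF assms, of w] False by (simp add: w_def add_mono distrib_left)
  finally show ?thesis
    using dual_scale_pos[OF assms, of w] False by (simp add: w_def)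
next
  case True
  then show ?thesis using pnorm_nonneg[of p u] pnorm_nonneg[of p v] by simp
qed

lemma pnorm_le_of_bounded:
  fixes v :: "real ^ 'd"
  assumes "1 \<le> p" "F \<noteq> {}" "\<And>i. i \<notin> F \<Longrightarrow> v $ i = 0" "\<And>i. \<bar>v $ i\<bar> \<le> c"
  shows "pnorm p v \<le> c * real (card F) powr inv_exp p"
  using assms(1)
proof (cases rule: exponent_cases)
  case infinite
  have "card F \<noteq> 0" using assms(2) by simp
  then show ?thesis using infinite assms(4) by (simp add: pnorm_infinity infnorm_le_iff)
next
  case (finite r)
  have c: "0 \<le> c" using assms(4)[of undefined] by linarith
  have "(\<Sum>i\<in>UNIV. \<bar>v $ i\<bar> powr r) \<le> (\<Sum>i\<in>UNIV. if i \<in> F then c powr r else 0)"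
    using assms finite by (intro sum_mono) (auto intro!: powr_mono2)
  also have "\<dots> = real (card F) * c powr r" by (simp add: sum.If_cases)
  finally have "pnorm p v \<le> (real (card F) * c powr r) powr (1/r)"
    using finite by (auto simp: pnorm_ereal intro!: powr_mono2 sum_nonneg)
  also have "\<dots> = c * real (card F) powr inv_exp p"
    using finite c by (simp add: powr_mult powr_powr mult.commute)
  finally show ?thesis .
qed

text \<open>Hoelder's inequality against the vector of signs of \<open>v\<close> on \<open>F\<close>. It makes the
  penalty enter \<open>pi_bound\<close> with the factor \<open>k powr (1/p)\<close>.\<close>

lemma sum_abs_sgn_pow_le:
  fixes v :: "real ^ 'd"
  assumes "1 \<le> p" "v \<noteq> 0" "F \<noteq> {}"
  shows "(\<Sum>i\<in>F. \<bar>sgn_pow p v $ i\<bar>) \<le> dual_scale p v * real (card F) powr inv_exp p"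
proof -
  define z :: "real ^ 'd" where "z = (\<chi> i. if i \<in> F then sgn (v $ i) else 0)"
  have "sgn_pow p v $ i * z $ i = (if i \<in> F then \<bar>sgn_pow p v $ i\<bar> else 0)" for i
    using sgn_pow_sgn[of p v i] sgn_pow_eq_0[of v i p] by (auto simp: z_def sgn_if split: if_splits)
  then have "(\<Sum>i\<in>F. \<bar>sgn_pow p v $ i\<bar>) = sgn_pow p v \<bullet> z"
    by (simp add: inner_vec_def sum.If_cases)
  also have "\<dots> \<le> dual_scale p v * pnorm p z" using assms by (intro dual_pairing_le)
  also have "pnorm p z \<le> 1 * real (card F) powr inv_exp p"
    using assms by (intro pnorm_le_of_bounded) (auto simp: z_def sgn_if)
  finally show ?thesis using dual_scale_pos[OF assms(1,2)] by simp
qed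

lemma pnorm_1_le:
  fixes z :: "real ^ 'd"
  assumes "1 \<le> p" "F \<noteq> {}" "\<And>i. i \<notin> F \<Longrightarrow> z $ i = 0"
  shows "pnorm 1 z \<le> real (card F) powr (1 - inv_exp p) * pnorm p z"
  using assms(1)
proof (cases rule: exponent_cases)
  case infinite
  have "pnorm 1 z = (\<Sum>i\<in>F. \<bar>z $ i\<bar>)"
    unfolding pnorm_1 using assms(3) by (intro sum.mono_neutral_right) auto
  also have "\<dots> \<le> (\<Sum>i\<in>F. infnorm z)" by (intro sum_mono component_le_infnorm_cart)
  finally show ?thesis using infinite by (simp add: pnorm_infinity)
next
  case (finite r)
  define k where "k = real (card F)"
  have k: "k > 0" using assms(2) by (simp add: k_def card_gt_0_iff)
  \<comment> \<open>A sign vector is its own dual vector, so Hoelder's inequality applies with the roles reversed.\<close>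
  define v :: "real ^ 'd" where "v = (\<chi> i. if i \<in> F then (if z $ i < 0 then -1 else 1) else 0)"
  have v0: "v \<noteq> 0" using assms(2) by (auto simp: v_def vec_eq_iff)
  have "\<bar>v $ i\<bar> powr r = (if i \<in> F then 1 else 0)" for i by (simp add: v_def)
  then have nv: "pnorm p v = k powr (1/r)"
    using finite by (simp add: pnorm_ereal k_def sum.If_cases)
  have "sgn_pow p v $ i * z $ i = \<bar>z $ i\<bar>" for i
    using finite assms(3)[of i] by (auto simp: sgn_pow_def v_def)
  then have "pnorm 1 z = sgn_pow p v \<bullet> z" by (simp add: pnorm_1 inner_vec_def)
  also have "\<dots> \<le> dual_scale p v * pnorm p z" using assms v0 by (intro dual_pairing_le)
  also have "dual_scale p v = k powr (1 - inv_exp p)"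
    using finite k nv by (simp add: dual_scale_def powr_powr diff_divide_distrib)
  finally show ?thesis by (simp add: k_def)
qed

text \<open>Interpolation between the 1-norm and the maximum norm, in the form needed for the small coordinates:
  each of them is at most the average \<open>L / l\<close> over one block.\<close>

lemma pnorm_le_interpolation:
  fixes z :: "real ^ 'd"
  assumes "1 \<le> p" "0 < l" "\<And>i. \<bar>z $ i\<bar> \<le> L / l" "pnorm 1 z \<le> L"
  shows "pnorm p z \<le> L * l powr (inv_exp p - 1)"
  using assms(1)
proof (cases rule: exponent_cases)
  case infinite
  then show ?thesis using assms by (simp add: pnorm_infinity infnorm_le_iff powr_minus field_simps)
next
  case (finite r)
  have L: "0 \<le> L" using pnorm_nonneg[of 1 z] assms(4) by linarith
  have "\<bar>z $ i\<bar> powr r \<le> (L / l) powr (r - 1) * \<bar>z $ i\<bar>" for i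
  proof (cases "z $ i = 0")
    case False
    have "\<bar>z $ i\<bar> powr r = \<bar>z $ i\<bar> powr (r - 1) * \<bar>z $ i\<bar>" using False by (simp add: powr_diff)
    also have "\<dots> \<le> (L / l) powr (r - 1) * \<bar>z $ i\<bar>"
      using assms(3) finite by (intro mult_right_mono powr_mono2) auto
    finally show ?thesis .
  qed simp
  then have "(\<Sum>i\<in>UNIV. \<bar>z $ i\<bar> powr r) \<le> (L / l) powr (r - 1) * pnorm 1 z"
    unfolding pnorm_1 sum_distrib_left by (rule sum_mono)
  also have "\<dots> \<le> (L / l) powr (r - 1) * L" using assms by (intro mult_left_mono) auto
  also have "\<dots> = L powr r * l powr (1 - r)"
  proof (cases "L = 0")
    case False
    then have "L > 0" using L by simp
    then have "(L / l) powr (r - 1) = L powr r / L * l powr (1 - r)"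
      using assms(2) by (simp add: powr_divide powr_diff)
    then show ?thesis using \<open>L > 0\<close> by simp
  qed simp
  finally have "pnorm p z \<le> (L powr r * l powr (1 - r)) powr (1 / r)"
    using finite by (auto simp: pnorm_ereal intro!: powr_mono2 sum_nonneg)
  also have "\<dots> = L * l powr (inv_exp p - 1)"
    using finite L assms(2) by (simp add: powr_mult powr_powr diff_divide_distrib)
  finally show ?thesis .
qed

lemma sort_map_eq: "sort (map f xs) = map f (sort_key f xs)"
  by (rule properties_for_sort) simp_all

text \<open>One set \<open>F\<close> serves all exponents, because sorting the magnitudes does not depend on \<open>p\<close>.\<close>

lemma tail_norm_eq_pnorm:
  fixes \<beta> :: "real ^ 'd"
  assumes "k \<le> CARD('d)"
  obtains F :: "'d set" where "card F = k" "\<And>p. 1 \<le> p \<Longrightarrow> tail_norm p k \<beta> = pnorm p (restr (-F) \<beta>)"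
proof -
  obtain xs :: "'d list" where xs: "set xs = UNIV" "distinct xs"
    using finite_distinct_list[of "UNIV :: 'd set"] by auto
  define js where "js = rev (sort_key (\<lambda>j. \<bar>\<beta> $ j\<bar>) xs)"
  have js: "set js = UNIV" "distinct js" using xs by (auto simp: js_def)
  then have len: "length js = CARD('d)" using distinct_card[OF js(2)] by simp
  have "mset_set UNIV = mset xs" using xs mset_set_set[OF xs(2)] by simp
  then have desc: "abs_desc \<beta> = map (\<lambda>j. \<bar>\<beta> $ j\<bar>) js"
    by (simp add: abs_desc_def js_def mset_map[symmetric] sort_map_eq rev_map del: mset_map)
  define F where "F = set (take k js)"
  have split: "set (take k js) \<union> set (drop k js) = UNIV" "set (take k js) \<inter> set (drop k js) = {}"
    using js set_append[of "take k js" "drop k js"] set_take_disj_set_drop_if_distinct[OF js(2), of k k] by simp_all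
  then have cF: "- F = set (drop k js)" by (auto simp: F_def)
  have "card F = k" using js len assms by (simp add: F_def distinct_card)
  moreover have bij: "bij_betw (\<lambda>j. js ! j) {k..<CARD('d)} (-F)"
  proof -
    have "inj_on (\<lambda>j. js ! j) {k..<CARD('d)}"
      using js(2) len by (intro inj_on_nth) auto
    moreover have "(\<lambda>j. js ! j) ` {k..<CARD('d)} = set (drop k js)"
    proof safe
      fix j assume "j \<in> {k..<CARD('d)}"
      then have "drop k js ! (j - k) = js ! j" "j - k < length (drop k js)" using len by auto
      then show "js ! j \<in> set (drop k js)" by (metis nth_mem)
    next
      fix x assume "x \<in> set (drop k js)"
      then obtain i where "i < length (drop k js)" "x = drop k js ! i" by (auto simp: in_set_conv_nth)
      then show "x \<in> (\<lambda>j. js ! j) ` {k..<CARD('d)}" using len by (intro image_eqI[of _ _ "k + i"]) auto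
    qed
    ultimately show ?thesis by (simp add: bij_betw_def cF)
  qed
  have nth: "abs_desc \<beta> ! j = \<bar>\<beta> $ (js ! j)\<bar>" if "j \<in> {k..<CARD('d)}" for j
    using that len by (simp add: desc)
  have "tail_norm p k \<beta> = pnorm p (restr (-F) \<beta>)" if "1 \<le> p" for p
    using that
  proof (cases rule: exponent_cases)
    case infinite
    have "(\<lambda>j. abs_desc \<beta> ! j) ` {k..<CARD('d)} = (\<lambda>i. \<bar>\<beta> $ i\<bar>) ` (-F)"
    proof -
      have "(\<lambda>j. abs_desc \<beta> ! j) ` {k..<CARD('d)} = (\<lambda>j. \<bar>\<beta> $ (js ! j)\<bar>) ` {k..<CARD('d)}"
        using nth by (rule image_cong[OF refl])
      also have "\<dots> = (\<lambda>i. \<bar>\<beta> $ i\<bar>) ` ((\<lambda>j. js ! j) ` {k..<CARD('d)})" by (simp only: image_image)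
      finally show ?thesis using bij by (simp add: bij_betw_def)
    qed
    then have 1: "tail_norm p k \<beta> = Max (insert 0 ((\<lambda>i. \<bar>\<beta> $ i\<bar>) ` (-F)))"
      using infinite by (simp add: tail_norm_def)
    have "Max (insert 0 ((\<lambda>i. \<bar>\<beta> $ i\<bar>) ` (-F))) = infnorm (restr (-F) \<beta>)"
    proof (rule antisym)
      show "Max (insert 0 ((\<lambda>i. \<bar>\<beta> $ i\<bar>) ` (-F))) \<le> infnorm (restr (-F) \<beta>)"
      proof (intro Max.boundedI)
        fix c assume "c \<in> insert 0 ((\<lambda>i. \<bar>\<beta> $ i\<bar>) ` (-F))"
        then show "c \<le> infnorm (restr (-F) \<beta>)"
          using component_le_infnorm_cart[of "restr (-F) \<beta>"] by (auto simp: infnorm_pos_le) (metis)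
      qed auto
      show "infnorm (restr (-F) \<beta>) \<le> Max (insert 0 ((\<lambda>i. \<bar>\<beta> $ i\<bar>) ` (-F)))"
        unfolding infnorm_le_iff by (auto intro!: Max_ge)
    qed
    then show ?thesis using 1 infinite by (simp add: pnorm_infinity)
  next
    case (finite r)
    have "(\<Sum>j = k..<CARD('d). (abs_desc \<beta> ! j) powr r) = (\<Sum>j = k..<CARD('d). \<bar>\<beta> $ (js ! j)\<bar> powr r)"
      by (intro sum.cong) (auto simp: nth)
    also have "\<dots> = (\<Sum>i\<in>-F. \<bar>\<beta> $ i\<bar> powr r)"
      using bij by (rule sum.reindex_bij_betw)
    also have "\<dots> = (\<Sum>i\<in>UNIV. \<bar>restr (-F) \<beta> $ i\<bar> powr r)"
      by (intro sum.mono_neutral_cong_left) auto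
    finally show ?thesis using finite by (simp add: tail_norm_def pnorm_ereal)
  qed
  ultimately show thesis using that by blast
qed


section \<open>Coordinate restrictions and block decompositions\<close>

lemma inner_restr: "(\<And>i. i \<notin> I \<Longrightarrow> s $ i = 0) \<Longrightarrow> s \<bullet> restr I z = s \<bullet> z"
  unfolding inner_vec_def by (intro sum.cong) auto

lemma pnorm_1_split: "pnorm 1 v = pnorm 1 (restr F v) + pnorm 1 (restr (-F) v)"
  unfolding pnorm_1 sum.distrib[symmetric] by (intro sum.cong) auto

lemma pnorm_1_restr: "pnorm 1 (restr F v) = (\<Sum>i\<in>F. \<bar>v $ i\<bar>)"
  unfolding pnorm_1 by (rule sum.mono_neutral_cong_right) auto

lemma matrix_vector_mult_uminus: "A *v (- u) = - (A *v u)" for A :: "real ^ 'd ^ 'd"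
  by (simp add: vec_eq_iff matrix_vector_mult_def sum_negf)


lemma top_subset:
  fixes f :: "'a \<Rightarrow> real"
  assumes "finite S" "m \<le> card S"
  obtains T where "T \<subseteq> S" "card T = m" "\<And>i j. i \<in> T \<Longrightarrow> j \<in> S - T \<Longrightarrow> f j \<le> f i"
  using assms(2)
proof (induction m arbitrary: thesis)
  case 0
  show ?case by (rule 0(1)[of "{}"]) auto
next
  case (Suc m)
  from Suc.prems(2) have "m \<le> card S" by simp
  with Suc.IH obtain T where T: "T \<subseteq> S" "card T = m" "\<And>i j. i \<in> T \<Longrightarrow> j \<in> S - T \<Longrightarrow> f j \<le> f i"
    by blast
  have "finite T" using T(1) assms(1) by (rule finite_subset)
  then have "\<not> S \<subseteq> T" using card_mono[of T S] T(2) Suc.prems(2) by auto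
  then have "S - T \<noteq> {}" by auto
  then obtain x where x: "x \<in> S - T" "\<And>j. j \<in> S - T \<Longrightarrow> f j \<le> f x"
    using obtains_MAX[of "S - T" f] assms(1) by (metis Max_ge finite_Diff finite_imageI imageI)
  show ?case
  proof (rule Suc.prems(1)[of "insert x T"])
    show "card (insert x T) = Suc m" using x(1) T(2) \<open>finite T\<close> by simp
  qed (use T x in auto)
qed

text \<open>The shifting argument. Split off the \<open>l\<close> largest entries as a block: the block itself costs the current
  maximum \<open>m\<close>, and all later entries are at most the block average, which becomes the maximum for the
  rest. So every block after the first is paid for by the 1-norm of its predecessor. Induction on the
  support avoids an explicit enumeration of the blocks; a last block with fewer than \<open>l\<close> entries is padded.\<close>

lemma block_decomposition_bound:
  fixes \<phi> :: "real ^ 'd \<Rightarrow> real" and z :: "real ^ 'd"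
  assumes l: "0 < l" and room: "card I + l \<le> CARD('d)"
    and sub: "\<And>u v. \<phi> (u + v) \<le> \<phi> u + \<phi> v"
    and block: "\<And>J u. card J = l \<Longrightarrow> I \<inter> J = {} \<Longrightarrow> (\<And>i. i \<notin> J \<Longrightarrow> u $ i = 0) \<Longrightarrow> \<phi> u \<le> C * infnorm u"
    and C: "0 \<le> C"
    and z: "\<And>i. i \<in> I \<Longrightarrow> z $ i = 0" "\<And>i. \<bar>z $ i\<bar> \<le> m"
  shows "\<phi> z \<le> C * (m + pnorm 1 z / l)"
  using z
proof (induction "card {i. z $ i \<noteq> 0}" arbitrary: z m rule: less_induct)
  case less
  define R where "R = {i. z $ i \<noteq> 0}"
  have RI: "I \<inter> R = {}" using less.prems(1) by (auto simp: R_def)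
  show ?case
  proof (cases "card R \<le> l")
    case True
    have "card (UNIV - I) = CARD('d) - card I" by (simp add: card_Diff_subset)
    then have "l \<le> card (UNIV - I)" using room by simp
    then obtain J where J: "R \<subseteq> J" "J \<subseteq> UNIV - I" "card J = l"
      using True RI exists_subset_between[of R l "UNIV - I"] by auto
    have "\<phi> z \<le> C * infnorm z" using J by (intro block[of J]) (auto simp: R_def)
    also have "\<dots> \<le> C * m" using C less.prems(2) by (intro mult_left_mono) (auto simp: infnorm_le_iff)
    also have "\<dots> \<le> C * (m + pnorm 1 z / l)" using C l pnorm_nonneg[of 1 z] by (intro mult_left_mono) auto
    finally show ?thesis .
  next
    case False
    then obtain T where T: "T \<subseteq> R" "card T = l" "\<And>i j. i \<in> T \<Longrightarrow> j \<in> R - T \<Longrightarrow> \<bar>z $ j\<bar> \<le> \<bar>z $ i\<bar>"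
      using top_subset[of R l "\<lambda>i. \<bar>z $ i\<bar>"] by auto
    define u w where "u = restr T z" and "w = restr (-T) z"
    have zuw: "z = u + w" by (auto simp: u_def w_def vec_eq_iff)
    have Tne: "T \<noteq> {}" using T l by auto
    define m' where "m' = pnorm 1 u / l"
    have u1: "pnorm 1 u = (\<Sum>i\<in>T. \<bar>z $ i\<bar>)"
      unfolding pnorm_1 u_def by (rule sum.mono_neutral_cong_right) auto
    have wm: "\<bar>w $ i\<bar> \<le> m'" for i
    proof (cases "i \<in> R - T")
      case True
      have "real l * \<bar>z $ i\<bar> = (\<Sum>j\<in>T. \<bar>z $ i\<bar>)" using T by simp
      also have "\<dots> \<le> pnorm 1 u" unfolding u1 using T True by (intro sum_mono) auto
      finally show ?thesis using l True by (simp add: w_def m'_def field_simps)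
    next
      case False
      then show ?thesis using pnorm_nonneg[of 1 u] l by (auto simp: w_def m'_def R_def)
    qed
    have "card {i. w $ i \<noteq> 0} < card {i. z $ i \<noteq> 0}"
      using Tne T by (intro psubset_card_mono) (auto simp: w_def R_def)
    then have IH: "\<phi> w \<le> C * (m' + pnorm 1 w / l)"
      using less.prems(1) wm by (intro less.hyps) (auto simp: w_def)
    have "\<phi> u \<le> C * infnorm u" using T RI by (intro block[of T]) (auto simp: u_def)
    also have "\<dots> \<le> C * m"
      using C less.prems(2) order_trans[OF abs_ge_zero less.prems(2)] by (intro mult_left_mono) (auto simp: infnorm_le_iff u_def)
    finally have "\<phi> z \<le> C * m + C * (m' + pnorm 1 w / l)" using sub[of u w] IH by (simp add: zuw)
    moreover have "pnorm 1 z = pnorm 1 u + pnorm 1 w"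
      unfolding pnorm_1 sum.distrib[symmetric] by (intro sum.cong) (auto simp: u_def w_def)
    ultimately show ?thesis by (simp add: m'_def algebra_simps add_divide_distrib)
  qed
qed

section \<open>The sparse eigenvalue quantities as inequalities\<close>

lemma restr_0: "restr I 0 = 0"
  by (simp add: vec_eq_iff)

lemma submat_mult_vector:
  "(\<And>i. i \<notin> J \<Longrightarrow> u $ i = 0) \<Longrightarrow> submat I J A *v u = restr I (A *v u)"
  by (auto simp: vec_eq_iff submat_def matrix_vector_mult_def intro!: sum.cong)

lemma eratio_pos: "0 < b \<Longrightarrow> eratio (ereal a) (ereal b) = ereal (a / b)"
  by (simp add: eratio_def zero_ereal_def)

lemma eratio_zero [simp]: "eratio a 0 = \<infinity>" "eratio a (ereal 0) = \<infinity>"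
  by (simp_all add: eratio_def zero_ereal_def)

lemma eratio_nonneg: "0 \<le> a \<Longrightarrow> 0 \<le> b \<Longrightarrow> 0 \<le> eratio a b"
  by (simp add: eratio_def ereal_divide_ereal zero_le_divide_ereal)

lemma nonzero_onD: "v \<in> nonzero_on I \<Longrightarrow> v \<noteq> 0" "v \<in> nonzero_on I \<Longrightarrow> i \<notin> I \<Longrightarrow> v $ i = 0"
  by (auto simp: nonzero_on_def)

lemma nonzero_on_uminus: "v \<in> nonzero_on I \<Longrightarrow> - v \<in> nonzero_on I"
  by (auto simp: nonzero_on_def)

lemma nonzero_on_nonempty: "I \<noteq> {} \<Longrightarrow> nonzero_on I \<noteq> {}"
proof -
  assume "I \<noteq> {}"
  then obtain i where "i \<in> I" by auto
  then have "axis i 1 \<in> nonzero_on I" by (auto simp: nonzero_on_def axis_def vec_eq_iff)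
  then show ?thesis by auto
qed

lemma disjoint_index_sets:
  assumes "m + l \<le> CARD('d::finite)"
  obtains I J :: "'d::finite set" where "card I = m" "card J = l" "I \<inter> J = {}"
proof -
  obtain I :: "'d set" where I: "card I = m" using assms obtain_subset_with_card_n[of m "UNIV :: 'd set"] by auto
  have "l \<le> card (UNIV - I)" using assms I by (simp add: card_Diff_subset)
  then obtain J where "J \<subseteq> UNIV - I" "card J = l" using obtain_subset_with_card_n by metis
  then show thesis using that[of I J] I by auto
qed

lemma omega_nonneg: "0 \<le> omega p A m"
  unfolding omega_def
  by (intro INF_greatest eratio_nonneg) (auto simp: pnorm_nonneg simp del: ereal_max)

lemma mu_nonneg: "0 \<le> mu p A m"
  unfolding mu_def by (intro INF_greatest eratio_nonneg) (auto simp: pnorm_nonneg)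

lemma rho_upper:
  assumes "1 \<le> p" "card I = m" "v \<in> nonzero_on I"
  shows "ereal (pnorm p (restr I (A *v v)) / pnorm p v) \<le> rho p A m"
proof -
  have "0 < pnorm p v" using assms by (intro pnorm_pos) (auto dest: nonzero_onD)
  moreover have "eratio (ereal (pnorm p (submat I I A *v v))) (ereal (pnorm p v)) \<le> rho p A m"
    unfolding rho_def using assms by (intro SUP_upper2[of I] SUP_upper) auto
  moreover have "submat I I A *v v = restr I (A *v v)"
    using assms by (intro submat_mult_vector) (auto dest: nonzero_onD)
  ultimately show ?thesis by (simp add: eratio_pos)
qed

lemma mu_lower:
  assumes "1 \<le> p" "card I = m" "v \<in> nonzero_on I"
  shows "mu p A m \<le> ereal (pnorm p (restr I (A *v v)) / pnorm p v)"
proof -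
  have "0 < pnorm p v" using assms by (intro pnorm_pos) (auto dest: nonzero_onD)
  moreover have "mu p A m \<le> eratio (ereal (pnorm p (submat I I A *v v))) (ereal (pnorm p v))"
    unfolding mu_def using assms by (intro INF_lower2[of I] INF_lower) auto
  moreover have "submat I I A *v v = restr I (A *v v)"
    using assms by (intro submat_mult_vector) (auto dest: nonzero_onD)
  ultimately show ?thesis by (simp add: eratio_pos)
qed

text \<open>The quadratic form of the definitions has the dual vector on the right; the argument below needs it on the
  left, as a test vector for \<open>A *v v\<close>. Symmetry of \<open>A\<close> reconciles them, and the restriction to \<open>I\<close> is
  immaterial for vectors supported in \<open>I\<close>.\<close>

lemma inner_submat_sgn_pow:
  assumes sym: "\<And>u v. u \<bullet> (A *v v) = v \<bullet> (A *v u)" and "v \<in> nonzero_on I"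
  shows "v \<bullet> (submat I I A *v sgn_pow p v) = sgn_pow p v \<bullet> (A *v v)"
proof -
  have supp: "sgn_pow p v $ i = 0" if "i \<notin> I" for i
    using assms(2) that by (intro sgn_pow_eq_0) (auto dest: nonzero_onD)
  then have "v \<bullet> (submat I I A *v sgn_pow p v) = v \<bullet> restr I (A *v sgn_pow p v)"
    by (simp add: submat_mult_vector)
  also have "\<dots> = v \<bullet> (A *v sgn_pow p v)" using assms(2) by (intro inner_restr) (auto dest: nonzero_onD)
  finally show ?thesis by (simp only: sym[of v])
qed

lemma omega_lower:
  assumes "1 \<le> p" "card I = m" and v: "v \<in> nonzero_on I" and sym: "\<And>u v. u \<bullet> (A *v v) = v \<bullet> (A *v u)"
  shows "omega p A m \<le> ereal (max 0 (sgn_pow p v \<bullet> (A *v v)) / (dual_scale p v * pnorm p v))"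
proof -
  have pos: "0 < dual_scale p v * pnorm p v"
    using assms by (auto intro!: mult_pos_pos pnorm_pos dual_scale_pos dest: nonzero_onD)
  have "omega p A m \<le> eratio (ereal (max 0 (v \<bullet> (submat I I A *v sgn_pow p v))))
       (ereal (if p = \<infinity> then pnorm p v else pnorm p v powr real_of_ereal p))"
    unfolding omega_def using assms by (intro INF_lower2[of I] INF_lower) auto
  then show ?thesis
    unfolding inner_submat_sgn_pow[OF sym v] omega_denominator[OF assms(1) nonzero_onD(1)[OF v]]
    using pos by (simp add: eratio_pos del: ereal_max)
qed

lemma ppi_upper:
  assumes "card I = m" "card J = l" "I \<inter> J = {}" and v: "v \<in> nonzero_on I" and u: "u \<in> nonzero_on J"
    and sym: "\<And>u v. u \<bullet> (A *v v) = v \<bullet> (A *v u)"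
  shows "eratio (ereal ((sgn_pow p v \<bullet> (A *v u)) * pnorm p v))
    (ereal (max 0 (sgn_pow p v \<bullet> (A *v v)) * infnorm u)) \<le> ppi p A m l"
proof -
  have "eratio (ereal (sgn_pow p v \<bullet> (submat I J A *v u) * pnorm p v))
      (ereal (max 0 (v \<bullet> (submat I I A *v sgn_pow p v)) * pnorm \<infinity> u)) \<le> ppi p A m l"
    unfolding ppi_def
    by (rule SUP_upper2[of I], use assms in force, rule SUP_upper2[of J], use assms in force,
        rule SUP_upper2[OF v], rule SUP_upper[OF u])
  moreover have "sgn_pow p v \<bullet> (submat I J A *v u) = sgn_pow p v \<bullet> (A *v u)"
  proof -
    have "sgn_pow p v \<bullet> (submat I J A *v u) = sgn_pow p v \<bullet> restr I (A *v u)"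
      using u by (subst submat_mult_vector) (auto dest: nonzero_onD)
    also have "\<dots> = sgn_pow p v \<bullet> (A *v u)"
      using v by (intro inner_restr sgn_pow_eq_0) (auto dest: nonzero_onD)
    finally show ?thesis .
  qed
  ultimately show ?thesis by (simp add: inner_submat_sgn_pow[OF sym v] pnorm_infinity)
qed

text \<open>A nonpositive form would make a denominator of \<open>ppi\<close> zero, hence \<open>ppi\<close> infinite.\<close>

lemma ppi_finite_pos:
  assumes "card I = m" "card J = l" "I \<inter> J = {}" "0 < l" and v: "v \<in> nonzero_on I"
    and sym: "\<And>u v. u \<bullet> (A *v v) = v \<bullet> (A *v u)" and fin: "ppi p A m l \<noteq> \<infinity>"
  shows "0 < sgn_pow p v \<bullet> (A *v v)"
proof (rule ccontr)
  assume neg: "\<not> 0 < sgn_pow p v \<bullet> (A *v v)"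
  have "J \<noteq> {}" using assms by auto
  then obtain u where u: "u \<in> nonzero_on J" using nonzero_on_nonempty[of J] by blast
  have "max 0 (sgn_pow p v \<bullet> (A *v v)) = 0" using neg by simp
  then show False using ppi_upper[OF assms(1-3) v u sym, of p] fin by simp
qed

lemma ppi_bound:
  assumes "card I = m" "card J = l" "I \<inter> J = {}" "0 < l" and v: "v \<in> nonzero_on I"
    and u: "\<And>i. i \<notin> J \<Longrightarrow> u $ i = 0"
    and sym: "\<And>u v. u \<bullet> (A *v v) = v \<bullet> (A *v u)" and \<pi>: "ppi p A m l = ereal \<pi>"
  shows "(sgn_pow p v \<bullet> (A *v u)) * pnorm p v \<le> \<pi> * (sgn_pow p v \<bullet> (A *v v)) * infnorm u"
proof (cases "u = 0")
  case False
  then have u': "u \<in> nonzero_on J" using u by (auto simp: nonzero_on_def)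
  have "0 < sgn_pow p v \<bullet> (A *v v)" using ppi_finite_pos[OF assms(1-4) v sym] \<pi> by simp
  moreover have "0 < infnorm u" using False by (simp add: infnorm_pos_lt)
  ultimately show ?thesis using ppi_upper[OF assms(1-3) v u' sym, of p]
    by (simp add: \<pi> eratio_pos field_simps)
qed (simp add: infnorm_0)

lemma ppi_nonneg:
  fixes A :: "real ^ 'd ^ 'd"
  assumes "m + l \<le> CARD('d)" "0 < m" "0 < l" and sym: "\<And>u v. u \<bullet> (A *v v) = v \<bullet> (A *v u)"
  shows "0 \<le> ppi p A m l"
proof -
  obtain I J :: "'d set" where IJ: "card I = m" "card J = l" "I \<inter> J = {}"
    using disjoint_index_sets assms(1) by blast
  then have "I \<noteq> {}" "J \<noteq> {}" using assms by auto
  then obtain v u where v: "v \<in> nonzero_on I" and u: "u \<in> nonzero_on J"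
    using nonzero_on_nonempty[of I] nonzero_on_nonempty[of J] by blast
  \<comment> \<open>The numerator is odd in \<open>u\<close>, so one of \<open>u\<close> and \<open>- u\<close> makes it nonnegative.\<close>
  obtain u' where u': "u' \<in> nonzero_on J" "0 \<le> sgn_pow p v \<bullet> (A *v u')"
  proof (cases "0 \<le> sgn_pow p v \<bullet> (A *v u)")
    case False
    then have "0 \<le> sgn_pow p v \<bullet> (A *v (- u))" by (simp add: matrix_vector_mult_uminus)
    then show thesis using that nonzero_on_uminus[OF u] by blast
  qed (use that u in blast)
  have "0 \<le> eratio (ereal ((sgn_pow p v \<bullet> (A *v u')) * pnorm p v))
    (ereal (max 0 (sgn_pow p v \<bullet> (A *v v)) * infnorm u'))"
    using u' by (intro eratio_nonneg) (auto simp: pnorm_nonneg infnorm_pos_le)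
  also have "\<dots> \<le> ppi p A m l" using IJ v u'(1) sym by (rule ppi_upper)
  finally show ?thesis .
qed

lemma rho_nonneg:
  fixes A :: "real ^ 'd ^ 'd"
  assumes "1 \<le> p" "m \<le> CARD('d)" "0 < m"
  shows "0 \<le> rho p A m"
proof -
  obtain I :: "'d set" where I: "card I = m" using assms obtain_subset_with_card_n[of m "UNIV :: 'd set"] by auto
  then have "I \<noteq> {}" using assms by auto
  then obtain v where "v \<in> nonzero_on I" using nonzero_on_nonempty[of I] by blast
  from rho_upper[OF assms(1) I this, of A] show ?thesis
    by (rule order_trans[rotated]) (simp add: pnorm_nonneg)
qed

text \<open>The product on the right is \<open>0\<close> when \<open>r = 0\<close>, even for infinite \<open>rho\<close>; the bound survives because then
  \<open>u = 0\<close>.\<close>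

lemma rho_bound:
  fixes A :: "real ^ 'd ^ 'd"
  assumes p: "1 \<le> p" and I: "card I = m" "0 < m" and u: "\<And>i. i \<notin> I \<Longrightarrow> u $ i = 0" "pnorm p u \<le> r"
  shows "ereal (pnorm p (restr I (A *v u))) \<le> rho p A m * ereal r"
proof -
  have m: "m \<le> CARD('d)" using I(1) card_mono[of UNIV I] by simp
  have r: "0 \<le> r" using u(2) pnorm_nonneg order_trans by blast
  show ?thesis
  proof (cases "u = 0")
    case True
    then have "restr I (A *v u) = 0" by (simp only: matrix_vector_mult_0_right restr_0)
    then show ?thesis using rho_nonneg[OF p m I(2), of A] r by (simp flip: zero_ereal_def)
  next
    case False
    then have u': "u \<in> nonzero_on I" using u by (auto simp: nonzero_on_def)
    have "ereal (pnorm p (restr I (A *v u))) = ereal (pnorm p (restr I (A *v u)) / pnorm p u) * ereal (pnorm p u)"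
      using pnorm_pos[OF p False] by simp
    also have "\<dots> \<le> rho p A m * ereal r"
      using u r rho_upper[OF p I(1) u'] rho_nonneg[OF p m I(2)] pnorm_nonneg
      by (intro ereal_mult_mono) auto
    finally show ?thesis .
  qed
qed

lemma mu_bound:
  assumes p: "1 \<le> p" and I: "card I = m" and w: "\<And>i. i \<notin> I \<Longrightarrow> w $ i = 0" and c: "pnorm p (restr I (A *v w)) \<le> c"
  shows "ereal (pnorm p w) \<le> eratio (ereal c) (mu p A m)"
proof (cases "w = 0")
  case True
  have "0 \<le> c" using c pnorm_nonneg order_trans by blast
  then have "0 \<le> eratio (ereal c) (mu p A m)" by (intro eratio_nonneg mu_nonneg) simp
  then show ?thesis using True by (simp add: zero_ereal_def)
next
  case False
  then have w': "w \<in> nonzero_on I" using w by (auto simp: nonzero_on_def)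
  have le: "mu p A m \<le> ereal (pnorm p (restr I (A *v w)) / pnorm p w)" by (rule mu_lower[OF p I w'])
  with mu_nonneg[of p A m] obtain \<mu> where \<mu>: "mu p A m = ereal \<mu>" "0 \<le> \<mu>" by (cases "mu p A m") auto
  have "\<mu> * pnorm p w \<le> c" using le c pnorm_pos[OF p False] by (simp add: \<mu> field_simps)
  then show ?thesis using \<mu> by (cases "\<mu> = 0") (auto simp: eratio_pos eratio_def zero_ereal_def field_simps)
qed

lemma submat_mat_1:
  "submat I I X ** submat I I (mat 1) = submat I I X" "submat I I (mat 1) ** submat I I X = submat I I X"
proof -
  have "(\<Sum>k\<in>UNIV. submat I I X $ i $ k * submat I I (mat 1) $ k $ j) =
      (\<Sum>k\<in>UNIV. if k = j then submat I I X $ i $ j else 0)" for i j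
    by (intro sum.cong) (auto simp: submat_def mat_def)
  then show "submat I I X ** submat I I (mat 1) = submat I I X"
    by (simp add: vec_eq_iff matrix_matrix_mult_def)
  have "(\<Sum>k\<in>UNIV. submat I I (mat 1) $ i $ k * submat I I X $ k $ j) =
      (\<Sum>k\<in>UNIV. if k = i then submat I I X $ i $ j else 0)" for i j
    by (intro sum.cong) (auto simp: submat_def mat_def)
  then show "submat I I (mat 1) ** submat I I X = submat I I X"
    by (simp add: vec_eq_iff matrix_matrix_mult_def)
qed

lemma is_submat_inv_unique:
  assumes "is_submat_inv I A B" "is_submat_inv I A C"
  shows "B = C"
proof -
  have B: "submat I I B = B" "B ** submat I I A = submat I I (mat 1)"
    and C: "submat I I C = C" "submat I I A ** C = submat I I (mat 1)"
    using assms by (simp_all add: is_submat_inv_def)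
  have "B = B ** submat I I (mat 1)" using submat_mat_1(1)[of I B] B by simp
  also have "\<dots> = (B ** submat I I A) ** C" by (simp only: C(2)[symmetric] matrix_mul_assoc)
  also have "\<dots> = submat I I (mat 1) ** C" by (simp only: B(2))
  also have "\<dots> = C" using submat_mat_1(2)[of I C] C by simp
  finally show ?thesis .
qed

lemma submat_inv_works:
  assumes "\<exists>B. is_submat_inv I A B"
  shows "is_submat_inv I A (submat_inv I A)"
proof -
  obtain B where B: "is_submat_inv I A B" using assms ..
  show ?thesis unfolding submat_inv_def
    by (rule theI[of "is_submat_inv I A", OF B]) (rule is_submat_inv_unique[OF _ B])
qed

lemma submat_inv_cancel:
  assumes inv: "is_submat_inv I A B"
  shows "(\<And>i. i \<notin> I \<Longrightarrow> w $ i = 0) \<Longrightarrow> B *v restr I (A *v w) = w"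
    and "restr I (A *v (B *v restr I z)) = restr I z"
    and "i \<notin> I \<Longrightarrow> (B *v z) $ i = 0"
proof -
  have B: "submat I I B = B" "B ** submat I I A = submat I I (mat 1)" "submat I I A ** B = submat I I (mat 1)"
    using inv by (simp_all add: is_submat_inv_def)
  have id: "submat I I (mat 1) *v x = restr I x" for x :: "real ^ 'a"
  proof -
    have "(\<Sum>j\<in>UNIV. submat I I (mat 1) $ i $ j * x $ j) = (\<Sum>j\<in>UNIV. if j = i then restr I x $ i else 0)" for i
      by (intro sum.cong) (auto simp: submat_def mat_def)
    then show ?thesis by (simp add: vec_eq_iff matrix_vector_mult_def)
  qed
  show "B *v restr I (A *v w) = w" if w: "\<And>i. i \<notin> I \<Longrightarrow> w $ i = 0"
  proof -
    have "B *v restr I (A *v w) = (B ** submat I I A) *v w"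
      using w by (simp add: submat_mult_vector flip: matrix_vector_mul_assoc)
    also have "\<dots> = w" using w by (auto simp: B id vec_eq_iff)
    finally show ?thesis .
  qed
  show supp: "(B *v z) $ i = 0" if "i \<notin> I" for i z
  proof -
    have "B $ i $ j = 0" for j using arg_cong[OF B(1), of "\<lambda>X. X $ i $ j"] that by (simp add: submat_def)
    then show ?thesis by (simp add: matrix_vector_mult_def)
  qed
  have "restr I (A *v (B *v restr I z)) = (submat I I A ** B) *v restr I z"
    using supp by (simp add: submat_mult_vector flip: matrix_vector_mul_assoc)
  also have "\<dots> = restr I z" by (simp add: B id vec_eq_iff)
  finally show "restr I (A *v (B *v restr I z)) = restr I z" .
qed

lemma gam_finite_inverse:
  "gam p A m l \<noteq> \<infinity> \<Longrightarrow> card I = m \<Longrightarrow> is_submat_inv I A (submat_inv I A)"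
  by (intro submat_inv_works) (auto simp: gam_def split: if_splits)

lemma gam_upper:
  assumes fin: "gam p A m l \<noteq> \<infinity>" and I: "card I = m" "card J = l" "I \<inter> J = {}" and u: "u \<in> nonzero_on J"
  shows "ereal (pnorm p (submat_inv I A *v restr I (A *v u)) / infnorm u) \<le> gam p A m l"
proof -
  have "eratio (ereal (pnorm p ((submat_inv I A ** submat I J A) *v u))) (ereal (pnorm \<infinity> u)) \<le> gam p A m l"
  proof -
    have "gam p A m l = (SUP I\<in>{I. card I = m}. SUP J\<in>{J. card J = l \<and> I \<inter> J = {}}. SUP u\<in>nonzero_on J.
       eratio (pnorm p ((submat_inv I A ** submat I J A) *v u)) (pnorm \<infinity> u))"
      using fin unfolding gam_def by (auto split: if_splits)
    then show ?thesis
      by (simp only:) (rule SUP_upper2[of I], use I in force, rule SUP_upper2[of J], use I in force, rule SUP_upper[OF u])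
  qed
  moreover have "(submat_inv I A ** submat I J A) *v u = submat_inv I A *v restr I (A *v u)"
    using u by (simp add: submat_mult_vector nonzero_onD flip: matrix_vector_mul_assoc)
  moreover have "0 < infnorm u" using nonzero_onD(1)[OF u] by (simp add: infnorm_pos_lt)
  ultimately show ?thesis by (simp add: pnorm_infinity eratio_pos)
qed

lemma gam_bound:
  assumes \<gamma>: "gam p A m l = ereal \<gamma>" and I: "card I = m" "card J = l" "I \<inter> J = {}"
    and u: "\<And>i. i \<notin> J \<Longrightarrow> u $ i = 0"
  shows "pnorm p (submat_inv I A *v restr I (A *v u)) \<le> \<gamma> * infnorm u"
proof (cases "u = 0")
  case True
  then have "submat_inv I A *v restr I (A *v u) = 0"
    by (simp only: matrix_vector_mult_0_right restr_0)
  then show ?thesis using True by (simp add: infnorm_0)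
next
  case False
  then have "u \<in> nonzero_on J" "0 < infnorm u" using u by (auto simp: nonzero_on_def infnorm_pos_lt)
  then show ?thesis using gam_upper[of p A m l I J u] I \<gamma> by (simp add: field_simps)
qed

lemma gam_nonneg:
  fixes A :: "real ^ 'd ^ 'd"
  assumes "m + l \<le> CARD('d)" "0 < l"
  shows "0 \<le> gam p A m l"
proof (cases "gam p A m l = \<infinity>")
  case False
  obtain I J :: "'d set" where IJ: "card I = m" "card J = l" "I \<inter> J = {}"
    using disjoint_index_sets assms(1) by blast
  then have "J \<noteq> {}" using assms by auto
  then obtain u where u: "u \<in> nonzero_on J" using nonzero_on_nonempty[of J] by blast
  have "0 \<le> ereal (pnorm p (submat_inv I A *v restr I (A *v u)) / infnorm u)"
    by (simp add: pnorm_nonneg infnorm_pos_le)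
  also have "\<dots> \<le> gam p A m l" using False IJ u by (rule gam_upper)
  finally show ?thesis .
qed simp


section \<open>Deviation of a stationary point from the target\<close>

lemma cone_constant_le_3: "0 < t \<Longrightarrow> t < 1 \<Longrightarrow> (4 - t) / (4 - 3 * t) \<le> (3::real)"
  by (simp add: field_simps)

text \<open>This is the reason for the constant \<open>4 (2 - t) / t\<close> in front of the noise level: the cone constant that
  it produces is so close to \<open>1\<close> that \<open>t / 2\<close> is left over after absorption.\<close>

lemma cone_constant_contracts:
  fixes t c :: real
  assumes "0 < t" "t < 1" "c \<le> 1 - t"
  shows "(4 - t) / (4 - 3 * t) * c \<le> 1 - t / 2"
proof -
  have "(4 - t) * c \<le> (4 - t) * (1 - t)" using assms by (intro mult_left_mono) auto
  also have "\<dots> \<le> (1 - t / 2) * (4 - 3 * t)"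
    using assms by (simp add: algebra_simps power2_eq_square)
  finally show ?thesis using assms by (simp add: field_simps)
qed

text \<open>The optimality conditions of a 1-norm penalised quadratic problem at \<open>b\<close>, written in
  terms of the deviation from a target \<open>\<beta>\<close>, at which the quadratic part has gradient \<open>2 e\<close>.\<close>

locale stationary_point =
  fixes A :: "real ^ 'd ^ 'd" and b \<beta> e :: "real ^ 'd" and lam \<epsilon> t :: real
  assumes sym: "\<And>u v. u \<bullet> (A *v v) = v \<bullet> (A *v u)"
    and psd: "\<And>v. 0 \<le> v \<bullet> (A *v v)"
    and kkt_le: "\<And>j. \<bar>2 * (A *v (b - \<beta>) + e) $ j\<bar> \<le> lam"
    and kkt_eq: "\<And>j. 2 * (A *v (b - \<beta>) + e) $ j * b $ j = - lam * \<bar>b $ j\<bar>"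
    and noise: "\<And>j. \<bar>e $ j\<bar> \<le> \<epsilon>"
    and t: "0 < t" "t < 1"
    and lam: "0 < lam" "4 * (2 - t) / t * \<epsilon> \<le> lam"
begin

abbreviation "\<Delta> \<equiv> b - \<beta>"

lemma eps_le: "\<epsilon> \<le> lam * t / (4 * (2 - t))"
  using lam t by (simp add: field_simps)

lemma eps_le_quarter: "\<epsilon> \<le> lam / 4"
proof -
  have "t / (4 * (2 - t)) \<le> 1 / 4" using t by (simp add: field_simps)
  then have "lam * (t / (4 * (2 - t))) \<le> lam * (1 / 4)" using lam by (intro mult_left_mono) auto
  then have "lam * t / (4 * (2 - t)) \<le> lam / 4" by (simp only: times_divide_eq_right mult_1_right)
  then show ?thesis using eps_le by linarith
qed

text \<open>Pair the optimality condition with \<open>\<Delta>\<close>: the quadratic term is nonnegative, the noise costs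
  \<open>\<epsilon>\<close> times the whole 1-norm, and the penalty gains \<open>lam\<close> times the 1-norm off \<open>F\<close>, up to twice
  that of the target there, against a loss of at most \<open>lam\<close> times the 1-norm on \<open>F\<close>.\<close>

lemma cone_condition:
  "pnorm 1 (restr (-F) \<Delta>) \<le> (4 - t) / (4 - 3 * t) * pnorm 1 (restr F \<Delta>) + 4 * pnorm 1 (restr (-F) \<beta>)"
proof -
  define g where "g = A *v \<Delta> + e"
  define L N r where "L = pnorm 1 (restr (-F) \<Delta>)" and "N = pnorm 1 (restr F \<Delta>)"
    and "r = pnorm 1 (restr (-F) \<beta>)"
  have nonneg: "0 \<le> L" "0 \<le> N" "0 \<le> r" by (auto simp: L_def N_def r_def pnorm_nonneg)
  have coord: "2 * g $ j * \<Delta> $ j \<le> lam * (\<bar>restr F \<Delta> $ j\<bar> - \<bar>restr (-F) \<Delta> $ j\<bar> + 2 * \<bar>restr (-F) \<beta> $ j\<bar>)" for j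
  proof -
    have "\<bar>2 * g $ j * \<beta> $ j\<bar> \<le> lam * \<bar>\<beta> $ j\<bar>"
      using kkt_le[of j] by (simp add: abs_mult g_def mult_right_mono)
    then have "2 * g $ j * \<Delta> $ j \<le> lam * (\<bar>\<beta> $ j\<bar> - \<bar>b $ j\<bar>)"
      using kkt_eq[of j] by (simp add: g_def algebra_simps abs_le_iff)
    also have "\<dots> \<le> lam * (\<bar>restr F \<Delta> $ j\<bar> - \<bar>restr (-F) \<Delta> $ j\<bar> + 2 * \<bar>restr (-F) \<beta> $ j\<bar>)"
      using lam by (intro mult_left_mono) auto
    finally show ?thesis .
  qed
  have "2 * (\<Delta> \<bullet> e) \<le> 2 * (g \<bullet> \<Delta>)"
    using psd[of \<Delta>] by (simp add: g_def inner_add_left inner_add_right inner_commute)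
  also have "\<dots> = (\<Sum>j\<in>UNIV. 2 * g $ j * \<Delta> $ j)"
    by (simp add: inner_vec_def sum_distrib_left mult.assoc)
  also have "\<dots> \<le> (\<Sum>j\<in>UNIV. lam * (\<bar>restr F \<Delta> $ j\<bar> - \<bar>restr (-F) \<Delta> $ j\<bar> + 2 * \<bar>restr (-F) \<beta> $ j\<bar>))"
    by (intro sum_mono coord)
  also have "\<dots> = lam * (N - L + 2 * r)"
    by (simp only: sum_distrib_left[symmetric] sum.distrib sum_subtractf L_def N_def r_def pnorm_1)
  finally have 1: "2 * (\<Delta> \<bullet> e) \<le> lam * (N - L + 2 * r)" .
  have "- (\<Delta> \<bullet> e) \<le> (\<Sum>j\<in>UNIV. \<bar>\<Delta> $ j\<bar> * \<epsilon>)"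
    unfolding inner_vec_def sum_negf[symmetric]
  proof (intro sum_mono)
    fix j
    have "- (\<Delta> $ j * e $ j) \<le> \<bar>\<Delta> $ j\<bar> * \<bar>e $ j\<bar>" by (metis abs_ge_minus_self abs_mult)
    also have "\<dots> \<le> \<bar>\<Delta> $ j\<bar> * \<epsilon>" by (intro mult_left_mono noise) simp
    finally show "- (\<Delta> $ j \<bullet> e $ j) \<le> \<bar>\<Delta> $ j\<bar> * \<epsilon>" by simp
  qed
  also have "\<dots> = \<epsilon> * (N + L)"
    using pnorm_1_split[of \<Delta> F] by (simp add: sum_distrib_right[symmetric] L_def N_def pnorm_1)
  finally have 2: "- (\<Delta> \<bullet> e) \<le> \<epsilon> * (N + L)" .
  have "\<epsilon> * (N + L) \<le> lam * t / (4 * (2 - t)) * (N + L)"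
    using eps_le nonneg by (intro mult_right_mono) auto
  moreover have "lam * (L - N - 2 * r) = - (lam * (N - L + 2 * r))" by (simp add: algebra_simps)
  ultimately have "lam * (L - N - 2 * r) \<le> 2 * (lam * t / (4 * (2 - t)) * (N + L))"
    using 1 2 by linarith
  also have "\<dots> = lam * (t / (2 * (2 - t)) * (N + L))"
    using t by (simp add: field_simps)
  finally have "L - N - 2 * r \<le> t / (2 * (2 - t)) * (N + L)"
    using lam(1) by (simp only: mult_le_cancel_left_pos)
  then have "(L - N - 2 * r) * (2 * (2 - t)) \<le> t * (N + L)"
    using t by (simp add: field_simps)
  then have "L * (4 - 3 * t) \<le> (4 - t) * N + 4 * (2 - t) * r"
    by (simp add: algebra_simps)
  also have "4 * (2 - t) * r \<le> 4 * (4 - 3 * t) * r"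
    using t nonneg by (intro mult_right_mono) auto
  finally have "L * (4 - 3 * t) \<le> (4 - t) * N + 4 * (4 - 3 * t) * r" by simp
  also have "\<dots> = ((4 - t) / (4 - 3 * t) * N + 4 * r) * (4 - 3 * t)"
    using t by (simp add: distrib_right)
  finally have "L * (4 - 3 * t) \<le> ((4 - t) / (4 - 3 * t) * N + 4 * r) * (4 - 3 * t)" .
  then show ?thesis using t by (simp add: L_def N_def r_def)
qed

lemma gradient_le: "\<bar>(A *v \<Delta>) $ j\<bar> \<le> 3 / 4 * lam"
proof -
  have "\<bar>x\<bar> \<le> 3 / 4 * lam" if "\<bar>2 * (x + y)\<bar> \<le> lam" "\<bar>y\<bar> \<le> \<epsilon>" for x y
    using that eps_le_quarter by argo
  then show ?thesis using kkt_le[of j] noise[of j] by simp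
qed

text \<open>At a nonzero coordinate of \<open>b\<close> the penalty contributes \<open>lam / 2\<close> with the sign of \<open>- b\<close>, more than the
  noise can compensate.\<close>

lemma gradient_sign: "sgn (b $ j) * (A *v \<Delta>) $ j \<le> 0"
proof -
  have "2 * ((A *v \<Delta>) $ j + e $ j) * b $ j = (- lam * sgn (b $ j)) * b $ j"
    using kkt_eq[of j] by (simp add: abs_sgn)
  then have "b $ j \<noteq> 0 \<Longrightarrow> 2 * ((A *v \<Delta>) $ j + e $ j) = - lam * sgn (b $ j)"
    using mult_right_cancel by blast
  then show ?thesis using noise[of j] eps_le_quarter lam by (auto simp: sgn_if split: if_splits)
qed

end

text \<open>The coordinates split into a set \<open>F\<close>, meant to carry the \<open>k\<close> largest entries of the target, the \<open>l\<close> coordinates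
  \<open>J\<^sub>0\<close> off \<open>F\<close> with the largest deviation, and the rest.\<close>

locale partitioned_stationary_point = stationary_point A b \<beta> e lam \<epsilon> t
  for A :: "real ^ 'd ^ 'd" and b \<beta> e :: "real ^ 'd" and lam \<epsilon> t :: real +
  fixes F J\<^sub>0 :: "'d set" and k l :: nat and p :: ereal
  assumes p: "1 \<le> p"
    and F: "card F = k" "1 \<le> k"
    and J: "J\<^sub>0 \<subseteq> -F" "card J\<^sub>0 = l"
    and J_top: "\<And>i j. i \<in> J\<^sub>0 \<Longrightarrow> j \<notin> F \<union> J\<^sub>0 \<Longrightarrow> \<bar>\<Delta> $ j\<bar> \<le> \<bar>\<Delta> $ i\<bar>"
    and kl: "k \<le> l" and room: "k + 2 * l \<le> CARD('d)"
begin

abbreviation "I \<equiv> F \<union> J\<^sub>0"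
abbreviation "R \<equiv> - I"
abbreviation "L \<equiv> pnorm 1 (restr (-F) \<Delta>)"
abbreviation "r\<^sub>1 \<equiv> pnorm 1 (restr (-F) \<beta>)"

lemma card_I: "card I = k + l"
  using F J by (subst card_Un_disjoint) auto

lemma F_ne: "F \<noteq> {}" using F by auto

lemma l_pos: "0 < l" using kl F by simp

lemma L_split: "L = (\<Sum>i\<in>J\<^sub>0. \<bar>\<Delta> $ i\<bar>) + pnorm 1 (restr R \<Delta>)"
proof -
  have "L = pnorm 1 (restr J\<^sub>0 (restr (-F) \<Delta>)) + pnorm 1 (restr (-J\<^sub>0) (restr (-F) \<Delta>))"
    by (rule pnorm_1_split)
  also have "restr J\<^sub>0 (restr (-F) \<Delta>) = restr J\<^sub>0 \<Delta>" using J by (auto simp: vec_eq_iff)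
  also have "restr (-J\<^sub>0) (restr (-F) \<Delta>) = restr R \<Delta>" by (auto simp: vec_eq_iff)
  finally show ?thesis by (simp add: pnorm_1_restr)
qed

lemma rest_le: "\<bar>restr R \<Delta> $ j\<bar> \<le> (\<Sum>i\<in>J\<^sub>0. \<bar>\<Delta> $ i\<bar>) / l"
proof (cases "j \<in> R")
  case True
  have "real l * \<bar>\<Delta> $ j\<bar> = (\<Sum>i\<in>J\<^sub>0. \<bar>\<Delta> $ j\<bar>)" using J by simp
  also have "\<dots> \<le> (\<Sum>i\<in>J\<^sub>0. \<bar>\<Delta> $ i\<bar>)" using J_top True by (intro sum_mono) auto
  finally show ?thesis using True l_pos by (simp add: field_simps)
qed (auto intro!: sum_nonneg divide_nonneg_nonneg)

text \<open>The block \<open>J\<^sub>0\<close> pays for the first block of the rest, so the total cost is the 1-norm off \<open>F\<close> divided by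
  \<open>l\<close>.\<close>

lemma rest_bound:
  assumes "\<And>u v. \<phi> (u + v) \<le> \<phi> u + \<phi> v" "0 \<le> C"
    "\<And>J u. card J = l \<Longrightarrow> I \<inter> J = {} \<Longrightarrow> (\<And>i. i \<notin> J \<Longrightarrow> u $ i = 0) \<Longrightarrow> \<phi> u \<le> C * infnorm u"
  shows "\<phi> (restr R \<Delta>) \<le> C * (L / l)"
proof -
  have "\<phi> (restr R \<Delta>) \<le> C * ((\<Sum>i\<in>J\<^sub>0. \<bar>\<Delta> $ i\<bar>) / l + pnorm 1 (restr R \<Delta>) / l)"
    using l_pos card_I room by (intro block_decomposition_bound[where I = I] assms rest_le) auto
  then show ?thesis by (simp add: L_split add_divide_distrib)
qed

lemma L_le:
  "L \<le> (4 - t) / (4 - 3 * t) * real k powr (1 - inv_exp p) * pnorm p (restr F \<Delta>) + 4 * r\<^sub>1"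
proof -
  have "pnorm 1 (restr F \<Delta>) \<le> real k powr (1 - inv_exp p) * pnorm p (restr F \<Delta>)"
    using pnorm_1_le[OF p F_ne, of "restr F \<Delta>"] F by simp
  then have "(4 - t) / (4 - 3 * t) * pnorm 1 (restr F \<Delta>)
      \<le> (4 - t) / (4 - 3 * t) * (real k powr (1 - inv_exp p) * pnorm p (restr F \<Delta>))"
    using t by (intro mult_left_mono) auto
  then show ?thesis using cone_condition[of F] by simp
qed

text \<open>The absorption step: \<open>c\<close> stands for \<open>gam\<close> or \<open>ppi\<close>, and its threshold condition leaves a factor
  \<open>1 - t / 2\<close> in front of the norm \<open>N\<close> that is being estimated.\<close>

lemma rest_weight_le:
  assumes "0 \<le> c" "c * (real k powr (1 - inv_exp p) / l) \<le> 1 - t" "pnorm p (restr F \<Delta>) \<le> N"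
  shows "c * (L / l) \<le> (1 - t / 2) * N + 4 * c * r\<^sub>1 / l"
proof -
  define q where "q = real k powr (1 - inv_exp p)"
  have N: "0 \<le> N" using assms(3) pnorm_nonneg order_trans by blast
  have "(4 - t) / (4 - 3 * t) * q * pnorm p (restr F \<Delta>) \<le> (4 - t) / (4 - 3 * t) * q * N"
    using assms t by (intro mult_left_mono) (auto simp: q_def)
  then have "L \<le> (4 - t) / (4 - 3 * t) * q * N + 4 * r\<^sub>1"
    using L_le unfolding q_def[symmetric] by linarith
  then have "c * (L / l) \<le> c * (((4 - t) / (4 - 3 * t) * q * N + 4 * r\<^sub>1) / l)"
    using assms by (intro mult_left_mono divide_right_mono) auto
  also have "\<dots> = (4 - t) / (4 - 3 * t) * (c * (q / l)) * N + 4 * c * r\<^sub>1 / l"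
    by (simp add: algebra_simps add_divide_distrib)
  also have "\<dots> \<le> (1 - t / 2) * N + 4 * c * r\<^sub>1 / l"
    using cone_constant_contracts[of t "c * (q / l)"] assms N t
    by (intro add_right_mono mult_right_mono) (auto simp: q_def)
  finally show ?thesis .
qed

text \<open>From \<open>I\<close> to all coordinates. For \<open>q = 1\<close> the cone condition suffices. For \<open>q = p\<close> the rest is
  interpolated, and \<open>k \<le> l\<close> turns \<open>k powr (1 - 1/p)\<close> times \<open>l powr (1/p - 1)\<close> into at most
  \<open>1\<close>.\<close>

lemma deviation_norm_le:
  assumes q: "q \<in> {1, p}" and N: "pnorm p (restr F \<Delta>) \<le> N" "pnorm p (restr I \<Delta>) \<le> N + s" "0 \<le> s"
  shows "pnorm q \<Delta> \<le> 4 * real k powr (inv_exp q - inv_exp p) * N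
    + 4 * real k powr (inv_exp q - inv_exp p) * s + 4 * r\<^sub>1 * real l powr (inv_exp q - 1)"
proof -
  define P where "P = real k powr (1 - inv_exp p)"
  have N0: "0 \<le> N" using N(1) pnorm_nonneg order_trans by blast
  have "(4 - t) / (4 - 3 * t) * P * pnorm p (restr F \<Delta>) \<le> 3 * P * N"
    using cone_constant_le_3 t N N0 pnorm_nonneg[of p "restr F \<Delta>"] by (intro mult_mono) (auto simp: P_def)
  then have L3: "L \<le> 3 * P * N + 4 * r\<^sub>1" using L_le unfolding P_def by linarith
  show ?thesis
  proof (cases "q = 1")
    case True
    have "pnorm 1 (restr F \<Delta>) \<le> P * pnorm p (restr F \<Delta>)"
      using pnorm_1_le[OF p F_ne, of "restr F \<Delta>"] F by (simp add: P_def)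
    also have "\<dots> \<le> P * N" using N by (intro mult_left_mono) (auto simp: P_def)
    finally have "pnorm 1 \<Delta> \<le> 4 * P * N + 4 * r\<^sub>1"
      using pnorm_1_split[of \<Delta> F] L3 by simp
    moreover have "0 \<le> 4 * P * s" using N by (simp add: P_def)
    ultimately have "pnorm q \<Delta> \<le> 4 * P * N + 4 * P * s + 4 * r\<^sub>1" using True by simp
    then show ?thesis using True l_pos by (simp only: P_def inv_exp_1 diff_self powr_zero_eq_one) simp
  next
    case False
    then have qp: "q = p" using q by simp
    have "\<bar>restr R \<Delta> $ j\<bar> \<le> L / l" for j
    proof -
      have "(\<Sum>i\<in>J\<^sub>0. \<bar>\<Delta> $ i\<bar>) / l \<le> L / l"
        using L_split pnorm_nonneg[of 1 "restr R \<Delta>"] by (intro divide_right_mono) auto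
      then show ?thesis using rest_le[of j] by linarith
    qed
    then have "pnorm p (restr R \<Delta>) \<le> L * real l powr (inv_exp p - 1)"
      using L_split p l_pos by (intro pnorm_le_interpolation) (auto simp: sum_nonneg)
    also have "\<dots> \<le> (3 * P * N + 4 * r\<^sub>1) * real l powr (inv_exp p - 1)"
      using L3 by (intro mult_right_mono) auto
    also have "P * real l powr (inv_exp p - 1) \<le> 1"
    proof -
      have "P \<le> real l powr (1 - inv_exp p)"
        unfolding P_def using kl inv_exp_le_1[OF p] by (intro powr_mono2) auto
      then have "P * real l powr (inv_exp p - 1) \<le> real l powr (1 - inv_exp p) * real l powr (inv_exp p - 1)"
        by (intro mult_right_mono) auto
      also have "\<dots> = 1" using l_pos by (simp add: powr_add[symmetric])
      finally show ?thesis .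
    qed
    then have "(3 * P * N + 4 * r\<^sub>1) * real l powr (inv_exp p - 1)
       \<le> 3 * N + 4 * r\<^sub>1 * real l powr (inv_exp p - 1)"
      using N0 mult_right_mono[of "P * real l powr (inv_exp p - 1)" 1 "3 * N"]
      by (simp add: algebra_simps)
    finally have "pnorm p (restr R \<Delta>) \<le> 3 * N + 4 * r\<^sub>1 * real l powr (inv_exp p - 1)" .
    moreover have "pnorm p \<Delta> \<le> pnorm p (restr I \<Delta>) + pnorm p (restr R \<Delta>)"
    proof -
      have "\<Delta> = restr I \<Delta> + restr R \<Delta>" by (auto simp: vec_eq_iff)
      then show ?thesis using pnorm_triangle[OF p] by metis
    qed
    ultimately show ?thesis using N kl F qp by simp
  qed
qed

text \<open>Applying the inverse of \<open>A\<close> on \<open>I\<close> to the \<open>I\<close>-part of \<open>A *v \<Delta>\<close> gives the \<open>I\<close>-part of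
  \<open>\<Delta>\<close> plus the images of the blocks of the rest. Testing with the dual vector of the \<open>I\<close>-part turns norms
  into linear functionals, for which the block bound is available.\<close>

lemma gamma_bound:
  fixes B :: "real ^ 'd ^ 'd"
  assumes inv: "\<And>w. (\<And>i. i \<notin> I \<Longrightarrow> w $ i = 0) \<Longrightarrow> B *v restr I (A *v w) = w"
    and \<gamma>: "0 \<le> \<gamma>" "\<And>J u. card J = l \<Longrightarrow> I \<inter> J = {} \<Longrightarrow> (\<And>i. i \<notin> J \<Longrightarrow> u $ i = 0) \<Longrightarrow>
        pnorm p (B *v restr I (A *v u)) \<le> \<gamma> * infnorm u"
    and Y: "pnorm p (B *v restr I (A *v \<Delta>)) \<le> Y"
    and t_le: "t \<le> 1 - \<gamma> * (real k powr (1 - inv_exp p) / l)"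
  shows "pnorm p (restr I \<Delta>) \<le> 2 / t * (4 * \<gamma> * r\<^sub>1 / l + Y)"
proof (cases "restr I \<Delta> = 0")
  case True
  have "0 \<le> Y" using Y pnorm_nonneg order_trans by blast
  then show ?thesis using True \<gamma> t pnorm_nonneg[of 1 "restr (-F) \<beta>"] by simp
next
  case False
  define w s S where "w = restr I \<Delta>" and "s = sgn_pow p w" and "S = dual_scale p w"
  have S: "0 < S" using False p by (simp add: S_def w_def dual_scale_pos)
  have holder: "s \<bullet> z \<le> S * pnorm p z" for z
    unfolding s_def S_def using p False by (intro dual_pairing_le) (auto simp: w_def)
  have add: "restr I (u + v) = restr I u + restr I v" for u v :: "real ^ 'd"
    by (auto simp: vec_eq_iff)
  have neg: "B *v restr I (A *v (- u)) = - (B *v restr I (A *v u))" for u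
  proof -
    have "restr I (- z) = - restr I z" for z :: "real ^ 'd" by (auto simp: vec_eq_iff)
    then show ?thesis by (simp only: matrix_vector_mult_uminus)
  qed
  define \<phi> where "\<phi> = (\<lambda>z. - (s \<bullet> (B *v restr I (A *v z))))"
  have "\<phi> (restr R \<Delta>) \<le> (S * \<gamma>) * (L / l)"
  proof (rule rest_bound)
    show "\<phi> (u + v) \<le> \<phi> u + \<phi> v" for u v
      by (simp add: \<phi>_def add matrix_vector_right_distrib inner_add_right)
    show "0 \<le> S * \<gamma>" using S \<gamma> by simp
    fix J and u :: "real ^ 'd" assume Ju: "card J = l" "I \<inter> J = {}" "\<And>i. i \<notin> J \<Longrightarrow> u $ i = 0"
    have "\<phi> u = s \<bullet> (B *v restr I (A *v (- u)))" by (simp only: \<phi>_def neg inner_minus_right)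
    also have "\<dots> \<le> S * pnorm p (B *v restr I (A *v (- u)))" by (rule holder)
    also have "\<dots> \<le> S * (\<gamma> * infnorm (- u))" using S Ju by (intro mult_left_mono \<gamma>(2)) auto
    finally show "\<phi> u \<le> S * \<gamma> * infnorm u" by (simp add: infnorm_neg)
  qed
  moreover have "s \<bullet> w = s \<bullet> (B *v restr I (A *v \<Delta>)) + \<phi> (restr R \<Delta>)"
  proof -
    have "w = \<Delta> + (- restr R \<Delta>)" by (auto simp: w_def vec_eq_iff)
    then have "B *v restr I (A *v w) = B *v restr I (A *v \<Delta>) + B *v restr I (A *v (- restr R \<Delta>))"
      by (simp only: add matrix_vector_right_distrib)
    then have "w = B *v restr I (A *v \<Delta>) + B *v restr I (A *v (- restr R \<Delta>))"
      using inv[of w] by (simp add: w_def)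
    then show ?thesis unfolding \<phi>_def neg by (metis inner_add_right inner_minus_right)
  qed
  moreover have "s \<bullet> w = S * pnorm p w"
    unfolding s_def S_def using p False by (intro dual_pairing_self) (auto simp: w_def)
  moreover have "S * (Y + \<gamma> * (L / l)) = S * Y + S * \<gamma> * (L / l)" by (simp add: algebra_simps)
  moreover have "S * pnorm p (B *v restr I (A *v \<Delta>)) \<le> S * Y" using Y S by simp
  ultimately have "S * pnorm p w \<le> S * (Y + \<gamma> * (L / l))"
    using holder[of "B *v restr I (A *v \<Delta>)"] by linarith
  then have "pnorm p w \<le> Y + \<gamma> * (L / l)" using S by simp
  also have "\<dots> \<le> Y + ((1 - t / 2) * pnorm p w + 4 * \<gamma> * r\<^sub>1 / l)"
    using \<gamma> t_le p by (intro add_left_mono rest_weight_le) (auto simp: w_def intro!: pnorm_mono)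
  finally have "t / 2 * pnorm p w \<le> 4 * \<gamma> * r\<^sub>1 / l + Y" by (simp add: algebra_simps)
  then show ?thesis using t unfolding w_def by (simp add: field_simps)
qed

text \<open>On \<open>J\<^sub>0\<close> the target is dropped from the deviation. There the entries of \<open>hybrid\<close>, hence of its dual
  vector, have the sign of \<open>b\<close>, which the gradient opposes.\<close>

definition "hybrid = restr F \<Delta> + restr J\<^sub>0 b"

lemma hybrid_nth: "hybrid $ i = (if i \<in> F then \<Delta> $ i else if i \<in> J\<^sub>0 then b $ i else 0)"
  using J by (auto simp: hybrid_def)

text \<open>Let \<open>s\<close> be the dual vector of \<open>hybrid\<close> and \<open>D = s \<bullet> (A *v hybrid)\<close>. Replacing \<open>hybrid\<close> by
  \<open>\<Delta>\<close> leaves the gradient term, the target on \<open>J\<^sub>0\<close> (bounded by \<open>X\<close>) and the blocks of the rest, and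
  \<open>\<pi>\<close> bounds each block by a multiple of \<open>D\<close> itself. Hence the blocks are absorbed in \<open>D\<close>, and \<open>\<omega>\<close>
  converts \<open>D\<close> into the norm of \<open>hybrid\<close> only at the end.\<close>

lemma pi_bound:
  assumes \<pi>: "0 \<le> \<pi>" "\<And>v J u. v \<noteq> 0 \<Longrightarrow> (\<And>i. i \<notin> I \<Longrightarrow> v $ i = 0) \<Longrightarrow> card J = l \<Longrightarrow> I \<inter> J = {} \<Longrightarrow>
        (\<And>i. i \<notin> J \<Longrightarrow> u $ i = 0) \<Longrightarrow>
        (sgn_pow p v \<bullet> (A *v u)) * pnorm p v \<le> \<pi> * (sgn_pow p v \<bullet> (A *v v)) * infnorm u"
    and \<omega>: "0 < \<omega>" "\<And>v. v \<noteq> 0 \<Longrightarrow> (\<And>i. i \<notin> I \<Longrightarrow> v $ i = 0) \<Longrightarrow>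
        \<omega> * (dual_scale p v * pnorm p v) \<le> sgn_pow p v \<bullet> (A *v v)"
    and X: "pnorm p (restr I (A *v restr J\<^sub>0 \<beta>)) \<le> X"
    and t_le: "t \<le> 1 - \<pi> * (real k powr (1 - inv_exp p) / l)"
  shows "pnorm p hybrid \<le> 2 / (t * \<omega>) * (X + real k powr inv_exp p * lam) + 8 * \<pi> * r\<^sub>1 / (t * l)"
proof (cases "hybrid = 0")
  case True
  have "0 \<le> X" using X pnorm_nonneg order_trans by blast
  then show ?thesis using True \<pi> \<omega> t lam pnorm_nonneg[of 1 "restr (-F) \<beta>"] by simp
next
  case False
  define s S P where "s = sgn_pow p hybrid" and "S = dual_scale p hybrid" and "P = pnorm p hybrid"
  define D where "D = s \<bullet> (A *v hybrid)"
  have S: "0 < S" "0 < P" using False p by (auto simp: S_def P_def dual_scale_pos pnorm_pos)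
  have supp: "i \<notin> I \<Longrightarrow> hybrid $ i = 0" for i by (simp add: hybrid_nth)
  then have s_supp: "i \<notin> I \<Longrightarrow> s $ i = 0" for i unfolding s_def by (intro sgn_pow_eq_0) auto
  have holder: "s \<bullet> z \<le> S * pnorm p z" for z
    unfolding s_def S_def using p False by (intro dual_pairing_le) auto
  have \<omega>D: "\<omega> * (S * P) \<le> D" unfolding D_def s_def S_def P_def by (rule \<omega>(2)[OF False supp])
  then have D: "0 < D" using \<omega> S by (smt (verit) mult_pos_pos)
  have rest: "- (s \<bullet> (A *v restr R \<Delta>)) \<le> (\<pi> * D / P) * (L / l)"
  proof (rule rest_bound)
    show "- (s \<bullet> (A *v (u + v))) \<le> - (s \<bullet> (A *v u)) + - (s \<bullet> (A *v v))" for u v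
      by (simp add: matrix_vector_right_distrib inner_add_right)
    show "0 \<le> \<pi> * D / P" using S D \<pi> by simp
    fix J and u :: "real ^ 'd" assume Ju: "card J = l" "I \<inter> J = {}" "\<And>i. i \<notin> J \<Longrightarrow> u $ i = 0"
    have "(s \<bullet> (A *v (- u))) * P \<le> \<pi> * D * infnorm (- u)"
      unfolding s_def P_def D_def using Ju supp False by (intro \<pi>(2)) auto
    then show "- (s \<bullet> (A *v u)) \<le> \<pi> * D / P * infnorm u"
      using S by (simp add: infnorm_neg matrix_vector_mult_uminus field_simps)
  qed
  have grad: "s \<bullet> (A *v \<Delta>) \<le> S * (real k powr inv_exp p * lam)"
  proof -
    have coord: "s $ i * (A *v \<Delta>) $ i \<le> (if i \<in> F then \<bar>s $ i\<bar> * lam else 0)" for i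
    proof -
      consider "i \<in> F" | "i \<in> J\<^sub>0" "i \<notin> F" | "i \<notin> I" by blast
      then show ?thesis
      proof cases
        case 1
        have "s $ i * (A *v \<Delta>) $ i \<le> \<bar>s $ i\<bar> * \<bar>(A *v \<Delta>) $ i\<bar>" by (metis abs_ge_self abs_mult)
        also have "\<dots> \<le> \<bar>s $ i\<bar> * lam" using gradient_le[of i] lam by (intro mult_left_mono) auto
        finally show ?thesis using 1 by simp
      next
        case 2
        have "s $ i = \<bar>s $ i\<bar> * sgn (b $ i)"
          using sgn_pow_sgn[of p hybrid i] 2 by (simp add: s_def hybrid_nth)
        then have "s $ i * (A *v \<Delta>) $ i = \<bar>s $ i\<bar> * (sgn (b $ i) * (A *v \<Delta>) $ i)"
          by (metis mult.assoc)
        also have "\<dots> \<le> 0" by (intro mult_nonneg_nonpos gradient_sign abs_ge_zero)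
        finally show ?thesis using 2 by simp
      next
        case 3
        then show ?thesis using s_supp by simp
      qed
    qed
    have "s \<bullet> (A *v \<Delta>) \<le> (\<Sum>i\<in>UNIV. if i \<in> F then \<bar>s $ i\<bar> * lam else 0)"
      unfolding inner_vec_def using coord by (intro sum_mono) simp
    also have "\<dots> = (\<Sum>i\<in>F. \<bar>s $ i\<bar>) * lam" by (simp add: sum.If_cases sum_distrib_right)
    also have "\<dots> \<le> (S * real (card F) powr inv_exp p) * lam"
      unfolding s_def S_def using p False F_ne lam by (intro mult_right_mono sum_abs_sgn_pow_le) auto
    finally show ?thesis using F by (simp add: mult_ac)
  qed
  have "s \<bullet> (A *v restr J\<^sub>0 \<beta>) = s \<bullet> restr I (A *v restr J\<^sub>0 \<beta>)"
    using s_supp by (rule inner_restr[symmetric])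
  also have "\<dots> \<le> S * X" using holder S X by (meson mult_left_mono less_imp_le order_trans)
  finally have target: "s \<bullet> (A *v restr J\<^sub>0 \<beta>) \<le> S * X" .
  have "hybrid = \<Delta> + restr J\<^sub>0 \<beta> - restr R \<Delta>" using J by (auto simp: vec_eq_iff hybrid_nth)
  then have "D = s \<bullet> (A *v \<Delta>) + s \<bullet> (A *v restr J\<^sub>0 \<beta>) + - (s \<bullet> (A *v restr R \<Delta>))"
    unfolding D_def by (metis (no_types, lifting) inner_add_right inner_diff_right matrix_vector_mult_diff_distrib
        matrix_vector_right_distrib diff_conv_add_uminus)
  then have "D \<le> S * (X + real k powr inv_exp p * lam) + (D / P) * (\<pi> * (L / l))"
    using grad target rest by (simp add: algebra_simps)
  moreover have "\<pi> * (L / l) \<le> (1 - t / 2) * P + 4 * \<pi> * r\<^sub>1 / l"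
    using \<pi> t_le p unfolding P_def
    by (intro rest_weight_le) (auto simp: hybrid_nth intro!: pnorm_mono)
  then have "(D / P) * (\<pi> * (L / l)) \<le> (D / P) * ((1 - t / 2) * P + 4 * \<pi> * r\<^sub>1 / l)"
    using D S by (intro mult_left_mono) auto
  ultimately have main: "D \<le> S * (X + real k powr inv_exp p * lam) + (D / P) * ((1 - t / 2) * P + 4 * \<pi> * r\<^sub>1 / l)"
    by linarith
  define W Z where "W = X + real k powr inv_exp p * lam" and "Z = 4 * \<pi> * r\<^sub>1 / l"
  have main': "D * (t / 2 * P - Z) \<le> S * W * P"
  proof -
    have "D * P \<le> (S * W + (D / P) * ((1 - t / 2) * P + Z)) * P"
      using main S unfolding W_def Z_def by (intro mult_right_mono) auto
    also have "\<dots> = S * W * P + D * ((1 - t / 2) * P + Z)" using S by (simp add: field_simps)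
    finally show ?thesis by (simp add: algebra_simps)
  qed
  have W: "0 \<le> W" using X pnorm_nonneg[of p "restr I (A *v restr J\<^sub>0 \<beta>)"] lam by (simp add: W_def)
  have "t / 2 * P - Z \<le> W / \<omega>"
  proof (cases "t / 2 * P - Z \<le> 0")
    case True
    moreover have "0 \<le> W / \<omega>" using W \<omega> by simp
    ultimately show ?thesis by linarith
  next
    case False
    then have "(\<omega> * (S * P)) * (t / 2 * P - Z) \<le> D * (t / 2 * P - Z)" using \<omega>D by (intro mult_right_mono) auto
    then have "(S * P) * (\<omega> * (t / 2 * P - Z)) \<le> (S * P) * W" using main' by (simp add: mult_ac)
    then have "\<omega> * (t / 2 * P - Z) \<le> W" using S by simp
    then show ?thesis using \<omega> by (simp add: field_simps)
  qed
  then have "P \<le> 2 / t * (W / \<omega> + Z)" using t by (simp add: field_simps)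
  then show ?thesis using t \<omega> l_pos unfolding P_def W_def Z_def by (simp add: field_simps)
qed

lemma hybrid_dominates:
  "pnorm p (restr F \<Delta>) \<le> pnorm p hybrid"
  "pnorm p (restr I \<Delta>) \<le> pnorm p hybrid + pnorm p (restr (-F) \<beta>)"
proof -
  show "pnorm p (restr F \<Delta>) \<le> pnorm p hybrid" using p by (intro pnorm_mono) (auto simp: hybrid_nth)
  have "restr I \<Delta> = hybrid + restr J\<^sub>0 (- \<beta>)" using J by (auto simp: vec_eq_iff hybrid_nth)
  then have "pnorm p (restr I \<Delta>) \<le> pnorm p hybrid + pnorm p (restr J\<^sub>0 (- \<beta>))"
    using pnorm_triangle[OF p] by metis
  also have "pnorm p (restr J\<^sub>0 (- \<beta>)) \<le> pnorm p (restr (-F) \<beta>)"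
    using p J by (intro pnorm_mono) auto
  finally show "pnorm p (restr I \<Delta>) \<le> pnorm p hybrid + pnorm p (restr (-F) \<beta>)" by simp
qed

end

context partitioned_stationary_point
begin

text \<open>If \<open>x\<close> were infinite, the right-hand side of the threshold would be \<open>-\<infinity>\<close>, as \<open>k\<close> is positive.\<close>

lemma threshold_finite:
  assumes "ereal t \<le> 1 - x * ereal (real k powr (1 - inv_exp p) / real l)" "0 \<le> x"
  obtains y where "x = ereal y" "0 \<le> y" "t \<le> 1 - y * (real k powr (1 - inv_exp p) / real l)"
proof -
  define c where "c = real k powr (1 - inv_exp p) / real l"
  have c: "0 < c" using F l_pos by (simp add: c_def)
  show thesis
  proof (cases x)
    case (real y)
    then show thesis using assms that[of y] by (simp add: one_ereal_def)
  next
    case PInf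
    then have "x * ereal c = \<infinity>" using c by simp
    have "ereal t \<le> 1 - \<infinity>" using assms(1) unfolding c_def[symmetric] \<open>x * ereal c = \<infinity>\<close> .
    then show thesis by (simp add: one_ereal_def)
  qed (use assms in auto)
qed

lemma dimensions: "0 < k + l" "k + l \<le> CARD('d)" "(k + l) + l \<le> CARD('d)"
  using l_pos room by auto

theorem deviation_bound_pi:
  assumes q: "q \<in> {1, p}" and rp: "pnorm p (restr (-F) \<beta>) = rp"
    and thr: "ereal t \<le> 1 - ppi p A (k + l) l * ereal (real k powr (1 - inv_exp p) / real l)"
    and kq: "kq = real k powr (inv_exp q - inv_exp p)"
  shows "ereal (pnorm q \<Delta>) \<le> eratio (ereal (8 * kq)) (ereal t * omega p A (k + l)) *
           (rho p A (k + l) * ereal rp + ereal (real k powr inv_exp p * lam))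
         + ereal (32 * kq / t) * ppi p A (k + l) l * ereal (r\<^sub>1 / real l)
         + ereal (4 * kq * rp) + ereal (4 * r\<^sub>1 * real l powr (inv_exp q - 1))"
proof -
  have kq0: "0 < kq" using F by (simp add: kq)
  have rp0: "0 \<le> rp" using rp pnorm_nonneg by metis
  obtain \<pi> where \<pi>: "ppi p A (k + l) l = ereal \<pi>" "0 \<le> \<pi>" "t \<le> 1 - \<pi> * (real k powr (1 - inv_exp p) / real l)"
    using threshold_finite[OF thr ppi_nonneg[OF dimensions(3,1) l_pos sym]] .
  have \<rho>0: "0 \<le> rho p A (k + l)" using p dimensions by (intro rho_nonneg) auto
  define c where "c = real k powr inv_exp p * lam"
  have c0: "0 < c" using F lam by (simp add: c_def)
  have I_ne: "I \<noteq> {}" using F_ne by auto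
  then obtain v where v: "v \<in> nonzero_on I" using nonzero_on_nonempty[of I] by blast
  have \<omega>_le: "omega p A (k + l) \<le> ereal (max 0 (sgn_pow p v \<bullet> (A *v v)) / (dual_scale p v * pnorm p v))"
    if "v \<in> nonzero_on I" for v
    using omega_lower[OF p card_I that sym] .
  obtain \<omega> where \<omega>: "omega p A (k + l) = ereal \<omega>" "0 \<le> \<omega>"
    using \<omega>_le[OF v] omega_nonneg[of p A "k + l"] by (cases "omega p A (k + l)") auto
  obtain J where J': "card J = l" "I \<inter> J = {}"
  proof -
    have "l \<le> card (UNIV - I)" using dimensions card_I by (simp add: card_Diff_subset)
    then obtain J where "J \<subseteq> UNIV - I" "card J = l" using obtain_subset_with_card_n by metis
    then show thesis using that by blast
  qed
  show ?thesis
  \<comment> \<open>In these two cases the right-hand side is infinite: as \<open>lam\<close> is positive, the second factor is not zero,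
  and \<open>\<omega>\<close> is finite, so neither is the first.\<close>
  proof (cases "\<omega> = 0 \<or> rho p A (k + l) * ereal rp = \<infinity>")
    case True
    have "eratio (ereal (8 * kq)) (ereal t * omega p A (k + l)) * (rho p A (k + l) * ereal rp + ereal c) = \<infinity>"
    proof (cases "\<omega> = 0")
      case True
      have "0 \<le> rho p A (k + l) * ereal rp" using \<rho>0 rp0 by simp
      then have "0 < rho p A (k + l) * ereal rp + ereal c"
        using c0 by (cases "rho p A (k + l) * ereal rp") auto
      then show ?thesis using True \<omega> by (simp add: ereal_mult_infty zero_ereal_def[symmetric])
    next
      case False
      then have "rho p A (k + l) * ereal rp = \<infinity>" using True by simp
      then show ?thesis using False \<omega> t kq0 by (simp add: eratio_pos)
    qed
    then show ?thesis unfolding c_def \<pi>(1) by (simp only:) simp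
  next
    case False
    then have \<omega>0: "0 < \<omega>" using \<omega> by simp
    have "0 \<le> rho p A (k + l) * ereal rp" using \<rho>0 rp0 by simp
    with False obtain X where X: "rho p A (k + l) * ereal rp = ereal X"
      by (cases "rho p A (k + l) * ereal rp") auto
    have "pnorm p (restr J\<^sub>0 \<beta>) \<le> rp" unfolding rp[symmetric] using p J by (intro pnorm_mono) auto
    then have "ereal (pnorm p (restr I (A *v restr J\<^sub>0 \<beta>))) \<le> rho p A (k + l) * ereal rp"
      using p card_I dimensions by (intro rho_bound) auto
    then have X_le: "pnorm p (restr I (A *v restr J\<^sub>0 \<beta>)) \<le> X" by (simp add: X)
    have "pnorm p hybrid \<le> 2 / (t * \<omega>) * (X + real k powr inv_exp p * lam) + 8 * \<pi> * r\<^sub>1 / (t * l)"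
    proof (rule pi_bound[OF \<pi>(2) _ \<omega>0 _ X_le \<pi>(3)])
      fix v u :: "real ^ 'd" and J
      assume a: "v \<noteq> 0" "\<And>i. i \<notin> I \<Longrightarrow> v $ i = 0" "card J = l" "I \<inter> J = {}" "\<And>i. i \<notin> J \<Longrightarrow> u $ i = 0"
      then have "v \<in> nonzero_on I" by (auto simp: nonzero_on_def)
      then show "(sgn_pow p v \<bullet> (A *v u)) * pnorm p v \<le> \<pi> * (sgn_pow p v \<bullet> (A *v v)) * infnorm u"
        using ppi_bound[OF card_I a(3,4) l_pos _ a(5) sym \<pi>(1)] by blast
    next
      fix v :: "real ^ 'd"
      assume a: "v \<noteq> 0" "\<And>i. i \<notin> I \<Longrightarrow> v $ i = 0"
      then have v: "v \<in> nonzero_on I" by (auto simp: nonzero_on_def)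
      have "0 < sgn_pow p v \<bullet> (A *v v)" using ppi_finite_pos[OF card_I J' l_pos v sym] \<pi> by simp
      moreover have "0 < dual_scale p v * pnorm p v" using p a by (simp add: dual_scale_pos pnorm_pos)
      ultimately show "\<omega> * (dual_scale p v * pnorm p v) \<le> sgn_pow p v \<bullet> (A *v v)"
        using \<omega>_le[OF v] \<omega> by (simp add: field_simps)
    qed
    then have N: "pnorm p hybrid \<le> 2 / (t * \<omega>) * (X + c) + 8 * \<pi> * r\<^sub>1 / (t * l)" by (simp only: c_def)
    have "pnorm q \<Delta> \<le> 4 * kq * pnorm p hybrid + 4 * kq * rp + 4 * r\<^sub>1 * real l powr (inv_exp q - 1)"
      unfolding kq using q hybrid_dominates rp rp0 by (intro deviation_norm_le) auto
    also have "4 * kq * pnorm p hybrid \<le> 4 * kq * (2 / (t * \<omega>) * (X + c) + 8 * \<pi> * r\<^sub>1 / (t * l))"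
      using N kq0 by (intro mult_left_mono) auto
    also have "\<dots> = 8 * kq / (t * \<omega>) * (X + c) + 32 * kq / t * \<pi> * (r\<^sub>1 / l)"
      by (simp add: algebra_simps)
    finally have "pnorm q \<Delta> \<le> 8 * kq / (t * \<omega>) * (X + c) + 32 * kq / t * \<pi> * (r\<^sub>1 / l)
        + 4 * kq * rp + 4 * r\<^sub>1 * real l powr (inv_exp q - 1)" by simp
    moreover have "eratio (ereal (8 * kq)) (ereal t * omega p A (k + l)) = ereal (8 * kq / (t * \<omega>))"
      using t \<omega>0 by (simp add: \<omega> eratio_pos)
    ultimately show ?thesis by (simp add: X \<pi> c_def)
  qed
qed

theorem deviation_bound_gam:
  assumes q: "q \<in> {1, p}"
    and thr: "ereal t \<le> 1 - gam p A (k + l) l * ereal (real k powr (1 - inv_exp p) / real l)"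
    and kq: "kq = real k powr (inv_exp q - inv_exp p)"
  shows "ereal (pnorm q \<Delta>) \<le> ereal (8 * kq / t) *
           (ereal 4 * gam p A (k + l) l * ereal (r\<^sub>1 / real l)
            + eratio (ereal (lam * real (k + l) powr inv_exp p)) (mu p A (k + l)))
         + ereal (4 * r\<^sub>1 * real l powr (inv_exp q - 1))"
proof -
  have kq0: "0 < kq" using F by (simp add: kq)
  obtain \<gamma> where \<gamma>: "gam p A (k + l) l = ereal \<gamma>" "0 \<le> \<gamma>" "t \<le> 1 - \<gamma> * (real k powr (1 - inv_exp p) / real l)"
    using threshold_finite[OF thr gam_nonneg[OF dimensions(3) l_pos]] .
  define B where "B = submat_inv I A"
  have inv: "is_submat_inv I A B" unfolding B_def using gam_finite_inverse[of p A "k + l" l I] \<gamma>(1) card_I by simp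
  define w where "w = B *v restr I (A *v \<Delta>)"
  have "\<bar>restr I (A *v \<Delta>) $ i\<bar> \<le> lam" for i using gradient_le[of i] lam by auto
  moreover have "I \<noteq> {}" using F_ne by auto
  ultimately have "pnorm p (restr I (A *v \<Delta>)) \<le> lam * real (card I) powr inv_exp p"
    using p by (intro pnorm_le_of_bounded) auto
  then have "pnorm p (restr I (A *v w)) \<le> lam * real (k + l) powr inv_exp p"
    unfolding w_def submat_inv_cancel(2)[OF inv] card_I .
  then have w_le: "ereal (pnorm p w) \<le> eratio (ereal (lam * real (k + l) powr inv_exp p)) (mu p A (k + l))"
    using p card_I submat_inv_cancel(3)[OF inv] unfolding w_def by (intro mu_bound) auto
  show ?thesis
  proof (cases "eratio (ereal (lam * real (k + l) powr inv_exp p)) (mu p A (k + l))")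
    case (real Y)
    have Y: "pnorm p w \<le> Y" using w_le real by simp
    have N: "pnorm p (restr I \<Delta>) \<le> 2 / t * (4 * \<gamma> * r\<^sub>1 / l + Y)"
    proof (rule gamma_bound[OF _ \<gamma>(2) _ _ \<gamma>(3)])
      show "B *v restr I (A *v w) = w" if "\<And>i. i \<notin> I \<Longrightarrow> w $ i = 0" for w
        using submat_inv_cancel(1)[OF inv that] .
      show "pnorm p (B *v restr I (A *v u)) \<le> \<gamma> * infnorm u"
        if "card J = l" "I \<inter> J = {}" "\<And>i. i \<notin> J \<Longrightarrow> u $ i = 0" for J u
        unfolding B_def using gam_bound[OF \<gamma>(1) card_I that] .
      show "pnorm p (B *v restr I (A *v \<Delta>)) \<le> Y" using Y by (simp only: w_def)
    qed
    have "pnorm p (restr F \<Delta>) \<le> pnorm p (restr I \<Delta>)" using p by (intro pnorm_mono) auto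
    then have "pnorm q \<Delta> \<le> 4 * kq * pnorm p (restr I \<Delta>) + 4 * kq * 0 + 4 * r\<^sub>1 * real l powr (inv_exp q - 1)"
      unfolding kq using q by (intro deviation_norm_le) auto
    also have "4 * kq * pnorm p (restr I \<Delta>) \<le> 4 * kq * (2 / t * (4 * \<gamma> * r\<^sub>1 / l + Y))"
      using N kq0 by (intro mult_left_mono) auto
    also have "\<dots> = 8 * kq / t * (4 * \<gamma> * (r\<^sub>1 / l) + Y)" by simp
    finally have "pnorm q \<Delta> \<le> 8 * kq / t * (4 * \<gamma> * (r\<^sub>1 / l) + Y) + 4 * r\<^sub>1 * real l powr (inv_exp q - 1)" by simp
    then show ?thesis unfolding real \<gamma>(1) by simp
  next
    case PInf
    then show ?thesis unfolding PInf \<gamma>(1) using kq0 t by simp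
  next
    case MInf
    then show ?thesis using w_le by simp
  qed
qed

end

section \<open>The lasso estimator\<close>

lemma emp_mat_mult: "emp_mat n x *v v = (1 / real n) *\<^sub>R (\<Sum>i = 1..n. (x i \<bullet> v) *\<^sub>R x i)"
proof -
  have "(\<Sum>k\<in>UNIV. 1 / real n * (\<Sum>i = 1..n. x i $ j * x i $ k) * v $ k) = 1 / real n * (\<Sum>i = 1..n. (x i \<bullet> v) * x i $ j)" for j
  proof -
    have "(\<Sum>k\<in>UNIV. 1 / real n * (\<Sum>i = 1..n. x i $ j * x i $ k) * v $ k)
        = 1 / real n * (\<Sum>k\<in>UNIV. \<Sum>i = 1..n. x i $ j * x i $ k * v $ k)"
      by (simp add: sum_distrib_left sum_distrib_right mult.assoc)
    also have "(\<Sum>k\<in>UNIV. \<Sum>i = 1..n. x i $ j * x i $ k * v $ k) = (\<Sum>i = 1..n. \<Sum>k\<in>UNIV. x i $ j * x i $ k * v $ k)"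
      by (rule sum.swap)
    also have "\<dots> = (\<Sum>i = 1..n. (x i \<bullet> v) * x i $ j)"
      by (simp add: inner_vec_def sum_distrib_left sum_distrib_right mult_ac)
    finally show ?thesis .
  qed
  then show ?thesis by (simp add: vec_eq_iff emp_mat_def matrix_vector_mult_def)
qed

lemma inner_emp_mat: "u \<bullet> (emp_mat n x *v v) = 1 / real n * (\<Sum>i = 1..n. (u \<bullet> x i) * (v \<bullet> x i))"
  by (simp add: emp_mat_mult inner_sum_right inner_commute mult_ac)

lemma emp_mat_sym: "u \<bullet> (emp_mat n x *v v) = v \<bullet> (emp_mat n x *v u)"
  by (simp add: inner_emp_mat mult.commute)

lemma emp_mat_psd: "0 \<le> v \<bullet> (emp_mat n x *v v)"
  by (simp add: inner_emp_mat sum_nonneg)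

lemma emp_mat_diag: "emp_mat n x $ j $ j = 1 / real n * (\<Sum>i = 1..n. (x i $ j)\<^sup>2)"
  by (simp add: emp_mat_def power2_eq_square)

text \<open>Half the gradient of the squared loss at \<open>\<beta>\<close>.\<close>

definition resid :: "nat \<Rightarrow> (nat \<Rightarrow> real ^ 'd) \<Rightarrow> (nat \<Rightarrow> real) \<Rightarrow> real ^ 'd \<Rightarrow> real ^ 'd" where
  "resid n x y \<beta> = (1 / real n) *\<^sub>R (\<Sum>i = 1..n. (\<beta> \<bullet> x i - y i) *\<^sub>R x i)"

lemma lasso_obj_expand:
  "lasso_obj n x y lam (b + u) = lasso_obj n x y lam b + 2 * (u \<bullet> (emp_mat n x *v (b - \<beta>) + resid n x y \<beta>))
    + u \<bullet> (emp_mat n x *v u) + lam * (pnorm 1 (b + u) - pnorm 1 b)"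
proof -
  have "(\<Sum>i = 1..n. ((b + u) \<bullet> x i - y i)\<^sup>2) = (\<Sum>i = 1..n. (b \<bullet> x i - y i)\<^sup>2)
      + 2 * ((\<Sum>i = 1..n. (u \<bullet> x i) * ((b - \<beta>) \<bullet> x i)) + (\<Sum>i = 1..n. (\<beta> \<bullet> x i - y i) * (u \<bullet> x i)))
      + (\<Sum>i = 1..n. (u \<bullet> x i) * (u \<bullet> x i))"
    unfolding sum_distrib_left sum.distrib[symmetric]
    by (intro sum.cong refl) (simp add: inner_add_left inner_diff_left power2_eq_square algebra_simps)
  moreover have "u \<bullet> resid n x y \<beta> = 1 / real n * (\<Sum>i = 1..n. (\<beta> \<bullet> x i - y i) * (u \<bullet> x i))"
    by (simp add: resid_def inner_sum_right)
  ultimately show ?thesis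
    by (simp only: lasso_obj_def inner_add_right inner_emp_mat) (simp add: distrib_left right_diff_distrib)
qed

text \<open>Convexity of the absolute value bounds the increment for a short step \<open>\<tau> s\<close> by \<open>\<tau>\<close> times the
  increment for \<open>s\<close>, while the quadratic term is of order \<open>\<tau>\<^sup>2\<close>. So the minimum condition holds
  without the quadratic term, and it is used for \<open>s = \<plusminus>1\<close> and \<open>s = \<plusminus>b\<close>.\<close>

lemma coordinate_optimality:
  fixes g a b lam :: real
  assumes min: "\<And>h. 0 \<le> h * g + h\<^sup>2 * a + lam * (\<bar>b + h\<bar> - \<bar>b\<bar>)" and "0 \<le> lam" "0 \<le> a"
  shows "\<bar>g\<bar> \<le> lam" "g * b = - lam * \<bar>b\<bar>"
proof -
  have key: "- lam * (\<bar>b + s\<bar> - \<bar>b\<bar>) \<le> s * g" for s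
  proof (rule field_le_epsilon)
    fix \<epsilon> :: real assume \<epsilon>: "0 < \<epsilon>"
    define \<tau> where "\<tau> = min 1 (\<epsilon> / (s\<^sup>2 * a + 1))"
    have pos: "0 < s\<^sup>2 * a + 1" using assms by (simp add: add_nonneg_pos)
    then have \<tau>: "0 < \<tau>" "\<tau> \<le> 1" "\<tau> * (s\<^sup>2 * a) \<le> \<epsilon>"
    proof -
      have "\<tau> * (s\<^sup>2 * a) \<le> \<epsilon> / (s\<^sup>2 * a + 1) * (s\<^sup>2 * a + 1)"
        using pos assms \<epsilon> by (intro mult_mono) (auto simp: \<tau>_def)
      then show "\<tau> * (s\<^sup>2 * a) \<le> \<epsilon>" using pos by simp
    qed (use pos \<epsilon> in \<open>auto simp: \<tau>_def\<close>)
    have conv: "\<bar>b + \<tau> * s\<bar> - \<bar>b\<bar> \<le> \<tau> * (\<bar>b + s\<bar> - \<bar>b\<bar>)"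
    proof -
      have "b + \<tau> * s = (1 - \<tau>) * b + \<tau> * (b + s)" by (simp add: algebra_simps)
      then have "\<bar>b + \<tau> * s\<bar> \<le> (1 - \<tau>) * \<bar>b\<bar> + \<tau> * \<bar>b + s\<bar>"
        using \<tau> abs_triangle_ineq[of "(1 - \<tau>) * b" "\<tau> * (b + s)"] by (simp add: abs_mult)
      then show ?thesis by (simp add: algebra_simps)
    qed
    have "0 \<le> (\<tau> * s) * g + (\<tau> * s)\<^sup>2 * a + lam * (\<bar>b + \<tau> * s\<bar> - \<bar>b\<bar>)" by (rule min)
    also have "\<dots> \<le> (\<tau> * s) * g + (\<tau> * s)\<^sup>2 * a + lam * (\<tau> * (\<bar>b + s\<bar> - \<bar>b\<bar>))"
      using conv assms by (intro add_left_mono mult_left_mono) auto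
    also have "\<dots> = \<tau> * (s * g + \<tau> * (s\<^sup>2 * a) + lam * (\<bar>b + s\<bar> - \<bar>b\<bar>))"
      by (simp add: power_mult_distrib algebra_simps power2_eq_square)
    finally have "0 \<le> s * g + \<tau> * (s\<^sup>2 * a) + lam * (\<bar>b + s\<bar> - \<bar>b\<bar>)"
      using \<tau> by (simp add: zero_le_mult_iff)
    then show "- lam * (\<bar>b + s\<bar> - \<bar>b\<bar>) \<le> s * g + \<epsilon>" using \<tau> by simp
  qed
  have "lam * (\<bar>b + s\<bar> - \<bar>b\<bar>) \<le> lam" if "s = 1 \<or> s = -1" for s
    using that assms by (intro mult_left_le) auto
  from this[of 1] this[of "-1"] key[of 1] key[of "-1"] show "\<bar>g\<bar> \<le> lam" by (simp add: abs_le_iff)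
  have "\<bar>b + b\<bar> - \<bar>b\<bar> = \<bar>b\<bar>" by simp
  then have "- lam * \<bar>b\<bar> \<le> b * g" using key[of b] by metis
  moreover have "lam * \<bar>b\<bar> \<le> - b * g" using key[of "- b"] by simp
  ultimately show "g * b = - lam * \<bar>b\<bar>" by (simp add: mult.commute)
qed

lemma lasso_kkt:
  fixes x :: "nat \<Rightarrow> real ^ 'd" and \<beta> :: "real ^ 'd"
  assumes "is_arg_min (lasso_obj n x y lam) (\<lambda>_. True) b" "0 \<le> lam"
  defines "g \<equiv> emp_mat n x *v (b - \<beta>) + resid n x y \<beta>"
  shows "\<bar>2 * g $ j\<bar> \<le> lam" "2 * g $ j * b $ j = - lam * \<bar>b $ j\<bar>"
proof -
  define a where "a = axis j 1 \<bullet> (emp_mat n x *v axis j 1)"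
  have "0 \<le> h * (2 * g $ j) + h\<^sup>2 * a + lam * (\<bar>b $ j + h\<bar> - \<bar>b $ j\<bar>)" for h
  proof -
    define u :: "real ^ 'd" where "u = h *\<^sub>R axis j 1"
    have "lasso_obj n x y lam b \<le> lasso_obj n x y lam (b + u)"
      using assms(1) by (simp add: is_arg_min_linorder)
    then have "0 \<le> 2 * (u \<bullet> g) + u \<bullet> (emp_mat n x *v u) + lam * (pnorm 1 (b + u) - pnorm 1 b)"
      unfolding lasso_obj_expand[of n x y lam b u \<beta>] g_def by linarith
    moreover have "u \<bullet> g = h * g $ j" by (simp add: u_def inner_axis')
    moreover have "u \<bullet> (emp_mat n x *v u) = h\<^sup>2 * a"
      by (simp add: u_def a_def matrix_vector_mult_scaleR power2_eq_square)
    moreover have "pnorm 1 (b + u) - pnorm 1 b = \<bar>b $ j + h\<bar> - \<bar>b $ j\<bar>"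
    proof -
      have "pnorm 1 (b + u) - pnorm 1 b = (\<Sum>i\<in>UNIV. \<bar>(b + u) $ i\<bar> - \<bar>b $ i\<bar>)"
        by (simp add: pnorm_1 sum_subtractf)
      also have "\<dots> = (\<Sum>i\<in>UNIV. if i = j then \<bar>b $ j + h\<bar> - \<bar>b $ j\<bar> else 0)"
        by (intro sum.cong) (auto simp: u_def axis_def)
      finally show ?thesis by simp
    qed
    ultimately show ?thesis by simp
  qed
  from coordinate_optimality[OF this \<open>0 \<le> lam\<close>] show "\<bar>2 * g $ j\<bar> \<le> lam" "2 * g $ j * b $ j = - lam * \<bar>b $ j\<bar>"
    using emp_mat_psd[of "axis j 1" n x] by (auto simp: a_def)
qed

text \<open>A target with vanishing gradient is a least squares solution, and for \<open>lam = 0\<close> that solution is unique.\<close>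

lemma noiseless_solution:
  assumes "lasso_solution n x y 0 b" "resid n x y \<beta> = 0"
  shows "b = \<beta>"
proof -
  have "lasso_obj n x y 0 \<beta> \<le> lasso_obj n x y 0 \<beta>'" for \<beta>'
    using lasso_obj_expand[of n x y 0 \<beta> "\<beta>' - \<beta>" \<beta>] emp_mat_psd[of "\<beta>' - \<beta>" n x] assms(2) by simp
  then have "is_arg_min (lasso_obj n x y 0) (\<lambda>_. True) \<beta>" by (simp add: is_arg_min_linorder)
  then show ?thesis using assms(1) by (auto simp: lasso_solution_def)
qed

lemma lasso_partition:
  fixes x :: "nat \<Rightarrow> real ^ 'd"
  assumes sol: "lasso_solution n x y lam b" and lam: "0 < lam" "4 * (2 - t) / t * \<epsilon> \<le> lam"
    and noise: "\<And>j. \<bar>resid n x y \<beta> $ j\<bar> \<le> \<epsilon>"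
    and t: "0 < t" "t < 1" and kl: "1 \<le> k" "k \<le> l" "k + 2 * l \<le> CARD('d)" and p: "1 \<le> p" and F: "card F = k"
  obtains J where "partitioned_stationary_point (emp_mat n x) b \<beta> (resid n x y \<beta>) lam \<epsilon> t F J k l p"
proof -
  have "l \<le> card (- F)" using kl F by (simp add: Compl_eq_Diff_UNIV card_Diff_subset)
  then obtain J where J: "J \<subseteq> - F" "card J = l" "\<And>i j. i \<in> J \<Longrightarrow> j \<in> - F - J \<Longrightarrow> \<bar>(b - \<beta>) $ j\<bar> \<le> \<bar>(b - \<beta>) $ i\<bar>"
    using top_subset[of "- F" l "\<lambda>i. \<bar>(b - \<beta>) $ i\<bar>"] by auto
  have min: "is_arg_min (lasso_obj n x y lam) (\<lambda>_. True) b" using sol by (simp add: lasso_solution_def)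
  have "partitioned_stationary_point (emp_mat n x) b \<beta> (resid n x y \<beta>) lam \<epsilon> t F J k l p"
  proof unfold_locales
    show "u \<bullet> (emp_mat n x *v v) = v \<bullet> (emp_mat n x *v u)" for u v by (rule emp_mat_sym)
    show "0 \<le> v \<bullet> (emp_mat n x *v v)" for v by (rule emp_mat_psd)
  qed (use lasso_kkt[OF min, of \<beta>] lam noise t kl p F J in auto)
  then show thesis by (rule that)
qed

text \<open>For \<open>lam = 0\<close> the cone condition is void, but then the noise bound forces \<open>resid n x y \<beta> = 0\<close> and
  hence \<open>b = \<beta>\<close>; it remains to see that the right-hand sides, as extended reals, are nonnegative.\<close>

theorem lasso_deviation_bound:
  fixes x :: "nat \<Rightarrow> real ^ 'd"
  assumes sol: "lasso_solution n x y lam b" and lam: "0 \<le> lam" "4 * (2 - t) / t * \<epsilon> \<le> lam"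
    and noise: "\<And>j. \<bar>resid n x y \<beta> $ j\<bar> \<le> \<epsilon>"
    and t: "0 < t" "t < 1" and kl: "1 \<le> k" "k \<le> l" "real l \<le> (real CARD('d) - real k) / 2" and p: "1 \<le> p" and q: "q \<in> {1, p}"
  defines "A \<equiv> emp_mat n x" and "kq \<equiv> real k powr (inv_exp q - inv_exp p)"
  shows "ereal t \<le> 1 - ppi p A (k + l) l * ereal (real k powr (1 - inv_exp p) / real l) \<Longrightarrow>
       ereal (pnorm q (b - \<beta>)) \<le>
         eratio (ereal (8 * kq)) (ereal t * omega p A (k + l)) *
           (rho p A (k + l) * ereal (tail_norm p k \<beta>) + ereal (real k powr inv_exp p * lam))
         + ereal (32 * kq / t) * ppi p A (k + l) l * ereal (tail_norm 1 k \<beta> / real l)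
         + ereal (4 * kq * tail_norm p k \<beta>)
         + ereal (4 * tail_norm 1 k \<beta> * real l powr (inv_exp q - 1))" (is "_ \<Longrightarrow> ?pi")
    and "ereal t \<le> 1 - gam p A (k + l) l * ereal (real k powr (1 - inv_exp p) / real l) \<Longrightarrow>
       ereal (pnorm q (b - \<beta>)) \<le>
         ereal (8 * kq / t) *
           (ereal 4 * gam p A (k + l) l * ereal (tail_norm 1 k \<beta> / real l)
            + eratio (ereal (lam * real (k + l) powr inv_exp p)) (mu p A (k + l)))
         + ereal (4 * tail_norm 1 k \<beta> * real l powr (inv_exp q - 1))" (is "_ \<Longrightarrow> ?gam")
proof -
  have "real (k + 2 * l) \<le> real CARD('d)" using kl(3) by (simp add: field_simps)
  then have room: "k + 2 * l \<le> CARD('d)" by (simp only: of_nat_le_iff)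
  then have "k \<le> CARD('d)" by simp
  then obtain F :: "'d set" where F: "card F = k" "\<And>p. 1 \<le> p \<Longrightarrow> tail_norm p k \<beta> = pnorm p (restr (-F) \<beta>)"
    using tail_norm_eq_pnorm by metis
  have tails: "tail_norm p k \<beta> = pnorm p (restr (-F) \<beta>)" "tail_norm 1 k \<beta> = pnorm 1 (restr (-F) \<beta>)"
    using F(2) p by simp_all
  have kq: "kq = real k powr (inv_exp q - inv_exp p)" by (simp add: kq_def)
  have *: ?pi if "b = \<beta>"
  proof -
    have "0 \<le> ppi p A (k + l) l" "0 \<le> rho p A (k + l)" "0 \<le> omega p A (k + l)"
      unfolding A_def using kl room p by (auto intro!: ppi_nonneg rho_nonneg omega_nonneg emp_mat_sym)
    then have "0 \<le> eratio (ereal (8 * kq)) (ereal t * omega p A (k + l)) *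
           (rho p A (k + l) * ereal (tail_norm p k \<beta>) + ereal (real k powr inv_exp p * lam))"
       "0 \<le> ereal (32 * kq / t) * ppi p A (k + l) l * ereal (tail_norm 1 k \<beta> / real l)"
       "0 \<le> ereal (4 * kq * tail_norm p k \<beta>)" "0 \<le> ereal (4 * tail_norm 1 k \<beta> * real l powr (inv_exp q - 1))"
      using t lam by (auto intro!: ereal_0_le_mult add_nonneg_nonneg eratio_nonneg simp: kq_def tails pnorm_nonneg)
    then show ?pi using that by (simp add: add_nonneg_nonneg flip: zero_ereal_def)
  qed
  have **: ?gam if "b = \<beta>"
  proof -
    have "0 \<le> gam p A (k + l) l" "0 \<le> mu p A (k + l)"
      using kl room by (auto intro!: gam_nonneg mu_nonneg)
    then have "0 \<le> ereal (8 * kq / t) *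
           (ereal 4 * gam p A (k + l) l * ereal (tail_norm 1 k \<beta> / real l)
            + eratio (ereal (lam * real (k + l) powr inv_exp p)) (mu p A (k + l)))"
      "0 \<le> ereal (4 * tail_norm 1 k \<beta> * real l powr (inv_exp q - 1))"
      using t lam by (auto intro!: ereal_0_le_mult add_nonneg_nonneg eratio_nonneg simp: kq_def tails pnorm_nonneg)
    then show ?gam using that by (simp add: add_nonneg_nonneg flip: zero_ereal_def)
  qed
  have lam0: "b = \<beta>" if "lam = 0"
  proof -
    have "4 * (2 - t) / t * \<epsilon> \<le> 0" "0 < 4 * (2 - t) / t" using lam(2) that t by auto
    then have "\<epsilon> \<le> 0" by (simp only: mult_le_0_iff) auto
    then have "resid n x y \<beta> $ j = 0" for j using noise[of j] by linarith
    then have "resid n x y \<beta> = 0" by (simp add: vec_eq_iff)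
    then show ?thesis using sol that noiseless_solution by blast
  qed
  show ?pi if "ereal t \<le> 1 - ppi p A (k + l) l * ereal (real k powr (1 - inv_exp p) / real l)"
  proof (cases "lam = 0")
    case False
    then obtain J where "partitioned_stationary_point A b \<beta> (resid n x y \<beta>) lam \<epsilon> t F J k l p"
      unfolding A_def using lasso_partition[OF sol _ lam(2) noise t kl(1,2) room p F(1)] lam(1) by force
    then interpret partitioned_stationary_point A b \<beta> "resid n x y \<beta>" lam \<epsilon> t F J k l p .
    show ?thesis using deviation_bound_pi[OF q refl that kq] unfolding tails .
  qed (use * lam0 in blast)
  show ?gam if "ereal t \<le> 1 - gam p A (k + l) l * ereal (real k powr (1 - inv_exp p) / real l)"
  proof (cases "lam = 0")
    case False
    then obtain J where "partitioned_stationary_point A b \<beta> (resid n x y \<beta>) lam \<epsilon> t F J k l p"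
      unfolding A_def using lasso_partition[OF sol _ lam(2) noise t kl(1,2) room p F(1)] lam(1) by force
    then interpret partitioned_stationary_point A b \<beta> "resid n x y \<beta>" lam \<epsilon> t F J k l p .
    show ?thesis using deviation_bound_gam[OF q that kq] unfolding tails .
  qed (use ** lam0 in blast)
qed


section \<open>Conditionally independent responses\<close>

locale prob_subalgebra = prob_space M + finite_measure_subalgebra M F
  for M :: "'w measure" and F :: "'w measure"
begin

lemma space_F [simp]: "space F = space M"
  using subalg by (simp add: subalgebra_def)

lemma F_measurable [measurable_dest]: "f \<in> borel_measurable F \<Longrightarrow> f \<in> borel_measurable M"
  by (rule measurable_from_subalg[OF subalg])

lemma F_sets [measurable_dest]: "A \<in> sets F \<Longrightarrow> A \<in> sets M"
  using subalg by (auto simp: subalgebra_def)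

lemma graph_measurable:
  assumes "Y \<in> borel_measurable M"
  shows "(\<lambda>w. (w, Y w)) \<in> measurable M (F \<Otimes>\<^sub>M borel)"
proof -
  have "(\<lambda>w. w) \<in> measurable M F" using F_sets by (auto simp: measurable_def sets.Int_space_eq2)
  then show ?thesis using assms by simp
qed

text \<open>Both sides are integrals of \<open>f\<close> with respect to images of weighted measures under \<open>w \<mapsto> (w, Y w)\<close>, and
  two finite measures that agree on rectangles are equal. This extends identities from events about \<open>Y\<close> to
  functions that also depend on the conditioning information.\<close>

lemma nn_integral_graph_eqI:
  fixes Y :: "'w \<Rightarrow> real" and g h :: "'w \<Rightarrow> ennreal"
  assumes Y [measurable]: "Y \<in> borel_measurable M"
    and [measurable]: "g \<in> borel_measurable M" "h \<in> borel_measurable M"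
    and fin: "(\<integral>\<^sup>+ w. g w \<partial>M) \<noteq> \<infinity>"
    and eq: "\<And>A B. A \<in> sets F \<Longrightarrow> B \<in> sets borel \<Longrightarrow>
      (\<integral>\<^sup>+ w. g w * (indicator A w * indicator B (Y w)) \<partial>M) =
      (\<integral>\<^sup>+ w. h w * (indicator A w * indicator B (Y w)) \<partial>M)"
    and f [measurable]: "f \<in> borel_measurable (F \<Otimes>\<^sub>M borel)"
  shows "(\<integral>\<^sup>+ w. g w * f (w, Y w) \<partial>M) = (\<integral>\<^sup>+ w. h w * f (w, Y w) \<partial>M)"
proof -
  note gr [measurable] = graph_measurable[OF Y]
  define N where "N = (\<lambda>g. distr (density M g) (F \<Otimes>\<^sub>M borel) (\<lambda>w. (w, Y w)))"
  have gr': "(\<lambda>w. (w, Y w)) \<in> measurable (density M u) (F \<Otimes>\<^sub>M borel)" for u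
    using gr by simp
  have int: "(\<integral>\<^sup>+ z. f z \<partial>N u) = (\<integral>\<^sup>+ w. u w * f (w, Y w) \<partial>M)"
    if [measurable]: "u \<in> borel_measurable M" "f \<in> borel_measurable (F \<Otimes>\<^sub>M borel)" for u and f :: "_ \<Rightarrow> ennreal"
    unfolding N_def by (subst nn_integral_distr[OF gr']) (auto simp: nn_integral_density)
  have rect: "emeasure (N u) (A \<times> B) = (\<integral>\<^sup>+ w. u w * (indicator A w * indicator B (Y w)) \<partial>M)"
    if [measurable]: "A \<in> sets F" "B \<in> sets borel" "u \<in> borel_measurable M" for A B u
  proof -
    have "emeasure (N u) (A \<times> B) = (\<integral>\<^sup>+ z. indicator (A \<times> B) z \<partial>N u)"
      by (subst nn_integral_indicator) (auto simp: N_def)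
    also have "\<dots> = (\<integral>\<^sup>+ w. u w * (indicator A w * indicator B (Y w)) \<partial>M)"
      by (subst int) (auto simp: indicator_times)
    finally show ?thesis .
  qed
  have "N g = N h"
  proof (rule measure_eqI_generator_eq[OF Int_stable_pair_measure_generator[of F borel]])
    show "{a \<times> b | a b. a \<in> sets F \<and> b \<in> sets (borel :: real measure)} \<subseteq> Pow (space F \<times> space (borel :: real measure))"
      using sets.space_closed[of F] by auto
    fix X assume "X \<in> {a \<times> b | a b. a \<in> sets F \<and> b \<in> sets (borel :: real measure)}"
    then show "emeasure (N g) X = emeasure (N h) X" using eq by (auto simp: rect)
  next
    show "sets (N g) = sigma_sets (space F \<times> space borel) {a \<times> b | a b. a \<in> sets F \<and> b \<in> sets (borel :: real measure)}"
      "sets (N h) = sigma_sets (space F \<times> space borel) {a \<times> b | a b. a \<in> sets F \<and> b \<in> sets (borel :: real measure)}"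
      by (auto simp: N_def sets_pair_measure)
  next
    show "range (\<lambda>i::nat. space F \<times> UNIV) \<subseteq> {a \<times> b | a b. a \<in> sets F \<and> b \<in> sets (borel :: real measure)}"
      by (auto intro!: exI[of _ "space F"] simp del: space_F)
    show "(\<Union>i::nat. space F \<times> UNIV) = space F \<times> space (borel :: real measure)" by simp
    fix i :: nat
    have "emeasure (N g) (space F \<times> UNIV) = (\<integral>\<^sup>+ w. g w \<partial>M)"
      using rect[of "space F" UNIV g] sets.top[of F] by (simp cong: nn_integral_cong)
    then show "emeasure (N g) (space F \<times> UNIV) \<noteq> \<infinity>" using fin by simp
  qed
  then show ?thesis using int[of g f] int[of h f] by simp
qed

lemma nn_cond_exp_le_1:
  assumes [measurable]: "D \<in> sets M"
  shows "AE w in M. nn_cond_exp M F (indicator D) w \<le> 1"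
proof -
  have "AE w in M. nn_cond_exp M F (indicator D) w \<le> nn_cond_exp M F (\<lambda>_. 1) w"
    by (rule nn_cond_exp_mono) (auto simp: indicator_def)
  moreover have "AE w in M. 1 = nn_cond_exp M F (\<lambda>_. 1) w" by (rule nn_cond_exp_F_meas) simp
  ultimately show ?thesis by auto
qed

lemma real_cond_exp_indicator:
  assumes [measurable]: "D \<in> sets M"
  shows "AE w in M. nn_cond_exp M F (indicator D) w = ennreal (real_cond_exp M F (indicator D) w)
    \<and> 0 \<le> real_cond_exp M F (indicator D) w"
proof -
  have 0: "AE w in M. 0 = nn_cond_exp M F (\<lambda>_. 0) w" by (rule nn_cond_exp_F_meas) simp
  have eq: "(\<lambda>x. ennreal (indicator D x)) = indicator D" "(\<lambda>x. ennreal (- indicator D x)) = (\<lambda>_. 0)"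
    by (auto simp: ennreal_indicator indicator_def ennreal_neg)
  show ?thesis using 0 nn_cond_exp_le_1[OF assms]
  proof eventually_elim
    case (elim w)
    then have "nn_cond_exp M F (indicator D) w \<noteq> top" by (auto simp: top_unique)
    then show ?case using elim by (simp add: real_cond_exp_def eq less_top)
  qed
qed

text \<open>Otherwise the set where \<open>e > 1\<close> would violate the assumption.\<close>

lemma AE_le_1_of_set_integrals:
  assumes e [measurable]: "e \<in> borel_measurable F"
    and le: "\<And>A. A \<in> sets F \<Longrightarrow> (\<integral>\<^sup>+ w. indicator A w * e w \<partial>M) \<le> emeasure M A"
  shows "AE w in M. e w \<le> (1 :: ennreal)"
proof -
  define A where "A = {w \<in> space F. 1 < e w}"
  have A [measurable]: "A \<in> sets F" unfolding A_def by measurable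
  have "AE w in M. indicator A w * e w \<le> (indicator A w :: ennreal)"
  proof (rule ccontr)
    assume *: "\<not> (AE w in M. indicator A w * e w \<le> (indicator A w :: ennreal))"
    have fin: "(\<integral>\<^sup>+ w. indicator A w \<partial>M) \<noteq> \<infinity>" by simp
    have "(\<integral>\<^sup>+ w. indicator A w \<partial>M) < (\<integral>\<^sup>+ w. indicator A w * e w \<partial>M)"
      by (rule nn_integral_less[OF _ _ fin _ *]) (measurable, auto simp: A_def indicator_def)
    with le[OF A] show False by simp
  qed
  then show ?thesis
  proof (rule AE_mp)
    show "AE w in M. indicator A w * e w \<le> (indicator A w :: ennreal) \<longrightarrow> e w \<le> 1"
      by (rule AE_I2) (auto simp: A_def indicator_def not_less split: if_splits)
  qed
qed

end

locale cond_indep_sample = prob_subalgebra M F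
  for M :: "'w measure" and F :: "'w measure" +
  fixes Y :: "'i \<Rightarrow> 'w \<Rightarrow> real" and S :: "'i set"
  assumes S: "finite S" and indep: "cond_indep_vars M F Y S"
begin

lemma Y_measurable: "i \<in> S \<Longrightarrow> Y i \<in> borel_measurable M"
  using indep by (simp add: cond_indep_vars_def)

definition cyl :: "'i set \<Rightarrow> ('i \<Rightarrow> real set) \<Rightarrow> 'w set" where
  "cyl J B = {w \<in> space M. \<forall>j\<in>J. Y j w \<in> B j}"

lemma cyl_measurable:
  assumes "J \<subseteq> S" "\<And>j. j \<in> J \<Longrightarrow> B j \<in> sets borel"
  shows "cyl J B \<in> sets M"
proof -
  have "finite J" using assms(1) S by (rule finite_subset)
  moreover have "{w \<in> space M. Y j w \<in> B j} \<in> sets M" if "j \<in> J" for j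
    using measurable_sets[OF Y_measurable, of j "B j"] assms that by (auto simp: vimage_def Int_def conj_commute)
  ultimately show ?thesis unfolding cyl_def by (intro sets.sets_Collect_finite_All) auto
qed

lemma cyl_insert:
  "m \<notin> J \<Longrightarrow> w \<in> space M \<Longrightarrow> indicator (cyl (insert m J) (B(m := C))) w = (indicator (cyl J B) w * indicator C (Y m w) :: ennreal)"
  by (auto simp: cyl_def indicator_def)

lemma cyl_cond_exp_mult:
  assumes "insert m J \<subseteq> S" "m \<notin> J" "\<And>j. j \<in> J \<Longrightarrow> B j \<in> sets borel" "C \<in> sets borel"
  shows "AE w in M. nn_cond_exp M F (indicator (cyl (insert m J) (B(m := C)))) w =
    nn_cond_exp M F (indicator (cyl J B)) w * nn_cond_exp M F (indicator (cyl {m} (\<lambda>_. C))) w"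
proof -
  have fin: "finite J" by (rule finite_subset[OF _ S]) (use assms(1) in auto)
  define r where "r = (\<lambda>J B. real_cond_exp M F (indicator (cyl J B)))"
  have prod: "AE w in M. r J B w = (\<Prod>j\<in>J. r {j} (\<lambda>_. B j) w)"
    if "J \<subseteq> S" "\<And>j. j \<in> J \<Longrightarrow> B j \<in> sets borel" for J B
  proof -
    have "finite J" using that(1) S by (rule finite_subset)
    then show ?thesis using indep that by (simp add: cond_indep_vars_def r_def cyl_def)
  qed
  have 1: "AE w in M. r (insert m J) (B(m := C)) w = (\<Prod>j\<in>insert m J. r {j} (\<lambda>_. (B(m := C)) j) w)"
    using assms by (intro prod) auto
  have 2: "AE w in M. r J B w = (\<Prod>j\<in>J. r {j} (\<lambda>_. B j) w)"
    using assms by (intro prod) auto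
  have "cyl (insert m J) (B(m := C)) \<in> sets M" "cyl J B \<in> sets M" "cyl {m} (\<lambda>_. C) \<in> sets M"
    using assms by (auto intro!: cyl_measurable)
  from 1 2 this[THEN real_cond_exp_indicator] show ?thesis
  proof eventually_elim
    case (elim w)
    have "(\<Prod>j\<in>insert m J. r {j} (\<lambda>_. (B(m := C)) j) w) = r {m} (\<lambda>_. C) w * (\<Prod>j\<in>J. r {j} (\<lambda>_. B j) w)"
      using fin assms(2) by (subst prod.insert) (auto intro!: prod.cong)
    then have "r (insert m J) (B(m := C)) w = r J B w * r {m} (\<lambda>_. C) w" using elim by simp
    then show ?case using elim by (simp add: r_def ennreal_mult)
  qed
qed

text \<open>The case of one general factor, for indicator functions of the other responses. Replacing the
  indicator of the cylinder by its conditional expectation makes everything but \<open>f\<close> a function of the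
  conditioning information; then \<open>f\<close> can be replaced by its conditional expectation, and the first
  replacement is undone.\<close>

lemma cylinder_swap:
  assumes mJ: "insert m J \<subseteq> S" "m \<notin> J" and B: "\<And>j. j \<in> J \<Longrightarrow> B j \<in> sets borel"
    and f [measurable]: "f \<in> borel_measurable (F \<Otimes>\<^sub>M borel)" and h [measurable]: "h \<in> borel_measurable F"
  shows "(\<integral>\<^sup>+ w. indicator (cyl J B) w * (h w * f (w, Y m w)) \<partial>M) =
    (\<integral>\<^sup>+ w. indicator (cyl J B) w * (h w * nn_cond_exp M F (\<lambda>w. f (w, Y m w)) w) \<partial>M)"
proof -
  let ?D = "indicator (cyl J B) :: 'w \<Rightarrow> ennreal"
  have Ym [measurable]: "Y m \<in> borel_measurable M" using mJ Y_measurable by auto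
  have cyl [measurable]: "cyl J B \<in> sets M" using mJ B by (intro cyl_measurable) auto
  note gr [measurable] = graph_measurable[OF Ym]
  have [measurable]: "(\<lambda>w. f (w, Y m w)) \<in> borel_measurable M" by (rule measurable_compose[OF gr f])
  have hf [measurable]: "(\<lambda>z. h (fst z) * f z) \<in> borel_measurable (F \<Otimes>\<^sub>M borel)" by measurable
  have "(\<integral>\<^sup>+ w. ?D w * (h (fst (w, Y m w)) * f (w, Y m w)) \<partial>M) =
      (\<integral>\<^sup>+ w. nn_cond_exp M F ?D w * (h (fst (w, Y m w)) * f (w, Y m w)) \<partial>M)"
  proof (rule nn_integral_graph_eqI[OF Ym _ _ _ _ hf])
    show "(\<integral>\<^sup>+ w. ?D w \<partial>M) \<noteq> \<infinity>" by simp
    fix A C assume [measurable]: "A \<in> sets F" and C [measurable]: "C \<in> sets (borel :: real measure)"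
    have cm [measurable]: "cyl {m} (\<lambda>_. C) \<in> sets M" "cyl (insert m J) (B(m := C)) \<in> sets M"
      using mJ B by (auto intro!: cyl_measurable)
    have "(\<integral>\<^sup>+ w. ?D w * (indicator A w * indicator C (Y m w)) \<partial>M) =
        (\<integral>\<^sup>+ w. indicator A w * indicator (cyl (insert m J) (B(m := C))) w \<partial>M)"
      by (intro nn_integral_cong) (simp add: cyl_insert[OF mJ(2)] mult_ac)
    also have "\<dots> = (\<integral>\<^sup>+ w. indicator A w * nn_cond_exp M F (indicator (cyl (insert m J) (B(m := C)))) w \<partial>M)"
      by (subst nn_cond_exp_intg) auto
    also have "\<dots> = (\<integral>\<^sup>+ w. (indicator A w * nn_cond_exp M F ?D w) * nn_cond_exp M F (indicator (cyl {m} (\<lambda>_. C))) w \<partial>M)"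
    proof (rule nn_integral_cong_AE)
      have "AE w in M. nn_cond_exp M F (indicator (cyl (insert m J) (B(m := C)))) w =
          nn_cond_exp M F ?D w * nn_cond_exp M F (indicator (cyl {m} (\<lambda>_. C))) w"
        using mJ B C by (rule cyl_cond_exp_mult)
      then show "AE w in M. indicator A w * nn_cond_exp M F (indicator (cyl (insert m J) (B(m := C)))) w =
          (indicator A w * nn_cond_exp M F ?D w) * nn_cond_exp M F (indicator (cyl {m} (\<lambda>_. C))) w"
        by eventually_elim (simp add: mult.assoc)
    qed
    also have "\<dots> = (\<integral>\<^sup>+ w. (indicator A w * nn_cond_exp M F ?D w) * indicator (cyl {m} (\<lambda>_. C)) w \<partial>M)"
      by (rule nn_cond_exp_intg) auto
    also have "\<dots> = (\<integral>\<^sup>+ w. nn_cond_exp M F ?D w * (indicator A w * indicator C (Y m w)) \<partial>M)"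
      by (intro nn_integral_cong) (auto simp: cyl_def indicator_def)
    finally show "(\<integral>\<^sup>+ w. ?D w * (indicator A w * indicator C (Y m w)) \<partial>M) =
      (\<integral>\<^sup>+ w. nn_cond_exp M F ?D w * (indicator A w * indicator C (Y m w)) \<partial>M)" .
  qed auto
  also have "\<dots> = (\<integral>\<^sup>+ w. (nn_cond_exp M F ?D w * h w) * f (w, Y m w) \<partial>M)"
    by (simp add: mult.assoc)
  also have "\<dots> = (\<integral>\<^sup>+ w. (nn_cond_exp M F ?D w * h w) * nn_cond_exp M F (\<lambda>w. f (w, Y m w)) w \<partial>M)"
    by (rule nn_cond_exp_intg[symmetric]) auto
  also have "\<dots> = (\<integral>\<^sup>+ w. (h w * nn_cond_exp M F (\<lambda>w. f (w, Y m w)) w) * nn_cond_exp M F ?D w \<partial>M)"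
    by (simp add: mult_ac)
  also have "\<dots> = (\<integral>\<^sup>+ w. (h w * nn_cond_exp M F (\<lambda>w. f (w, Y m w)) w) * ?D w \<partial>M)"
    by (rule nn_cond_exp_intg) auto
  finally show ?thesis by (simp add: mult_ac)
qed

text \<open>Induction on the set \<open>K\<close> of responses that already carry a general function, the responses in \<open>J\<close>
  carrying indicators. In the step, the indicator of the new response runs through all Borel sets, so
  \<open>nn_integral_graph_eqI\<close> upgrades it to a function, and \<open>cylinder_swap\<close> replaces that function by its
  conditional expectation. The upper bound on the factors keeps the weighted measures finite.\<close>

lemma product_swap:
  fixes f :: "'i \<Rightarrow> 'w \<times> real \<Rightarrow> ennreal"
  assumes f: "\<And>i. i \<in> S \<Longrightarrow> f i \<in> borel_measurable (F \<Otimes>\<^sub>M borel)"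
    and bdd: "\<And>i z. f i z \<le> ennreal c"
    and K: "K \<subseteq> S"
  shows "J \<subseteq> S - K \<Longrightarrow> (\<And>j. j \<in> J \<Longrightarrow> B j \<in> sets borel) \<Longrightarrow> A \<in> sets F \<Longrightarrow>
    (\<integral>\<^sup>+ w. (indicator (cyl J B) w * (\<Prod>i\<in>K. f i (w, Y i w))) * indicator A w \<partial>M) =
    (\<integral>\<^sup>+ w. (indicator (cyl J B) w * (\<Prod>i\<in>K. nn_cond_exp M F (\<lambda>w. f i (w, Y i w)) w)) * indicator A w \<partial>M)"
  using finite_subset[OF K S] K
proof (induction K arbitrary: J B A rule: finite_induct)
  case empty
  show ?case by simp
next
  case (insert m K)
  let ?e = "\<lambda>i. nn_cond_exp M F (\<lambda>w. f i (w, Y i w))"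
  have Ym [measurable]: "Y m \<in> borel_measurable M" using insert.prems Y_measurable by auto
  have fm [measurable]: "f m \<in> borel_measurable (F \<Otimes>\<^sub>M borel)" using insert.prems f by auto
  have cyl [measurable]: "cyl J B \<in> sets M" using insert.prems by (intro cyl_measurable) auto
  have fY: "(\<lambda>w. f i (w, Y i w)) \<in> borel_measurable M" if "i \<in> S" for i
    using measurable_compose[OF graph_measurable[OF Y_measurable] f] that by blast
  have [measurable]: "(\<lambda>w. \<Prod>i\<in>K. f i (w, Y i w)) \<in> borel_measurable M"
    using fY insert.prems by (intro borel_measurable_prod_ennreal) auto
  have [measurable]: "(\<lambda>w. \<Prod>i\<in>K. ?e i w) \<in> borel_measurable F"
    by (intro borel_measurable_prod_ennreal) auto
  define g where "g = (\<lambda>w. indicator (cyl J B) w * (\<Prod>i\<in>K. f i (w, Y i w)))"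
  define h where "h = (\<lambda>w. indicator (cyl J B) w * (\<Prod>i\<in>K. ?e i w))"
  have gh [measurable]: "g \<in> borel_measurable M" "h \<in> borel_measurable M" unfolding g_def h_def by measurable
  have [measurable]: "A \<in> sets F" by fact
  have fA: "(\<lambda>z. f m z * indicator A (fst z)) \<in> borel_measurable (F \<Otimes>\<^sub>M borel)" by measurable
  have "g w \<le> ennreal (max c 0) ^ card K" for w
  proof -
    have "(\<Prod>i\<in>K. f i (w, Y i w)) \<le> (\<Prod>i\<in>K. ennreal (max c 0))"
      using bdd by (intro prod_mono_ennreal) (auto intro: order_trans[OF bdd] ennreal_leI)
    then show ?thesis by (auto simp: g_def indicator_def)
  qed
  then have "(\<integral>\<^sup>+ w. g w \<partial>M) \<le> (\<integral>\<^sup>+ w. ennreal (max c 0) ^ card K \<partial>M)" by (intro nn_integral_mono)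
  also have "\<dots> < \<infinity>" by (simp add: emeasure_space_1 power_less_top_ennreal)
  finally have fin: "(\<integral>\<^sup>+ w. g w \<partial>M) \<noteq> \<infinity>" by simp
  have eq: "(\<integral>\<^sup>+ w. g w * (indicator A w * indicator C (Y m w)) \<partial>M) =
      (\<integral>\<^sup>+ w. h w * (indicator A w * indicator C (Y m w)) \<partial>M)"
    if "A \<in> sets F" "C \<in> sets borel" for A C
  proof -
    have mJ: "m \<notin> J" using insert.prems by auto
    have "(\<integral>\<^sup>+ w. g w * (indicator A w * indicator C (Y m w)) \<partial>M) =
      (\<integral>\<^sup>+ w. (indicator (cyl (insert m J) (B(m := C))) w * (\<Prod>i\<in>K. f i (w, Y i w))) * indicator A w \<partial>M)"
      by (intro nn_integral_cong) (simp add: cyl_insert[OF mJ] g_def mult_ac)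
    also have "\<dots> = (\<integral>\<^sup>+ w. (indicator (cyl (insert m J) (B(m := C))) w * (\<Prod>i\<in>K. ?e i w)) * indicator A w \<partial>M)"
      using insert.prems insert.hyps that by (intro insert.IH) auto
    also have "\<dots> = (\<integral>\<^sup>+ w. h w * (indicator A w * indicator C (Y m w)) \<partial>M)"
      by (intro nn_integral_cong) (simp add: cyl_insert[OF mJ] h_def mult_ac)
    finally show ?thesis .
  qed
  have "(\<integral>\<^sup>+ w. (indicator (cyl J B) w * (\<Prod>i\<in>insert m K. f i (w, Y i w))) * indicator A w \<partial>M) =
      (\<integral>\<^sup>+ w. g w * (f m (w, Y m w) * indicator A (fst (w, Y m w))) \<partial>M)"
    using insert.hyps by (intro nn_integral_cong) (simp add: g_def mult_ac)
  also have "\<dots> = (\<integral>\<^sup>+ w. h w * (f m (w, Y m w) * indicator A (fst (w, Y m w))) \<partial>M)"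
    by (rule nn_integral_graph_eqI[OF Ym gh fin eq fA])
  also have "\<dots> = (\<integral>\<^sup>+ w. indicator (cyl J B) w * (((\<Prod>i\<in>K. ?e i w) * indicator A w) * f m (w, Y m w)) \<partial>M)"
    by (intro nn_integral_cong) (simp add: h_def mult_ac)
  also have "\<dots> = (\<integral>\<^sup>+ w. indicator (cyl J B) w * (((\<Prod>i\<in>K. ?e i w) * indicator A w) * ?e m w) \<partial>M)"
    using insert.prems by (intro cylinder_swap) auto
  also have "\<dots> = (\<integral>\<^sup>+ w. (indicator (cyl J B) w * (\<Prod>i\<in>insert m K. ?e i w)) * indicator A w \<partial>M)"
    using insert.hyps by (intro nn_integral_cong) (simp add: mult_ac)
  finally show ?case .
qed

text \<open>Truncation at \<open>N\<close> makes the factors bounded and only decreases their conditional expectations; Fatou's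
  lemma removes the truncation.\<close>

lemma product_integral_le:
  fixes f :: "'i \<Rightarrow> 'w \<times> real \<Rightarrow> real"
  assumes f: "\<And>i. i \<in> S \<Longrightarrow> f i \<in> borel_measurable (F \<Otimes>\<^sub>M borel)"
    and le: "\<And>i. i \<in> S \<Longrightarrow> AE w in M. nn_cond_exp M F (\<lambda>w. ennreal (f i (w, Y i w))) w \<le> 1"
    and A [measurable]: "A \<in> sets F"
  shows "(\<integral>\<^sup>+ w. (\<Prod>i\<in>S. ennreal (f i (w, Y i w))) * indicator A w \<partial>M) \<le> emeasure M A"
proof -
  define u where "u = (\<lambda>(N::nat) i z. ennreal (min (real N) (f i z)))"
  have u [measurable]: "u N i \<in> borel_measurable (F \<Otimes>\<^sub>M borel)" if "i \<in> S" for N i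
    using f[OF that] unfolding u_def by measurable
  have fY: "(\<lambda>w. f i (w, Y i w)) \<in> borel_measurable M" if "i \<in> S" for i
    using measurable_compose[OF graph_measurable[OF Y_measurable] f] that by blast
  have uY: "(\<lambda>w. u N i (w, Y i w)) \<in> borel_measurable M" if "i \<in> S" for i N
    using measurable_compose[OF graph_measurable[OF Y_measurable] u] that by blast
  have bound: "(\<integral>\<^sup>+ w. (\<Prod>i\<in>S. u N i (w, Y i w)) * indicator A w \<partial>M) \<le> emeasure M A" for N
  proof -
    have all: "indicator (cyl {} B) w = (1::ennreal)" if "w \<in> space M" for w B
      using that by (simp add: cyl_def)
    have "(\<integral>\<^sup>+ w. (\<Prod>i\<in>S. u N i (w, Y i w)) * indicator A w \<partial>M) =
        (\<integral>\<^sup>+ w. (indicator (cyl {} (\<lambda>_. UNIV)) w * (\<Prod>i\<in>S. u N i (w, Y i w))) * indicator A w \<partial>M)"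
      by (intro nn_integral_cong) (simp add: all)
    also have "\<dots> = (\<integral>\<^sup>+ w. (indicator (cyl {} (\<lambda>_. UNIV)) w * (\<Prod>i\<in>S. nn_cond_exp M F (\<lambda>w. u N i (w, Y i w)) w)) * indicator A w \<partial>M)"
      by (rule product_swap[where c = "real N"]) (auto simp: u_def intro!: ennreal_leI f borel_measurable_min measurable_compose[OF _ measurable_ennreal])
    also have "\<dots> \<le> (\<integral>\<^sup>+ w. indicator A w \<partial>M)"
    proof (rule nn_integral_mono_AE)
      have "AE w in M. \<forall>i\<in>S. nn_cond_exp M F (\<lambda>w. u N i (w, Y i w)) w \<le> 1"
      proof (rule AE_finite_allI[OF S])
        fix i assume i: "i \<in> S"
        have "AE w in M. nn_cond_exp M F (\<lambda>w. u N i (w, Y i w)) w \<le> nn_cond_exp M F (\<lambda>w. ennreal (f i (w, Y i w))) w"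
          using i fY uY by (intro nn_cond_exp_mono) (auto simp: u_def intro!: ennreal_leI)
        with le[OF i] show "AE w in M. nn_cond_exp M F (\<lambda>w. u N i (w, Y i w)) w \<le> 1" by eventually_elim simp
      qed
      then show "AE w in M. (indicator (cyl {} (\<lambda>_. UNIV)) w * (\<Prod>i\<in>S. nn_cond_exp M F (\<lambda>w. u N i (w, Y i w)) w)) * indicator A w
        \<le> (indicator A w :: ennreal)"
      proof eventually_elim
        case (elim w)
        then have "(\<Prod>i\<in>S. nn_cond_exp M F (\<lambda>w. u N i (w, Y i w)) w) \<le> (\<Prod>i\<in>S. 1)"
          by (intro prod_mono_ennreal) auto
        then show ?case by (auto simp: indicator_def)
      qed
    qed
    finally show ?thesis by simp
  qed
  have "(\<integral>\<^sup>+ w. (\<Prod>i\<in>S. ennreal (f i (w, Y i w))) * indicator A w \<partial>M)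
      \<le> (\<integral>\<^sup>+ w. liminf (\<lambda>N. (\<Prod>i\<in>S. u N i (w, Y i w)) * indicator A w) \<partial>M)"
  proof (rule nn_integral_mono)
    fix w
    have "eventually (\<lambda>N. \<forall>i\<in>S. f i (w, Y i w) \<le> real N) sequentially"
      using S by (simp add: eventually_ball_finite_distrib)
        (meson eventually_sequentiallyI real_nat_ceiling_ge of_nat_le_iff order_trans)
    then have "eventually (\<lambda>N. (\<Prod>i\<in>S. ennreal (f i (w, Y i w))) * indicator A w \<le> (\<Prod>i\<in>S. u N i (w, Y i w)) * indicator A w) sequentially"
      by eventually_elim (simp add: u_def min_absorb2)
    then show "(\<Prod>i\<in>S. ennreal (f i (w, Y i w))) * indicator A w \<le> liminf (\<lambda>N. (\<Prod>i\<in>S. u N i (w, Y i w)) * indicator A w)"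
      by (rule Liminf_bounded)
  qed
  also have "\<dots> \<le> liminf (\<lambda>N. \<integral>\<^sup>+ w. (\<Prod>i\<in>S. u N i (w, Y i w)) * indicator A w \<partial>M)"
    using uY by (intro nn_integral_liminf borel_measurable_times_ennreal borel_measurable_prod_ennreal) auto
  also have "\<dots> \<le> emeasure M A"
    using bound by (intro Liminf_le) auto
  finally show ?thesis .
qed

end

section \<open>Sub-Gaussian noise with design-dependent weights\<close>

context prob_subalgebra
begin

text \<open>On each of the finitely many pieces where \<open>c\<close> is constant, the bound for that constant applies.\<close>

lemma mgf_simple_coefficient:
  assumes \<xi> [measurable]: "\<xi> \<in> borel_measurable M"
    and mgf: "\<And>t. AE w in M. nn_cond_exp M F (\<lambda>w. ennreal (exp (t * \<xi> w))) w \<le> ennreal (exp (\<sigma>\<^sup>2 * t\<^sup>2 / 2))"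
    and c: "simple_function F c" and A [measurable]: "A \<in> sets F"
  shows "(\<integral>\<^sup>+ w. indicator A w * ennreal (exp (c w * \<xi> w - \<sigma>\<^sup>2 * (c w)\<^sup>2 / 2)) \<partial>M) \<le> emeasure M A"
proof -
  define T where "T = c ` space M"
  have T: "finite T" using simple_functionD(1)[OF c] by (simp add: T_def)
  define At where "At = (\<lambda>t. A \<inter> {w \<in> space M. c w = t})"
  have At [measurable]: "At t \<in> sets F" for t
  proof -
    have "At t = A \<inter> (c -` {t} \<inter> space F)" by (auto simp: At_def)
    then show ?thesis using simple_functionD(2)[OF c, of "{t}"] A by auto
  qed
  have split: "indicator A w * x (c w) = (\<Sum>t\<in>T. indicator (At t) w * x t)"
    if "w \<in> space M" for w and x :: "real \<Rightarrow> ennreal"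
  proof -
    have "(\<Sum>t\<in>T. indicator (At t) w * x t) = (\<Sum>t\<in>T. if t = c w then indicator A w * x t else 0)"
      using that by (intro sum.cong) (auto simp: At_def indicator_def)
    then show ?thesis using that T by (simp add: sum.delta' T_def)
  qed
  have "(\<integral>\<^sup>+ w. indicator A w * ennreal (exp (c w * \<xi> w - \<sigma>\<^sup>2 * (c w)\<^sup>2 / 2)) \<partial>M) =
      (\<integral>\<^sup>+ w. (\<Sum>t\<in>T. indicator (At t) w * ennreal (exp (t * \<xi> w - \<sigma>\<^sup>2 * t\<^sup>2 / 2))) \<partial>M)"
    by (intro nn_integral_cong split)
  also have "\<dots> = (\<Sum>t\<in>T. \<integral>\<^sup>+ w. indicator (At t) w * ennreal (exp (t * \<xi> w - \<sigma>\<^sup>2 * t\<^sup>2 / 2)) \<partial>M)"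
    by (intro nn_integral_sum) measurable
  also have "\<dots> \<le> (\<Sum>t\<in>T. \<integral>\<^sup>+ w. indicator (At t) w \<partial>M)"
  proof (rule sum_mono)
    fix t assume "t \<in> T"
    define K where "K = ennreal (exp (- (\<sigma>\<^sup>2 * t\<^sup>2 / 2)))"
    have K: "K * ennreal (exp (\<sigma>\<^sup>2 * t\<^sup>2 / 2)) = 1"
      by (simp add: K_def ennreal_mult[symmetric] mult_exp_exp)
    have "(\<integral>\<^sup>+ w. indicator (At t) w * ennreal (exp (t * \<xi> w - \<sigma>\<^sup>2 * t\<^sup>2 / 2)) \<partial>M) =
        (\<integral>\<^sup>+ w. (K * indicator (At t) w) * ennreal (exp (t * \<xi> w)) \<partial>M)"
      by (intro nn_integral_cong) (auto simp: K_def indicator_def ennreal_mult[symmetric] mult_exp_exp)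
    also have "\<dots> = (\<integral>\<^sup>+ w. (K * indicator (At t) w) * nn_cond_exp M F (\<lambda>w. ennreal (exp (t * \<xi> w))) w \<partial>M)"
      by (rule nn_cond_exp_intg[symmetric]) auto
    also have "\<dots> \<le> (\<integral>\<^sup>+ w. indicator (At t) w \<partial>M)"
    proof (rule nn_integral_mono_AE)
      show "AE w in M. (K * indicator (At t) w) * nn_cond_exp M F (\<lambda>w. ennreal (exp (t * \<xi> w))) w \<le> indicator (At t) w"
        using mgf[of t]
      proof eventually_elim
        case (elim w)
        then have "K * nn_cond_exp M F (\<lambda>w. ennreal (exp (t * \<xi> w))) w \<le> 1"
          by (metis K mult_left_mono zero_le)
        then show ?case by (auto simp: indicator_def)
      qed
    qed
    finally show "(\<integral>\<^sup>+ w. indicator (At t) w * ennreal (exp (t * \<xi> w - \<sigma>\<^sup>2 * t\<^sup>2 / 2)) \<partial>M) \<le> (\<integral>\<^sup>+ w. indicator (At t) w \<partial>M)" .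
  qed
  also have "\<dots> = (\<integral>\<^sup>+ w. (\<Sum>t\<in>T. indicator (At t) w) \<partial>M)"
    by (intro nn_integral_sum[symmetric]) measurable
  also have "\<dots> = (\<integral>\<^sup>+ w. indicator A w \<partial>M)"
    using split[of _ "\<lambda>_. 1"] by (intro nn_integral_cong) simp
  finally show ?thesis by simp
qed

text \<open>The exceptional null set of the bound for \<open>t\<close> depends on \<open>t\<close>, so a random \<open>t\<close> cannot be
  inserted directly. Approximation by simple functions and Fatou's lemma give the bound for the integrals over all sets of
  \<open>F\<close>, and these determine the conditional expectation.\<close>

lemma mgf_random_coefficient:
  assumes \<xi> [measurable]: "\<xi> \<in> borel_measurable M"
    and mgf: "\<And>t. AE w in M. nn_cond_exp M F (\<lambda>w. ennreal (exp (t * \<xi> w))) w \<le> ennreal (exp (\<sigma>\<^sup>2 * t\<^sup>2 / 2))"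
    and c [measurable]: "c \<in> borel_measurable F"
  shows "AE w in M. nn_cond_exp M F (\<lambda>w. ennreal (exp (c w * \<xi> w - \<sigma>\<^sup>2 * (c w)\<^sup>2 / 2))) w \<le> 1"
proof (rule AE_le_1_of_set_integrals)
  fix A assume A [measurable]: "A \<in> sets F"
  from borel_measurable_implies_sequence_metric[OF c]
  obtain s where s: "\<And>k. simple_function F (s k)" "\<And>w. w \<in> space M \<Longrightarrow> (\<lambda>k. s k w) \<longlonglongrightarrow> c w"
    using space_F by metis
  have [measurable]: "s k \<in> borel_measurable F" for k using s(1) by (rule borel_measurable_simple_function)
  define g where "g = (\<lambda>c w. ennreal (exp (c w * \<xi> w - \<sigma>\<^sup>2 * (c w)\<^sup>2 / 2)))"
  have [measurable]: "g u \<in> borel_measurable M" if "u \<in> borel_measurable F" for u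
    using F_measurable[OF that] unfolding g_def by measurable
  have "(\<integral>\<^sup>+ w. indicator A w * nn_cond_exp M F (g c) w \<partial>M) = (\<integral>\<^sup>+ w. indicator A w * g c w \<partial>M)"
    by (rule nn_cond_exp_intg) auto
  also have "\<dots> \<le> (\<integral>\<^sup>+ w. liminf (\<lambda>k. indicator A w * g (s k) w) \<partial>M)"
  proof (rule nn_integral_mono)
    fix w assume "w \<in> space M"
    then have "(\<lambda>k. g (s k) w) \<longlonglongrightarrow> g c w" unfolding g_def by (intro tendsto_intros s) auto
    then have "(\<lambda>k. indicator A w * g (s k) w) \<longlonglongrightarrow> indicator A w * g c w"
      by (intro tendsto_mult_ennreal tendsto_const) (auto simp: g_def indicator_def)
    then have "liminf (\<lambda>k. indicator A w * g (s k) w) = indicator A w * g c w"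
      by (intro lim_imp_Liminf) auto
    then show "indicator A w * g c w \<le> liminf (\<lambda>k. indicator A w * g (s k) w)" by simp
  qed
  also have "\<dots> \<le> liminf (\<lambda>k. \<integral>\<^sup>+ w. indicator A w * g (s k) w \<partial>M)"
    by (intro nn_integral_liminf) measurable
  also have "\<dots> \<le> emeasure M A"
    using mgf_simple_coefficient[OF \<xi> mgf s(1) A] by (intro Liminf_le) (auto simp: g_def)
  finally show "(\<integral>\<^sup>+ w. indicator A w * nn_cond_exp M F (\<lambda>w. ennreal (exp (c w * \<xi> w - \<sigma>\<^sup>2 * (c w)\<^sup>2 / 2))) w \<partial>M) \<le> emeasure M A"
    by (simp add: g_def)
qed auto

text \<open>The integral of \<open>exp \<xi> + exp (-\<xi>)\<close> is at most \<open>2\<close>, while the integrand is at least \<open>2\<close> with equality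
  only at \<open>\<xi> = 0\<close>.\<close>

lemma degenerate_noise:
  assumes \<xi> [measurable]: "\<xi> \<in> borel_measurable M"
    and mgf: "\<And>t. AE w in M. nn_cond_exp M F (\<lambda>w. ennreal (exp (t * \<xi> w))) w \<le> 1"
  shows "AE w in M. \<xi> w = 0"
proof (rule ccontr)
  assume "\<not> (AE w in M. \<xi> w = 0)"
  have strict: "2 < exp z + exp (- z)" if "z \<noteq> 0" for z :: real
  proof -
    have "exp z + exp (- z) = (exp (z / 2) - exp (- z / 2))\<^sup>2 + 2"
      by (simp add: power2_diff exp_double[symmetric] mult_exp_exp)
    moreover have "exp (z / 2) - exp (- z / 2) \<noteq> 0" using that by simp
    ultimately show ?thesis by simp
  qed
  then have weak: "2 \<le> exp z + exp (- z)" for z :: real by (cases "z = 0") (auto simp: less_imp_le)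
  have int: "(\<integral>\<^sup>+ w. ennreal (exp (t * \<xi> w)) \<partial>M) \<le> 1" for t
  proof -
    have "(\<integral>\<^sup>+ w. ennreal (exp (t * \<xi> w)) \<partial>M) = (\<integral>\<^sup>+ w. 1 * nn_cond_exp M F (\<lambda>w. ennreal (exp (t * \<xi> w))) w \<partial>M)"
      by (subst nn_cond_exp_intg) auto
    also have "\<dots> \<le> (\<integral>\<^sup>+ w. 1 \<partial>M)" using mgf[of t] by (intro nn_integral_mono_AE) auto
    finally show ?thesis by (simp add: emeasure_space_1)
  qed
  have "(\<integral>\<^sup>+ w. 2 \<partial>M) < (\<integral>\<^sup>+ w. ennreal (exp (\<xi> w) + exp (- \<xi> w)) \<partial>M)"
  proof (rule nn_integral_less)
    show "AE w in M. (2::ennreal) \<le> ennreal (exp (\<xi> w) + exp (- \<xi> w))"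
      using weak by (intro AE_I2) (metis ennreal_leI ennreal_numeral zero_le_numeral)
    show "\<not> (AE w in M. ennreal (exp (\<xi> w) + exp (- \<xi> w)) \<le> 2)"
    proof
      assume "AE w in M. ennreal (exp (\<xi> w) + exp (- \<xi> w)) \<le> 2"
      then have "AE w in M. \<xi> w = 0"
      proof eventually_elim
        case (elim w)
        then have "exp (\<xi> w) + exp (- \<xi> w) \<le> 2"
          by (metis ennreal_le_iff ennreal_numeral zero_le_numeral)
        then show ?case using strict[of "\<xi> w"] by force
      qed
      with \<open>\<not> (AE w in M. \<xi> w = 0)\<close> show False ..
    qed
  qed (auto simp: emeasure_space_1)
  also have "\<dots> = (\<integral>\<^sup>+ w. ennreal (exp (1 * \<xi> w)) \<partial>M) + (\<integral>\<^sup>+ w. ennreal (exp (-1 * \<xi> w)) \<partial>M)"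
    by (subst nn_integral_add[symmetric]) auto
  also have "\<dots> \<le> 1 + 1" by (intro add_mono int)
  finally show False by (simp add: emeasure_space_1)
qed

end

context cond_indep_sample
begin

abbreviation "noise i w \<equiv> Y i w - real_cond_exp M F (Y i) w"

lemma noise_measurable: "i \<in> S \<Longrightarrow> noise i \<in> borel_measurable M"
  using Y_measurable by measurable

lemma exponential_moment_le:
  assumes sub: "\<And>i. i \<in> S \<Longrightarrow> cond_subgaussian M F (Y i) \<sigma>"
    and c: "\<And>i. i \<in> S \<Longrightarrow> c i \<in> borel_measurable F" and A: "A \<in> sets F"
  shows "(\<integral>\<^sup>+ w. ennreal (exp (\<Sum>i\<in>S. c i w * noise i w - \<sigma>\<^sup>2 * (c i w)\<^sup>2 / 2)) * indicator A w \<partial>M) \<le> emeasure M A"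
proof -
  define f where "f = (\<lambda>i z. exp (c i (fst z) * (snd z - real_cond_exp M F (Y i) (fst z)) - \<sigma>\<^sup>2 * (c i (fst z))\<^sup>2 / 2))"
  have "(\<integral>\<^sup>+ w. (\<Prod>i\<in>S. ennreal (f i (w, Y i w))) * indicator A w \<partial>M) \<le> emeasure M A"
  proof (rule product_integral_le[OF _ _ A])
    fix i assume i: "i \<in> S"
    have [measurable]: "c i \<in> borel_measurable F" using c i by auto
    show "f i \<in> borel_measurable (F \<Otimes>\<^sub>M borel)" unfolding f_def by measurable
    show "AE w in M. nn_cond_exp M F (\<lambda>w. ennreal (f i (w, Y i w))) w \<le> 1"
      using mgf_random_coefficient[OF noise_measurable[OF i], of \<sigma> "c i"] sub[OF i]
      by (simp add: f_def cond_subgaussian_def)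
  qed
  moreover have "(\<Prod>i\<in>S. ennreal (f i (w, Y i w))) = ennreal (exp (\<Sum>i\<in>S. c i w * noise i w - \<sigma>\<^sup>2 * (c i w)\<^sup>2 / 2))" for w
    using S by (simp add: f_def exp_sum prod_ennreal)
  ultimately show ?thesis by simp
qed

text \<open>Chernoff's method with the usual optimal exponent \<open>\<theta> = s / (\<sigma>\<^sup>2 v)\<close>, for which the exponent at
  the threshold equals \<open>ln (1 / \<eta>)\<close>. On the set \<open>G\<close> where the weights are small, the indicator of the tail is
  strictly below \<open>\<eta>\<close> times the exponential, so the inequality of integrals is strict unless \<open>G\<close> is a null set. For
  \<open>\<sigma> = 0\<close> the threshold is \<open>0\<close> and the noise vanishes.\<close>

lemma weighted_noise_tail:
  assumes sub: "\<And>i. i \<in> S \<Longrightarrow> cond_subgaussian M F (Y i) \<sigma>" and \<sigma>: "0 \<le> \<sigma>"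
    and a: "\<And>i. i \<in> S \<Longrightarrow> a i \<in> borel_measurable F" and v: "0 < v" and \<eta>: "0 < \<eta>" "\<eta> < 1"
  shows "prob {w \<in> space M. (\<Sum>i\<in>S. (a i w)\<^sup>2) \<le> v \<and> \<sigma> * sqrt (2 * v * ln (1 / \<eta>)) < (\<Sum>i\<in>S. a i w * noise i w)} < \<eta>"
    (is "prob ?H < \<eta>")
proof (cases "\<sigma> = 0")
  case True
  have "AE w in M. \<forall>i\<in>S. noise i w = 0"
    using sub True by (intro AE_finite_allI[OF S] degenerate_noise noise_measurable) (auto simp: cond_subgaussian_def)
  then have "AE w in M. \<not> (\<sigma> * sqrt (2 * v * ln (1 / \<eta>)) < (\<Sum>i\<in>S. a i w * noise i w))"
    by eventually_elim (simp add: True)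
  then have "AE w in M. w \<notin> ?H" by eventually_elim simp
  moreover have "?H \<in> events"
    using a[THEN F_measurable] noise_measurable by measurable
  ultimately have "prob ?H = 0" by (simp add: prob_eq_0)
  then show ?thesis using \<eta> by simp
next
  case False
  then have \<sigma>: "0 < \<sigma>" using \<sigma> by simp
  define Lg where "Lg = ln (1 / \<eta>)"
  have Lg: "0 < Lg" using \<eta> by (simp add: Lg_def)
  define s where "s = \<sigma> * sqrt (2 * v * Lg)"
  have s: "0 < s" "s\<^sup>2 = 2 * \<sigma>\<^sup>2 * v * Lg" using \<sigma> v Lg by (auto simp: s_def power_mult_distrib)
  define \<theta> where "\<theta> = s / (\<sigma>\<^sup>2 * v)"
  have \<theta>: "0 < \<theta>" using s \<sigma> v by (simp add: \<theta>_def)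
  have opt: "\<theta> * s - \<sigma>\<^sup>2 * \<theta>\<^sup>2 * v / 2 = Lg"
    using s \<sigma> v by (simp add: \<theta>_def power2_eq_square field_simps)
  define G where "G = {w \<in> space F. (\<Sum>i\<in>S. (a i w)\<^sup>2) \<le> v}"
  have G [measurable]: "G \<in> sets F" unfolding G_def using a by measurable
  define Z where "Z = (\<lambda>w. \<Sum>i\<in>S. a i w * noise i w)"
  have Z [measurable]: "Z \<in> borel_measurable M" unfolding Z_def using a[THEN F_measurable] noise_measurable by measurable
  define H where "H = {w \<in> G. s < Z w}"
  have H: "?H = H" by (auto simp: H_def G_def Z_def s_def Lg_def)
  have "H = G \<inter> {w \<in> space M. s < Z w}" by (auto simp: H_def G_def)
  then have Hm [measurable]: "H \<in> sets M" by simp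
  define u where "u = (\<lambda>w. \<Sum>i\<in>S. \<theta> * a i w * noise i w - \<sigma>\<^sup>2 * (\<theta> * a i w)\<^sup>2 / 2)"
  have [measurable]: "u \<in> borel_measurable M" unfolding u_def using a[THEN F_measurable] noise_measurable by measurable
  have u: "u w = \<theta> * Z w - \<sigma>\<^sup>2 * \<theta>\<^sup>2 * (\<Sum>i\<in>S. (a i w)\<^sup>2) / 2" for w
    by (simp add: u_def Z_def sum_subtractf sum_distrib_left sum_divide_distrib power_mult_distrib mult_ac)
  have uH: "Lg < u w" if "w \<in> H" for w
  proof -
    have "\<sigma>\<^sup>2 * \<theta>\<^sup>2 * (\<Sum>i\<in>S. (a i w)\<^sup>2) \<le> \<sigma>\<^sup>2 * \<theta>\<^sup>2 * v"
      using that by (intro mult_left_mono) (auto simp: H_def G_def)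
    moreover have "\<theta> * s < \<theta> * Z w" using that \<theta> by (simp add: H_def)
    ultimately show ?thesis using opt unfolding u by linarith
  qed
  have expLg: "\<eta> * exp Lg = 1" using \<eta> by (simp add: Lg_def)
  have strict: "indicator H w < ennreal (\<eta> * exp (u w))" for w
  proof (cases "w \<in> H")
    case True
    then have "\<eta> * exp Lg < \<eta> * exp (u w)" using uH[of w] \<eta> by simp
    then show ?thesis using True expLg by (simp add: ennreal_lessI flip: ennreal_1)
  qed (use \<eta> in auto)
  show ?thesis
  proof (cases "AE w in M. w \<notin> G")
    case True
    then have "AE w in M. w \<notin> H" by eventually_elim (simp add: H_def)
    then have "prob H = 0" by (simp add: prob_eq_0)
    then show ?thesis using H \<eta> by simp
  next
    case False
    have "emeasure M H = (\<integral>\<^sup>+ w. indicator H w \<partial>M)" by simp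
    also have "\<dots> < (\<integral>\<^sup>+ w. ennreal (\<eta> * exp (u w)) * indicator G w \<partial>M)"
    proof (rule nn_integral_less)
      have "indicator H w \<le> ennreal (\<eta> * exp (u w)) * indicator G w" for w
        using strict[of w] by (cases "w \<in> G") (auto simp: H_def)
      then show "AE w in M. indicator H w \<le> ennreal (\<eta> * exp (u w)) * indicator G w" by simp
      show "\<not> (AE w in M. ennreal (\<eta> * exp (u w)) * indicator G w \<le> indicator H w)"
      proof
        assume "AE w in M. ennreal (\<eta> * exp (u w)) * indicator G w \<le> indicator H w"
        then have "AE w in M. w \<notin> G"
        proof eventually_elim
          case (elim w)
          then show ?case using strict[of w] by (auto simp: not_le[symmetric])
        qed
        with False show False ..
      qed
    qed (auto simp: emeasure_eq_measure)
    also have "\<dots> = ennreal \<eta> * (\<integral>\<^sup>+ w. ennreal (exp (u w)) * indicator G w \<partial>M)"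
      using \<eta> by (subst nn_integral_cmult[symmetric]) (auto simp: ennreal_mult mult.assoc)
    also have "\<dots> \<le> ennreal \<eta> * emeasure M G"
      using exponential_moment_le[OF sub, of "\<lambda>i w. \<theta> * a i w" G] a
      by (intro mult_left_mono) (auto simp: u_def)
    also have "\<dots> \<le> ennreal \<eta> * 1" by (intro mult_left_mono) (auto simp: emeasure_eq_measure)
    finally show ?thesis using \<eta> H by (simp add: emeasure_eq_measure ennreal_less_iff)
  qed
qed

text \<open>Union bound over the \<open>d\<close> coordinates and the two signs, each at level \<open>\<delta> / (2 d)\<close>.\<close>

lemma noise_event:
  fixes X :: "'i \<Rightarrow> 'w \<Rightarrow> real ^ 'd"
  assumes sub: "\<And>i. i \<in> S \<Longrightarrow> cond_subgaussian M F (Y i) \<sigma>" and \<sigma>: "0 \<le> \<sigma>"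
    and X: "\<And>i. i \<in> S \<Longrightarrow> X i \<in> borel_measurable F" and v: "0 < v" and \<delta>: "0 < \<delta>" "\<delta> < 1"
  obtains E where "E \<in> events" "1 - \<delta> < prob E"
    "\<And>w j. w \<in> E \<Longrightarrow> (\<Sum>i\<in>S. (X i w $ j)\<^sup>2) \<le> v \<Longrightarrow>
      \<bar>\<Sum>i\<in>S. X i w $ j * noise i w\<bar> \<le> \<sigma> * sqrt (2 * v * ln (2 * real CARD('d) / \<delta>))"
proof -
  define \<eta> where "\<eta> = \<delta> / (2 * real CARD('d))"
  have d: "1 \<le> real CARD('d)" by (simp add: Suc_leI)
  then have "\<delta> < 2 * real CARD('d)" using \<delta> by linarith
  then have \<eta>: "0 < \<eta>" "\<eta> < 1" using \<delta> by (simp_all add: \<eta>_def)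
  define s where "s = \<sigma> * sqrt (2 * v * ln (1 / \<eta>))"
  define Bad where "Bad = (\<lambda>(j, \<epsilon>::real). {w \<in> space M. (\<Sum>i\<in>S. (\<epsilon> * X i w $ j)\<^sup>2) \<le> v \<and> s < (\<Sum>i\<in>S. \<epsilon> * X i w $ j * noise i w)})"
  define Q where "Q = (UNIV :: 'd set) \<times> {1, -1 :: real}"
  have Q: "finite Q" "card Q = 2 * CARD('d)" "Q \<noteq> {}" by (auto simp: Q_def card_cartesian_product)
  have comp: "(\<lambda>w. \<epsilon> * X i w $ j) \<in> borel_measurable F" if "i \<in> S" for i j and \<epsilon> :: real
    using X[OF that] by (intro borel_measurable_times borel_measurable_const measurable_compose[OF _ borel_measurable_nth])
  have Bad_m: "Bad z \<in> events" for z
  proof (cases z)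
    case (Pair j \<epsilon>)
    have 1: "(\<lambda>w. \<epsilon> * X i w $ j) \<in> borel_measurable M" if "i \<in> S" for i using F_measurable[OF comp[OF that]] .
    have "(\<lambda>w. \<Sum>i\<in>S. (\<epsilon> * X i w $ j)\<^sup>2) \<in> borel_measurable M" "(\<lambda>w. \<Sum>i\<in>S. \<epsilon> * X i w $ j * noise i w) \<in> borel_measurable M"
      using 1 noise_measurable by (auto intro!: borel_measurable_sum borel_measurable_power borel_measurable_times)
    then show ?thesis unfolding Bad_def Pair prod.case by measurable
  qed
  have lt: "prob (Bad z) < \<eta>" if "z \<in> Q" for z
    using weighted_noise_tail[OF sub \<sigma>, of "\<lambda>i w. snd z * X i w $ fst z" v \<eta>] comp v \<eta>
    by (simp add: Bad_def s_def case_prod_unfold)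
  have "prob (\<Union>z\<in>Q. Bad z) \<le> (\<Sum>z\<in>Q. prob (Bad z))"
    using Q Bad_m by (intro finite_measure_subadditive_finite) auto
  also have "\<dots> < (\<Sum>z\<in>Q. \<eta>)" using lt Q by (intro sum_strict_mono) auto
  also have "\<dots> = \<delta>" using Q d by (simp add: \<eta>_def)
  finally have P: "prob (\<Union>z\<in>Q. Bad z) < \<delta>" .
  have Bad_U: "(\<Union>z\<in>Q. Bad z) \<in> events" using Q Bad_m by auto
  show thesis
  proof (rule that[of "space M - (\<Union>z\<in>Q. Bad z)"])
    show "space M - (\<Union>z\<in>Q. Bad z) \<in> events" using Bad_U by auto
    show "1 - \<delta> < prob (space M - (\<Union>z\<in>Q. Bad z))" using P Bad_U by (simp add: prob_compl)
    fix w j assume w: "w \<in> space M - (\<Union>z\<in>Q. Bad z)" and le: "(\<Sum>i\<in>S. (X i w $ j)\<^sup>2) \<le> v"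
    have "w \<notin> Bad (j, 1)" "w \<notin> Bad (j, -1)" using w by (auto simp: Q_def)
    then have "(\<Sum>i\<in>S. X i w $ j * noise i w) \<le> s" "- (\<Sum>i\<in>S. X i w $ j * noise i w) \<le> s"
      using w le by (auto simp: Bad_def not_less sum_negf)
    then show "\<bar>\<Sum>i\<in>S. X i w $ j * noise i w\<bar> \<le> \<sigma> * sqrt (2 * v * ln (2 * real CARD('d) / \<delta>))"
      by (simp add: s_def \<eta>_def)
  qed
qed

end

section \<open>The deviation bounds with high probability\<close>

lemma subalgebra_design_alg:
  assumes "\<And>i. i \<in> {1..n} \<Longrightarrow> x i \<in> borel_measurable M"
  shows "subalgebra M (design_alg M n x)"
  unfolding design_alg_def subalgebra_def
proof safe
  have "(\<lambda>w. \<lambda>i\<in>{1..n}. x i w) \<in> measurable M (Pi\<^sub>M {1..n} (\<lambda>_. borel))"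
    using assms by (intro measurable_restrict) auto
  then show "A \<in> sets M" if "A \<in> sets (vimage_algebra (space M) (\<lambda>w. \<lambda>i\<in>{1..n}. x i w) (Pi\<^sub>M {1..n} (\<lambda>_. borel)))" for A
    using that measurable_sets by (auto simp: sets_vimage_algebra2 space_PiM)
qed auto

lemma design_measurable:
  assumes "i \<in> {1..n}"
  shows "x i \<in> borel_measurable (design_alg M n x)"
proof -
  have "(\<lambda>w. \<lambda>i\<in>{1..n}. x i w) \<in> measurable (design_alg M n x) (Pi\<^sub>M {1..n} (\<lambda>_. borel))"
    unfolding design_alg_def by (rule measurable_vimage_algebra1) (auto simp: space_PiM)
  from measurable_compose[OF this measurable_component_singleton[OF assms]] show ?thesis
    using assms by simp
qed

theorem theorem4p1:
  fixes M :: "'w measure" and n :: nat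
    and x :: "nat \<Rightarrow> 'w \<Rightarrow> real ^ 'd" and y :: "nat \<Rightarrow> 'w \<Rightarrow> real"
    and \<sigma> lam a \<delta> :: real and bhat :: "'w \<Rightarrow> real ^ 'd" and bbar :: "real ^ 'd"
  assumes "prob_space M" and "n \<ge> 1"
    and "\<And>i. i \<in> {1..n} \<Longrightarrow> x i \<in> borel_measurable M"
    and "\<And>i. i \<in> {1..n} \<Longrightarrow> y i \<in> borel_measurable M"
    and "cond_indep_vars M (design_alg M n x) y {1..n}"
    and "\<sigma> \<ge> 0"
    and "\<And>i. i \<in> {1..n} \<Longrightarrow> cond_subgaussian M (design_alg M n x) (y i) \<sigma>"
    and "lam \<ge> 0"
    and "AE w in M. lasso_solution n (\<lambda>i. x i w) (\<lambda>i. y i w) lam (bhat w)"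
    and "a > 0" and "0 < \<delta>" and "\<delta> < 1"
  shows "\<exists>E\<in>sets M. measure M E > 1 - \<delta> \<and> (\<forall>w\<in>E. \<forall>(k::nat) (l::nat) (t::real) (p::ereal). \<forall>q\<in>{1, p}.
    1 \<le> k \<and> k \<le> l \<and> real l \<le> (real CARD('d) - real k) / 2 \<and> 0 < t \<and> t < 1 \<and> 1 \<le> p \<longrightarrow>
    (let A = emp_mat n (\<lambda>i. x i w);
         lam_large = (lam \<ge> 4 * (2 - t) / t *
           (\<sigma> * a * sqrt (2 / real n * ln (2 * real CARD('d) / \<delta>)) +
            pnorm \<infinity> ((1 / real n) *\<^sub>R
              (\<Sum>i = 1..n. (bbar \<bullet> x i w - cond_mean M n x y i w) *\<^sub>R x i w))));
         diag_le = (sqrt (SUP j. A $ j $ j) \<le> a);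
         kqp = real k powr (inv_exp q - inv_exp p)
     in
      (ereal t \<le> 1 - ppi p A (k + l) l * ereal (real k powr (1 - inv_exp p) / real l) \<and>
       lam_large \<and> diag_le \<longrightarrow>
       ereal (pnorm q (bhat w - bbar)) \<le>
         eratio (ereal (8 * kqp)) (ereal t * omega p A (k + l)) *
           (rho p A (k + l) * ereal (tail_norm p k bbar) + ereal (real k powr inv_exp p * lam))
         + ereal (32 * kqp / t) * ppi p A (k + l) l * ereal (tail_norm 1 k bbar / real l)
         + ereal (4 * kqp * tail_norm p k bbar)
         + ereal (4 * tail_norm 1 k bbar * real l powr (inv_exp q - 1)))
      \<and>
      (ereal t \<le> 1 - gam p A (k + l) l * ereal (real k powr (1 - inv_exp p) / real l) \<and>
       lam_large \<and> diag_le \<longrightarrow>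
       ereal (pnorm q (bhat w - bbar)) \<le>
         ereal (8 * kqp / t) *
           (ereal 4 * gam p A (k + l) l * ereal (tail_norm 1 k bbar / real l)
            + eratio (ereal (lam * real (k + l) powr inv_exp p)) (mu p A (k + l)))
         + ereal (4 * tail_norm 1 k bbar * real l powr (inv_exp q - 1)))))"
proof -
  interpret prob_space M by fact
  define F where "F = design_alg M n x"
  have sub: "subalgebra M F" unfolding F_def using assms(3) by (rule subalgebra_design_alg)
  interpret cond_indep_sample M F y "{1..n}"
    using sub assms(5) by unfold_locales (simp_all add: F_def)
  have n: "0 < real n" using assms(2) by simp
  \<comment> \<open>A diagonal of \<open>A\<close> bounded by \<open>a\<^sup>2\<close> means that the squared entries of each column of the design sum to
  at most \<open>v\<close>.\<close>
  define v where "v = real n * a\<^sup>2"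
  have v: "0 < v" using n assms(10) by (simp add: v_def)
  define s where "s = \<sigma> * a * sqrt (2 / real n * ln (2 * real CARD('d) / \<delta>))"
  obtain E\<^sub>1 where E1: "E\<^sub>1 \<in> events" "1 - \<delta> < prob E\<^sub>1"
    "\<And>w j. w \<in> E\<^sub>1 \<Longrightarrow> (\<Sum>i = 1..n. (x i w $ j)\<^sup>2) \<le> v \<Longrightarrow>
      \<bar>\<Sum>i = 1..n. x i w $ j * noise i w\<bar> \<le> \<sigma> * sqrt (2 * v * ln (2 * real CARD('d) / \<delta>))"
    by (rule noise_event[OF assms(7)[folded F_def] assms(6) design_measurable[of _ n x M, folded F_def] v assms(11,12)])
      (assumption, assumption, rule that)
  have scale: "\<sigma> * sqrt (2 * v * ln (2 * real CARD('d) / \<delta>)) = real n * s"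
  proof -
    have "2 * v * ln (2 * real CARD('d) / \<delta>) = (real n * a)\<^sup>2 * (2 / real n * ln (2 * real CARD('d) / \<delta>))"
      using n by (simp add: v_def power2_eq_square)
    then have "sqrt (2 * v * ln (2 * real CARD('d) / \<delta>)) = real n * a * sqrt (2 / real n * ln (2 * real CARD('d) / \<delta>))"
      using n assms(10) by (simp only: real_sqrt_mult real_sqrt_abs) simp
    then show ?thesis by (simp add: s_def)
  qed
  obtain N where N: "N \<in> null_sets M" "{w \<in> space M. \<not> lasso_solution n (\<lambda>i. x i w) (\<lambda>i. y i w) lam (bhat w)} \<subseteq> N"
    using assms(9) by (auto elim!: AE_E)
  define E where "E = E\<^sub>1 - N"
  have E: "E \<in> events" "1 - \<delta> < prob E"
    using E1 N measure_Diff_null_set[OF E1(1) N(1)] by (auto simp: E_def)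
  have good: "\<bar>resid n (\<lambda>i. x i w) (\<lambda>i. y i w) bbar $ j\<bar> \<le> s + pnorm \<infinity> ((1 / real n) *\<^sub>R
              (\<Sum>i = 1..n. (bbar \<bullet> x i w - cond_mean M n x y i w) *\<^sub>R x i w))"
    if w: "w \<in> E" and diag: "sqrt (SUP j. emp_mat n (\<lambda>i. x i w) $ j $ j) \<le> a" for w j
  proof -
    define m where "m = (1 / real n) *\<^sub>R (\<Sum>i = 1..n. (bbar \<bullet> x i w - cond_mean M n x y i w) *\<^sub>R x i w)"
    have "emp_mat n (\<lambda>i. x i w) $ j $ j \<le> (SUP j. emp_mat n (\<lambda>i. x i w) $ j $ j)"
      by (intro cSUP_upper bdd_above_finite) auto
    also have "\<dots> \<le> a\<^sup>2" using diag by (rule sqrt_le_D)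
    finally have "(\<Sum>i = 1..n. (x i w $ j)\<^sup>2) \<le> v" using n by (simp add: emp_mat_diag v_def field_simps)
    then have "\<bar>\<Sum>i = 1..n. x i w $ j * noise i w\<bar> \<le> real n * s"
      using E1(3)[of w j] w scale by (simp add: E_def)
    then have "\<bar>1 / real n * (\<Sum>i = 1..n. x i w $ j * noise i w)\<bar> \<le> s"
      using n by (simp add: abs_mult field_simps)
    moreover have "resid n (\<lambda>i. x i w) (\<lambda>i. y i w) bbar $ j = m $ j - 1 / real n * (\<Sum>i = 1..n. x i w $ j * noise i w)"
    proof -
      have "(\<Sum>i = 1..n. (bbar \<bullet> x i w - y i w) * x i w $ j) =
          (\<Sum>i = 1..n. (bbar \<bullet> x i w - cond_mean M n x y i w) * x i w $ j) - (\<Sum>i = 1..n. x i w $ j * noise i w)"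
        unfolding sum_subtractf[symmetric] by (intro sum.cong) (simp_all add: cond_mean_def F_def algebra_simps)
      then show ?thesis by (simp add: resid_def m_def diff_divide_distrib)
    qed
    moreover have "\<bar>m $ j\<bar> \<le> pnorm \<infinity> m" by (simp add: pnorm_infinity component_le_infnorm_cart)
    ultimately show ?thesis unfolding m_def[symmetric] by linarith
  qed
  have sol: "lasso_solution n (\<lambda>i. x i w) (\<lambda>i. y i w) lam (bhat w)" if "w \<in> E" for w
    using that N E(1) sets.sets_into_space[OF E(1)] by (auto simp: E_def)
  show ?thesis
    unfolding Let_def
  proof (rule bexI[OF _ E(1)], intro conjI E(2) ballI allI impI, goal_cases)
    case (1 w k l t p q)
    then have w: "w \<in> E" and diag: "sqrt (SUP j. emp_mat n (\<lambda>i. x i w) $ j $ j) \<le> a" by blast+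
    from lasso_deviation_bound(1)[OF sol[OF w] assms(8) _ good[OF w diag], where t = t and k = k and l = l and p = p and q = q] 1
    show ?case unfolding s_def by blast
  next
    case (2 w k l t p q)
    then have w: "w \<in> E" and diag: "sqrt (SUP j. emp_mat n (\<lambda>i. x i w) $ j $ j) \<le> a" by blast+
    from lasso_deviation_bound(2)[OF sol[OF w] assms(8) _ good[OF w diag], where t = t and k = k and l = l and p = p and q = q] 2
    show ?case unfolding s_def by blast
  qed
qed

end
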